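(* Let $x>0$ and assume that all non-trivial zeros of $\zeta(s)$ are simple. Then there exists a sequence of positive numbers $(T_j)_{j\ge1}$ with $T_j\to\infty$ such that \[ \sum_{n=1}^\infty\frac{\lambda(n)}{n(x^2+n^2)}=-\pi x^{-5/2}\sum_{n=1}^\infty\frac{c(n)}{\sqrt{2n}}e^{-\pi nx/2}-\frac{\pi x^{-5/2}}{2\sqrt2\,\zeta(\frac12)}+\frac{2\pi^2}{x^2}\lim_{j\to\infty}\sum_{|\gamma_m|<T_j}\frac{\zeta(2\rho_m-1)\Gamma(2\rho_m-1)}{\zeta'(\rho_m)\Gamma(\rho_m)(2\pi x)^{\rho_m}}. \]
   Context: $\lambda(n)$ is the Liouville function ($\lambda(n)=(-1)^{a_1+\cdots+a_k}$ for $n=p_1^{a_1}\cdots p_k^{a_k}$). $c(n)=m\mu(k)$ if $n=m^2k$ with $k$ squarefree ($\mu$ Möbius); equivalently $\sum c(n)n^{-s}=\zeta(2s-1)/\zeta(s)$ for $\operatorname{Re}(s)>1$. Non-trivial zeros of $\zeta$ are $\rho_m=\beta_m+i\gamma_m$, $m\in\mathbb{Z}$, $\rho_{-m}=\beta_m-i\gamma_m$. *)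

theory Defs
  imports
    "HOL-Complex_Analysis.Complex_Analysis"
    "HOL-Computational_Algebra.Squarefree"
begin

text \<open>
  The exponent is the number of prime factors counted with multiplicity. The value at
  \<open>0\<close> is irrelevant.
\<close>
definition liouville :: "nat \<Rightarrow> int" where
  "liouville n = (- 1) ^ size (prime_factorization n)"

definition moebius :: "nat \<Rightarrow> int" where
  "moebius n = (if squarefree n then (- 1) ^ card (prime_factors n) else 0)"

text \<open>
  For \<open>n > 0\<close>, \<open>square_part n\<close> and \<open>squarefree_part n\<close> are the unique \<open>m\<close> and
  squarefree \<open>k\<close> with \<open>n = m\<^sup>2 * k\<close>.
\<close>
definition c_coeff :: "nat \<Rightarrow> int" where
  "c_coeff n = int (square_part n) * moebius (squarefree_part n)"

text \<open>
  The Riemann zeta function is the analytic continuation to \<open>\<complex> - {1}\<close> of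
  the series \<open>1 + 1 / 2\<^sup>s + 1 / 3\<^sup>s + \<dots>\<close>. It is unique because \<open>\<complex> - {1}\<close> is
  connected; the value at the pole \<open>1\<close> is fixed arbitrarily to make it unique as a total
  function.
\<close>
definition riemann_zeta :: "complex \<Rightarrow> complex" where
  "riemann_zeta = (THE f. f holomorphic_on (- {1}) \<and> f 1 = 0 \<and>
     (\<forall>s. Re s > 1 \<longrightarrow> (\<lambda>n. of_nat (Suc n) powr (- s)) sums f s))"

text \<open>
  The trivial zeros are \<open>-2, -4, -6, \<dots>\<close>. The point \<open>1\<close> is excluded because the value
  of \<^const>\<open>riemann_zeta\<close> there is only a convention.
\<close>
definition nontrivial_zeta_zeros :: "complex set" where
  "nontrivial_zeta_zeros =
     {\<rho>. \<rho> \<noteq> 1 \<and> riemann_zeta \<rho> = 0 \<and> (\<forall>k::nat. k \<ge> 1 \<longrightarrow> \<rho> \<noteq> - (2 * of_nat k))}"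

definition nontrivial_zeta_zeros_below :: "real \<Rightarrow> complex set" where
  "nontrivial_zeta_zeros_below T = {\<rho> \<in> nontrivial_zeta_zeros. \<bar>Im \<rho>\<bar> < T}"

end

theory Submission
  imports Defs "HOL-Probability.Levy" "HOL-Real_Asymp.Real_Asymp"
begin

text \<open>
  By the functional equation, the function
  \<open>zeta (2 * s - 1) * Gamma (2 * s - 1) / (zeta s * Gamma s * (2 * pi * x) powr s)\<close> equals
  \<open>zeta (2 - 2 * s) / (4 * pi * sin (pi * s / 2) * zeta (1 - s)) * x powr (- s)\<close>. In the second form it
  is expanded on the line \<open>Re s = -1/2\<close> with the Dirichlet series of the Liouville function, and termwise
  Mellin inversion gives the left-hand side of the theorem; in the first form it is expanded on \<open>Re s = 9/8\<close>
  with the Dirichlet series of \<open>c\<close>, which gives the exponential sum. The residues between the two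
  lines, at \<open>1/2\<close> and at the non-trivial zeros, account for the remaining terms.

  The horizontal sides of the rectangles tend to zero along heights that avoid the zeros: a
  minimum modulus argument on discs of fixed radius around \<open>2 + \<i> * T\<close>, where \<open>zeta\<close> has polynomial growth,
  bounds \<open>1 / zeta\<close> by \<open>exp (o T)\<close> on some line in every strip of height \<open>1\<close>, whereas
  \<open>1 / sin (pi * s / 2)\<close> decays like \<open>exp (- pi * T / 2)\<close>.

  The functional equation itself comes from the Mellin integral of \<open>1 / (exp x - 1)\<close>, expanded for
  \<open>-1 < Re s < 0\<close> by the partial fractions of the hyperbolic cotangent.
\<close>

subsection \<open>Zeta to the right of Re s = -1\<close>

text \<open>All growth estimates stay in the half-plane to the right of -1: for
  \<open>-1 < Re s < 3/2\<close> both \<open>1 - s\<close> and \<open>2 - 2 * s\<close> lie there,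
  so the kernel can be written with \<open>zeta_pre\<close> and is controlled by the trapezoidal
  series. The line -1/2 has \<open>Re (1 - s) = 3/2\<close>, where the Liouville series converges
  absolutely; 9/8 lies to the right of 1, as the series of \<open>c_coeff\<close> demands, and to
  the left of 3/2. The obstacle is the size of 1 / zeta between its zeros, which is not controlled
  at every height; this is why the sum over the zeros converges only along chosen heights. Near
  height T there are O(ln T) zeros, and some height in each unit interval keeps a distance of order
  1 / ln T from all of them. The resulting loss exp (O (ln T * ln ln T)) is harmless against exp (-
  pi * T / 2). Mellin inversion rests on positivity: \<open>exp (- exp v)\<close> and
  \<open>1 / (1 + exp (2 * v))\<close>, tilted by \<open>exp (\<sigma> * v)\<close>, are multiples
  of probability densities, so inversion theorems for characteristic functions apply.\<close>

definition zeta_term :: "nat \<Rightarrow> complex \<Rightarrow> complex" where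
  "zeta_term n s =
     (s - 1) * (of_nat (Suc n) powr (-s) + of_nat (Suc (Suc n)) powr (-s)) / 2
     - (of_nat (Suc n) powr (1 - s) - of_nat (Suc (Suc n)) powr (1 - s))"

text \<open>
  The function \<open>(s - 1) * zeta s\<close>, summed by the trapezoidal rule; multiplying by \<open>s - 1\<close> removes
  the pole, and the series converges for \<open>Re s > -1\<close>.
\<close>
definition zeta_pre :: "complex \<Rightarrow> complex" where
  "zeta_pre s = 1 + (s - 1) / 2 + (\<Sum>n. zeta_term n s)"

text \<open>Up to the factor \<open>s - 1\<close>, a term is the error of the trapezoidal rule for
  \<open>x powr (-s)\<close> on a unit interval, that is, the integral of half of
  \<open>(x - N) * (x - N - 1)\<close> against the second derivative. The polynomial factor is at
  most 1/8 in modulus, and differentiating twice gains two powers of \<open>N\<close>: this moves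
  convergence from \<open>Re s > 1\<close> to \<open>Re s > -1\<close>. The integral itself is
  replaced by the mean value inequality for a primitive \<open>P\<close>.\<close>

lemma zeta_term_bound:
  assumes "Re s \<ge> -2"
  shows "norm (zeta_term n s) \<le>
           norm s * norm (s + 1) * norm (s - 1) / 8 * real (Suc n) powr (- Re s - 2)"
proof -
  define N where "N = real (Suc n)"
  have N: "N > 0" by (simp add: N_def)
  \<comment> \<open>\<open>P\<close> comes from integrating the error of the trapezoidal rule by parts twice.\<close>
  define P where "P = (\<lambda>x::complex.
     (s - 1) * ((x - N) * (x - N - 1) / 2 * (-s * x powr (-s-1)) - (x - N - 1/2) * x powr (-s))
     - x powr (1 - s))"
  define P' where "P' = (\<lambda>x::complex. (s - 1) * (s * (s + 1)) * ((x - N) * (x - N - 1) / 2) * x powr (-s-2))"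
  let ?S = "closed_segment (of_real N) (of_real (N + 1)) :: complex set"
  have inS: "\<exists>u. x = of_real u \<and> N \<le> u \<and> u \<le> N + 1" if "x \<in> ?S" for x
  proof -
    from that obtain t where "0 \<le> t" "t \<le> 1" "x = of_real (N + t)"
      by (auto simp: closed_segment_def scaleR_conv_of_real algebra_simps)
    then show ?thesis by (intro exI[of _ "N + t"]) auto
  qed
  have deriv: "(P has_field_derivative P' x) (at x within ?S)" if "x \<in> ?S" for x
  proof -
    obtain u where u: "x = of_real u" "u > 0" using inS[OF \<open>x \<in> ?S\<close>] N by force
    then have nz: "x \<notin> \<real>\<^sub>\<le>\<^sub>0" by auto
    have x0: "x \<noteq> 0" using u by auto
    define X where "X = x powr (-s-2)"
    have e: "x powr (-s-1) = x * X" "x powr (-s) = x * (x * X)"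
      using x0 by (auto simp: X_def powr_diff power2_eq_square divide_simps)
    have "- 2 - s = - s - 2" by simp
    then have X': "x powr (-2-s) = X" unfolding X_def by (simp only:)
    note pd = has_field_derivative_at_within[OF has_field_derivative_powr[OF nz], of _ ?S]
    have D: "((\<lambda>x. x powr (-s-1)) has_field_derivative (-s-1) * X) (at x within ?S)"
            "((\<lambda>x. x powr (-s)) has_field_derivative (-s) * (x * X)) (at x within ?S)"
            "((\<lambda>x. x powr (1-s)) has_field_derivative (1-s) * (x * (x * X))) (at x within ?S)"
      using pd[of "-s-1"] pd[of "-s"] pd[of "1-s"] by (simp_all add: e X')
    have Dq: "((\<lambda>x. (x - N) * (x - N - 1) / 2) has_field_derivative (x - N - 1/2)) (at x within ?S)"
      by (auto intro!: derivative_eq_intros simp: field_simps)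
    have Dl: "((\<lambda>x. x - N - 1/2) has_field_derivative 1) (at x within ?S)"
      by (auto intro!: derivative_eq_intros)
    show ?thesis unfolding P_def P'_def X_def[symmetric]
      by (rule DERIV_cong[OF DERIV_diff[OF DERIV_cmult[OF DERIV_diff[OF
            DERIV_mult[OF Dq DERIV_cmult[OF D(1)]] DERIV_mult[OF Dl D(2)]]] D(3)]])
         (simp add: e field_simps)
  qed
  have bound: "norm (P' x) \<le> norm s * norm (s + 1) * norm (s - 1) / 8 * N powr (- Re s - 2)"
    if "x \<in> ?S" for x
  proof -
    obtain u where u: "x = of_real u" "N \<le> u" "u \<le> N + 1" using inS[OF \<open>x \<in> ?S\<close>] by auto
    have "(u - N) * (u - N - 1) = (u - N - 1/2)^2 - 1/4" by (simp add: power2_eq_square algebra_simps)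
    then have "(u - N) * (u - N - 1) \<ge> -1/4" by simp
    moreover have "(u - N) * (u - N - 1) \<le> 0" using u by (intro mult_nonneg_nonpos) auto
    ultimately have a: "\<bar>(u - N) * (u - N - 1) / 2\<bar> \<le> 1/8" by (simp add: abs_if)
    have "(x - N) * (x - N - 1) / 2 = of_real ((u - N) * (u - N - 1) / 2)" by (simp add: u)
    then have b: "norm ((x - N) * (x - N - 1) / 2) \<le> 1/8"
      using a by (simp only: norm_of_real)
    have c: "norm (x powr (-s-2)) = u powr (- Re s - 2)"
      using u N by (simp add: norm_powr_real_powr)
    have d: "u powr (- Re s - 2) \<le> N powr (- Re s - 2)"
      using u N assms by (intro powr_mono2') auto
    have "norm (P' x) = (norm s * norm (s+1) * norm (s-1)) * (norm ((x - N) * (x - N - 1) / 2) * norm (x powr (-s-2)))"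
      unfolding P'_def by (simp only: norm_mult mult_ac)
    also have "\<dots> \<le> (norm s * norm (s+1) * norm (s-1)) * (1/8 * N powr (- Re s - 2))"
      using b c d by (intro mult_left_mono mult_mono) auto
    finally show ?thesis by simp
  qed
  have "norm (P (of_real (N+1)) - P (of_real N)) \<le>
     (norm s * norm (s + 1) * norm (s - 1) / 8 * N powr (- Re s - 2)) * norm (of_real (N+1) - of_real N :: complex)"
    by (rule field_differentiable_bound[of ?S P P']) (use deriv bound in auto)
  also have "P (of_real (N+1)) - P (of_real N) = - zeta_term n s"
    unfolding P_def zeta_term_def N_def by (simp add: field_simps)
  finally show ?thesis by (simp add: N_def)
qed

lemma summable_Suc_powr: "a < -1 \<Longrightarrow> summable (\<lambda>n. real (Suc n) powr a)"
  using summable_real_powr_iff[of a] by (subst summable_Suc_iff) auto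

lemma zeta_term_summable:
  assumes "Re s > -1" shows "summable (\<lambda>n. norm (zeta_term n s))"
proof (rule summable_comparison_test')
  show "summable (\<lambda>n. norm s * norm (s + 1) * norm (s - 1) / 8 * real (Suc n) powr (- Re s - 2))"
    using assms by (intro summable_mult summable_Suc_powr) auto
  show "norm (norm (zeta_term n s)) \<le> norm s * norm (s + 1) * norm (s - 1) / 8 * real (Suc n) powr (- Re s - 2)"
    if "n \<ge> 0" for n using zeta_term_bound[of s n] assms by simp
qed

lemma zeta_term_holomorphic: "zeta_term n holomorphic_on A"
  unfolding zeta_term_def by (intro holomorphic_intros) auto

lemma zeta_pre_holomorphic: "zeta_pre holomorphic_on {s. Re s > -1}"
proof -
  have "(\<lambda>s. \<Sum>n. zeta_term n s) holomorphic_on {s. Re s > -1}"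
  proof (rule holomorphic_uniform_sequence)
    show "open {s. Re s > -1}" by (rule open_halfspace_Re_gt)
    show "(\<lambda>s. \<Sum>k<n. zeta_term k s) holomorphic_on {s. Re s > -1}" for n
      by (intro holomorphic_on_sum zeta_term_holomorphic)
    show "\<exists>d>0. cball x d \<subseteq> {s. Re s > -1} \<and>
          uniform_limit (cball x d) (\<lambda>n s. \<Sum>k<n. zeta_term k s) (\<lambda>s. \<Sum>n. zeta_term n s) sequentially"
      if "x \<in> {s. Re s > -1}" for x
    proof -
      define d where "d = (Re x + 1) / 2"
      have d: "d > 0" using that by (simp add: d_def)
      have re: "Re s \<ge> Re x - d" if "s \<in> cball x d" for s
        using abs_Re_le_cmod[of "x - s"] that by (auto simp: dist_norm)
      have nm: "norm s \<le> norm x + d" if "s \<in> cball x d" for s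
        using that norm_triangle_ineq2[of s x] by (auto simp: dist_norm norm_minus_commute)
      have sub: "cball x d \<subseteq> {s. Re s > -1}"
        using re that by (force simp: d_def field_simps)
      define C where "C = (norm x + d) * (norm x + d + 1) * (norm x + d + 1) / 8"
      have "uniform_limit (cball x d) (\<lambda>n s. \<Sum>k<n. zeta_term k s) (\<lambda>s. \<Sum>n. zeta_term n s) sequentially"
      proof (rule Weierstrass_m_test)
        show "summable (\<lambda>n. C * real (Suc n) powr (- (Re x - d) - 2))"
          using that by (intro summable_mult summable_Suc_powr) (auto simp: d_def field_simps)
        show "norm (zeta_term n s) \<le> C * real (Suc n) powr (- (Re x - d) - 2)"
          if "s \<in> cball x d" for n s
        proof -
          have "Re s \<ge> -2" using sub that by force
          note zeta_term_bound[OF this, of n]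
          also have "norm s * norm (s + 1) * norm (s - 1) / 8 * real (Suc n) powr (- Re s - 2)
                      \<le> C * real (Suc n) powr (- (Re x - d) - 2)"
            unfolding C_def
          proof (intro mult_mono divide_right_mono)
            show "norm (s + 1) \<le> norm x + d + 1" "norm (s - 1) \<le> norm x + d + 1"
              using nm[OF that] norm_triangle_ineq[of s 1] norm_triangle_ineq4[of s 1] by auto
            show "real (Suc n) powr (- Re s - 2) \<le> real (Suc n) powr (- (Re x - d) - 2)"
              using re[OF that] by (intro powr_mono) auto
          qed (use nm[OF that] d in auto)
          finally show ?thesis .
        qed
      qed
      with d sub show ?thesis by blast
    qed
  qed
  then show ?thesis unfolding zeta_pre_def by (intro holomorphic_intros) auto
qed

text \<open>The three factors of size \<open>norm s\<close> in the bound of a term give the cube.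
  The line -3/4 leaves the summable exponent -5/4 and lies to the left of every point at which the
  bound is used.\<close>

lemma zeta_pre_bound:
  obtains K where "K > 0" "\<And>s. Re s \<ge> -3/4 \<Longrightarrow> norm (zeta_pre s) \<le> K * (1 + norm s) ^ 3"
proof -
  define K where "K = (\<Sum>n. real (Suc n) powr (-5/4)) / 8"
  have sm: "summable (\<lambda>n. real (Suc n) powr (-5/4))" by (rule summable_Suc_powr) auto
  have K: "K \<ge> 0" unfolding K_def using sm by (intro divide_nonneg_pos suminf_nonneg) auto
  have "norm (zeta_pre s) \<le> (2 + K) * (1 + norm s) ^ 3" if s: "Re s \<ge> -3/4" for s
  proof -
    let ?B = "norm s * norm (s + 1) * norm (s - 1)"
    have sum1: "summable (\<lambda>n. norm (zeta_term n s))" using s by (intro zeta_term_summable) auto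
    have "norm (\<Sum>n. zeta_term n s) \<le> (\<Sum>n. norm (zeta_term n s))"
      by (rule summable_norm[OF sum1])
    also have "\<dots> \<le> (\<Sum>n. ?B / 8 * real (Suc n) powr (-5/4))"
    proof (rule suminf_le)
      show "norm (zeta_term n s) \<le> ?B / 8 * real (Suc n) powr (-5/4)" for n
      proof -
        have "norm (zeta_term n s) \<le> ?B / 8 * real (Suc n) powr (-Re s - 2)"
          using s by (intro zeta_term_bound) auto
        also have "\<dots> \<le> ?B / 8 * real (Suc n) powr (-5/4)"
          using s by (intro mult_left_mono powr_mono) auto
        finally show ?thesis .
      qed
    qed (use sum1 sm in \<open>auto intro!: summable_mult\<close>)
    also have "\<dots> = ?B * K" using suminf_mult[OF sm, of "?B/8"] by (simp add: K_def)
    also have "?B \<le> (1 + norm s) * (1 + norm s) * (1 + norm s)"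
      using norm_triangle_ineq[of s 1] norm_triangle_ineq4[of s 1] by (intro mult_mono) auto
    finally have 1: "norm (\<Sum>n. zeta_term n s) \<le> (1 + norm s) ^ 3 * K"
      using K by (simp add: power3_eq_cube mult_right_mono)
    have "norm (zeta_pre s) \<le> norm (1 + (s-1)/2) + norm (\<Sum>n. zeta_term n s)"
      unfolding zeta_pre_def by (rule norm_triangle_ineq)
    moreover have "norm (1 + (s-1)/2) \<le> 1 + (norm s + 1) / 2"
    proof -
      have "norm (1 + (s-1)/2) \<le> 1 + norm (s - 1) / 2"
        using norm_triangle_ineq[of 1 "(s-1)/2"] by (simp add: norm_divide)
      moreover have "norm (s - 1) \<le> norm s + 1" using norm_triangle_ineq4[of s 1] by simp
      ultimately show ?thesis by argo
    qed
    moreover have "1 + (norm s + 1) / 2 \<le> 2 * (1 + norm s) ^ 3"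
    proof -
      have "1 + norm s \<le> (1 + norm s) ^ 3" using self_le_power[of "1 + norm s" 3] by simp
      then show ?thesis using norm_ge_zero[of s] by argo
    qed
    ultimately show ?thesis using 1 by (simp add: algebra_simps)
  qed
  with K show ?thesis by (intro that[of "2 + K"]) auto
qed

lemma zeta_term_partial_sums:
  "(\<Sum>k<N. zeta_term k s) =
     (s - 1) * ((\<Sum>k<N. of_nat (Suc k) powr (-s)) - 1 / 2 + of_nat (Suc N) powr (-s) / 2)
     - 1 + of_nat (Suc N) powr (1 - s)"
proof (induction N)
  case (Suc N)
  show ?case unfolding sum.lessThan_Suc Suc.IH
    unfolding zeta_term_def by (simp add: field_simps)
qed (simp add: field_simps)

lemma Suc_powr_tendsto_0:
  assumes "Re a < 0" shows "(\<lambda>N. of_nat (Suc N) powr a :: complex) \<longlonglongrightarrow> 0"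
proof (rule tendsto_norm_zero_cancel)
  have "(\<lambda>N. real (Suc N) powr Re a) \<longlonglongrightarrow> 0"
    using assms by real_asymp
  then show "(\<lambda>N. norm (of_nat (Suc N) powr a :: complex)) \<longlonglongrightarrow> 0"
    using norm_powr_real_powr'[of "of_nat (Suc _)" a] by (simp add: norm_powr_real_powr del: of_nat_Suc)
qed

lemma zeta_pre_sums:
  assumes "Re s > 1"
  shows "(\<lambda>n. of_nat (Suc n) powr (-s)) sums (zeta_pre s / (s - 1))"
proof -
  have s1: "s \<noteq> 1" using assms by auto
  have "(\<lambda>N. \<Sum>k<N. zeta_term k s) \<longlonglongrightarrow> (\<Sum>n. zeta_term n s)"
    using summable_LIMSEQ[OF summable_norm_cancel[OF zeta_term_summable[of s]]] assms by simp
  then have "(\<lambda>N. ((\<Sum>k<N. zeta_term k s) + 1 - of_nat (Suc N) powr (1 - s)) / (s - 1) + 1/2 - of_nat (Suc N) powr (-s) / 2)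
     \<longlonglongrightarrow> ((\<Sum>n. zeta_term n s) + 1 - 0) / (s - 1) + 1/2 - 0 / 2"
    using assms s1 by (intro tendsto_intros Suc_powr_tendsto_0) auto
  moreover have "((\<Sum>k<N. zeta_term k s) + 1 - of_nat (Suc N) powr (1 - s)) / (s - 1) + 1/2 - of_nat (Suc N) powr (-s) / 2
      = (\<Sum>k<N. of_nat (Suc k) powr (-s))" for N
    using s1 unfolding zeta_term_partial_sums by (simp add: field_simps)
  moreover have "((\<Sum>n. zeta_term n s) + 1 - 0) / (s - 1) + 1/2 - 0 / 2 = zeta_pre s / (s - 1)"
    using s1 by (simp add: zeta_pre_def field_simps)
  ultimately show ?thesis unfolding sums_def by simp
qed

lemma zeta_pre_1 [simp]: "zeta_pre 1 = 1"
proof -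
  have "zeta_term n 1 = 0" for n
    unfolding zeta_term_def by (simp del: of_nat_Suc)
  then show ?thesis by (simp add: zeta_pre_def)
qed

text \<open>The trapezoidal rule is exact for the constant function, so all terms vanish at 0. This
  gives zeta (0) = -1/2, and together with the value at 1 it shows that \<open>zeta_pre\<close> is
  not constant.\<close>

lemma zeta_pre_0 [simp]: "zeta_pre 0 = 1 / 2"
proof -
  have "zeta_term n 0 = 0" for n
    unfolding zeta_term_def by (simp del: of_nat_Suc) simp
  then show ?thesis by (simp add: zeta_pre_def)
qed

text \<open>The theorem divides by zeta (1/2). The part of \<open>zeta_pre\<close> outside the
  series is 3/4 at this point, and the term bound with constant 3/64 keeps the series below 3/4 in
  modulus.\<close>

lemma zeta_pre_half: "zeta_pre (1/2) \<noteq> 0"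
proof -
  have sm: "summable (\<lambda>n. 3 / 64 * (1 / real (Suc n) ^ 2))"
    using inverse_squares_sums by (intro summable_mult) (simp add: sums_iff)
  have b: "norm (zeta_term n (1/2)) \<le> 3 / 64 * (1 / real (Suc n) ^ 2)" for n
  proof -
    have "norm (zeta_term n (1/2)) \<le> 1/2 * (3/2) * (1/2) / 8 * real (Suc n) powr (-1/2-2)"
      using zeta_term_bound[of "1/2" n] by simp
    also have "real (Suc n) powr (-1/2-2) \<le> real (Suc n) powr (-2)" by (intro powr_mono) auto
    also have "\<dots> = 1 / real (Suc n) ^ 2" by (simp add: powr_minus powr_numeral divide_simps)
    finally show ?thesis by simp
  qed
  have sm': "summable (\<lambda>n. norm (zeta_term n (1/2)))" by (intro zeta_term_summable) auto
  have "norm (\<Sum>n. zeta_term n (1/2)) \<le> (\<Sum>n. norm (zeta_term n (1/2)))"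
    by (rule summable_norm[OF sm'])
  also have "\<dots> \<le> (\<Sum>n. 3 / 64 * (1 / real (Suc n) ^ 2))" by (rule suminf_le[OF b sm' sm])
  also have "\<dots> = 3 / 64 * (pi\<^sup>2 / 6)"
    using inverse_squares_sums by (subst suminf_mult) (auto simp: sums_iff)
  also have "pi\<^sup>2 < 4\<^sup>2" using pi_less_4 by (intro power_strict_mono) auto
  finally have "norm (\<Sum>n. zeta_term n (1/2)) < 3 / 4" by simp
  moreover have "norm (- 3/4 :: complex) = 3/4" by simp
  ultimately have "(\<Sum>n. zeta_term n (1/2)) \<noteq> - 3/4" by (metis less_irrefl)
  then show ?thesis by (auto simp: zeta_pre_def add_eq_0_iff)
qed

subsection \<open>Mellin integrals on the real line\<close>

text \<open>Differentiation under the integral sign. Cauchy's inequality on discs of radius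
  \<open>r\<close> turns the majorant \<open>g\<close> into the majorant \<open>g x / r\<close> of
  the derivative, hence of the difference quotients, and dominated convergence applies. With
  \<open>r = e / 2\<close> the discs around points of \<open>cball s0 r\<close> stay inside
  \<open>S\<close>.\<close>

lemma holomorphic_lebesgue_integral:
  fixes f :: "complex \<Rightarrow> 'a \<Rightarrow> complex"
  assumes S: "open S"
    and hol: "\<And>x. x \<in> space M \<Longrightarrow> (\<lambda>s. f s x) holomorphic_on S"
    and meas: "\<And>s. s \<in> S \<Longrightarrow> f s \<in> borel_measurable M"
    and g: "integrable M g"
    and bound: "\<And>s x. s \<in> S \<Longrightarrow> x \<in> space M \<Longrightarrow> norm (f s x) \<le> g x"
  shows "(\<lambda>s. LINT x|M. f s x) holomorphic_on S"
proof (subst holomorphic_on_open[OF S], intro ballI)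
  fix s0 assume s0: "s0 \<in> S"
  obtain e where e: "e > 0" "cball s0 e \<subseteq> S" using S s0 by (meson open_contains_cball)
  define r where "r = e / 2"
  have r: "r > 0" using e by (simp add: r_def)
  have int: "integrable M (f s)" if "s \<in> S" for s
    by (rule Bochner_Integration.integrable_bound[OF g]) (use meas bound that in fastforce)+
  have lip: "norm (f (s0 + h) x - f s0 x) \<le> g x / r * norm h"
    if x: "x \<in> space M" and h: "norm h \<le> r" for h x
  proof -
    have "norm (f s0 x - f (s0 + h) x) \<le> g x / r * norm (s0 - (s0 + h))"
    proof (rule field_differentiable_bound[of "cball s0 r"])
      fix z assume z: "z \<in> cball s0 r"
      have sub: "cball z r \<subseteq> S"
      proof
        fix w assume "w \<in> cball z r"
        then have "w \<in> cball s0 e" using z dist_triangle[of s0 w z] by (simp add: r_def)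
        then show "w \<in> S" using e by auto
      qed
      have holz: "(\<lambda>s. f s x) holomorphic_on cball z r"
        using hol[OF x] sub by (rule holomorphic_on_subset)
      show "((\<lambda>s. f s x) has_field_derivative deriv (\<lambda>s. f s x) z) (at z within cball s0 r)"
        by (rule has_field_derivative_at_within, rule holomorphic_derivI[OF hol[OF x] S])
           (use sub r in auto)
      have "norm ((deriv ^^ 1) (\<lambda>s. f s x) z) \<le> fact 1 * g x / r ^ 1"
      proof (rule Cauchy_inequality)
        show "(\<lambda>s. f s x) holomorphic_on ball z r"
          using holz ball_subset_cball holomorphic_on_subset by blast
        show "continuous_on (cball z r) (\<lambda>s. f s x)"
          using holz by (rule holomorphic_on_imp_continuous_on)
        show "norm (f w x) \<le> g x" if "norm (z - w) = r" for w
          by (rule bound[OF _ x]) (use sub that in \<open>auto simp: dist_norm\<close>)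
      qed (use r in auto)
      then show "norm (deriv (\<lambda>s. f s x) z) \<le> g x / r" by simp
    qed (use r h in \<open>auto simp: dist_norm\<close>)
    then show ?thesis by (simp add: norm_minus_commute)
  qed
  have inS: "s0 + h \<in> S" if "norm h \<le> r" for h
    using e that r by (auto simp: r_def dist_norm subset_iff)
  have der: "((\<lambda>h. (f (s0 + h) x - f s0 x) / h) \<longlongrightarrow> deriv (\<lambda>s. f s x) s0) (at 0)"
    if "x \<in> space M" for x
    using holomorphic_derivI[OF hol[OF that] S s0, of UNIV] unfolding DERIV_def .
  have "((\<lambda>h. ((LINT x|M. f (s0 + h) x) - (LINT x|M. f s0 x)) / h) \<longlongrightarrow> (LINT x|M. deriv (\<lambda>s. f s x) s0)) (at 0)"
    unfolding tendsto_at_iff_sequentially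
  proof (intro allI impI)
    fix X :: "nat \<Rightarrow> complex" assume X: "\<forall>i. X i \<in> UNIV - {0}" "X \<longlonglongrightarrow> 0"
    obtain N where N: "\<And>n. n \<ge> N \<Longrightarrow> norm (X n) < r"
      using LIMSEQ_D[OF X(2) r] by auto
    \<comment> \<open>The tail \<open>Y\<close> stays within distance \<open>r\<close> of 0, so that
      the bound \<open>lip\<close> holds for all its members and not only eventually.\<close>
    define Y where "Y n = X (n + N)" for n
    have Y: "norm (Y n) \<le> r" "Y n \<noteq> 0" for n
      using N[of "n + N"] X by (auto simp: Y_def)
    have Y0: "Y \<longlonglongrightarrow> 0"
      using LIMSEQ_ignore_initial_segment[OF X(2), of N] unfolding Y_def .
    have lim: "(\<lambda>n. (f (s0 + Y n) x - f s0 x) / Y n) \<longlonglongrightarrow> deriv (\<lambda>s. f s x) s0" if "x \<in> space M" for x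
      using filterlim_compose[OF der[OF that], of Y sequentially] Y Y0 by (simp add: filterlim_at)
    have ms: "(\<lambda>x. (f (s0 + Y n) x - f s0 x) / Y n) \<in> borel_measurable M" for n
      using meas[OF inS[OF Y(1)[of n]]] meas[OF s0] by measurable
    have "(\<lambda>n. LINT x|M. (f (s0 + Y n) x - f s0 x) / Y n) \<longlonglongrightarrow> (LINT x|M. deriv (\<lambda>s. f s x) s0)"
    proof (rule integral_dominated_convergence[where w = "\<lambda>x. g x / r"])
      show "(\<lambda>x. deriv (\<lambda>s. f s x) s0) \<in> borel_measurable M"
        by (rule borel_measurable_LIMSEQ_metric[OF ms lim])
      show "integrable M (\<lambda>x. g x / r)" using g by simp
      show "AE x in M. norm ((f (s0 + Y n) x - f s0 x) / Y n) \<le> g x / r" for n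
        using lip[OF _ Y(1)[of n]] Y(2)[of n] r
          by (intro AE_I2) (simp add: norm_divide pos_divide_le_eq)
    qed (use ms lim in auto)
    moreover have "(LINT x|M. (f (s0 + Y n) x - f s0 x) / Y n) = ((LINT x|M. f (s0 + Y n) x) - (LINT x|M. f s0 x)) / Y n" for n
      using int[OF inS[OF Y(1)[of n]]] int[OF s0] by simp
    ultimately have "(\<lambda>n. ((LINT x|M. f (s0 + Y n) x) - (LINT x|M. f s0 x)) / Y n) \<longlonglongrightarrow> (LINT x|M. deriv (\<lambda>s. f s x) s0)"
      by (simp only:)
    then show "((\<lambda>h. ((LINT x|M. f (s0 + h) x) - (LINT x|M. f s0 x)) / h) \<circ> X) \<longlonglongrightarrow> (LINT x|M. deriv (\<lambda>s. f s x) s0)"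
      unfolding Y_def o_def by (rule LIMSEQ_offset[where k = N])
  qed
  then show "\<exists>f'. ((\<lambda>s. LINT x|M. f s x) has_field_derivative f') (at s0)"
    by (auto simp: DERIV_def)
qed

text \<open>
  Here and below Mellin integrals over \<open>(0, \<infinity>)\<close> are written on the whole line via \<open>x = exp u\<close>, so that
  scaling becomes translation and \<open>x powr s\<close> becomes the entire function \<open>exp (s * u)\<close>.
\<close>
lemma Gamma_exp_integral:
  assumes "Re s > 0"
  shows "has_bochner_integral lborel (\<lambda>u. exp (s * of_real u) * of_real (exp (- exp u))) (Gamma s)"
proof -
  let ?f = "\<lambda>t. complex_of_real t powr (s - 1) / of_real (exp t)"
  let ?k = "\<lambda>u. exp (s * of_real u) * complex_of_real (exp (- exp u))"
  have img: "exp ` (UNIV :: real set) = {0<..}"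
    by (auto simp: image_iff) (metis exp_ln)
  have "?f absolutely_integrable_on exp ` UNIV \<and> integral (exp ` UNIV) ?f = Gamma s"
    unfolding img using absolutely_integrable_Gamma_integral'[OF assms] Gamma_integral_complex'[OF assms]
    by (auto simp: has_integral_iff)
  then have "(\<lambda>u. \<bar>exp u\<bar> *\<^sub>R ?f (exp u)) absolutely_integrable_on UNIV \<and>
      integral UNIV (\<lambda>u. \<bar>exp u\<bar> *\<^sub>R ?f (exp u)) = Gamma s"
    by (subst has_absolute_integral_change_of_variables_real[where g = exp])
       (auto intro!: derivative_eq_intros inj_onI)
  moreover have "\<bar>exp u\<bar> *\<^sub>R ?f (exp u) = ?k u" for u
  proof -
    have "Ln (complex_of_real (exp u)) = of_real u" by (simp add: Ln_of_real)
    then have "complex_of_real (exp u) powr (s - 1) = exp ((s - 1) * of_real u)"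
      by (simp add: powr_def)
    moreover have "complex_of_real (exp u) * exp ((s - 1) * of_real u) = exp (s * of_real u)"
      by (simp add: exp_of_real[symmetric] algebra_simps flip: exp_add)
    ultimately show ?thesis by (simp add: scaleR_conv_of_real exp_minus divide_simps)
  qed
  ultimately have *: "?k absolutely_integrable_on UNIV" "integral UNIV ?k = Gamma s" by simp_all
  have cont: "continuous_on UNIV ?k" by (intro continuous_intros)
  have int: "integrable lborel ?k"
    using *(1) cont by (simp add: set_integrable_def integrable_completion borel_measurable_continuous_onI)
  have "integral\<^sup>L lborel ?k = Gamma s"
    using *(2) integral_lborel[OF int] has_integral_integral_lborel[OF int] by (simp add: integral_unique)
  with int show ?thesis by (simp add: has_bochner_integral_iff)
qed

lemma has_bochner_integral_translate:
  fixes f :: "real \<Rightarrow> 'a :: {banach, second_countable_topology}"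
  assumes "has_bochner_integral lborel f x"
  shows "has_bochner_integral lborel (\<lambda>u. f (t + u)) x"
  using lborel_has_bochner_integral_real_affine_iff[of 1 f x t] assms by simp

lemma exp_add_exp_integral:
  assumes "Re s > 0"
  shows "has_bochner_integral lborel (\<lambda>u. exp (s * of_real u) * of_real (exp (- exp (c + 2 * u))))
           (exp (- s / 2 * of_real c) * Gamma (s / 2) / 2)"
proof -
  have "has_bochner_integral lborel (\<lambda>u. exp (s/2 * of_real u) * of_real (exp (- exp u))) (Gamma (s/2))"
    using assms by (intro Gamma_exp_integral) simp
  then have "has_bochner_integral lborel
     (\<lambda>u. exp (s/2 * of_real (c + 2 * u)) * complex_of_real (exp (- exp (c + 2 * u)))) (Gamma (s/2) /\<^sub>R \<bar>2\<bar>)"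
    by (subst (asm) lborel_has_bochner_integral_real_affine_iff[of 2 _ _ c]) auto
  note * = this
  have "has_bochner_integral lborel
     (\<lambda>u. exp (- s / 2 * of_real c) * (exp (s/2 * of_real (c + 2 * u)) * complex_of_real (exp (- exp (c + 2 * u)))))
     (exp (- s / 2 * of_real c) * (Gamma (s/2) /\<^sub>R \<bar>2\<bar>))"
    by (rule has_bochner_integral_mult_right) (rule *)
  also have "(\<lambda>u. exp (- s / 2 * of_real c) * (exp (s/2 * of_real (c + 2 * u)) * complex_of_real (exp (- exp (c + 2 * u)))))
     = (\<lambda>u. exp (s * of_real u) * of_real (exp (- exp (c + 2 * u))))"
    unfolding mult.assoc[symmetric] exp_add[symmetric] by (simp add: algebra_simps add_divide_distrib)
  finally show ?thesis by (simp add: scaleR_conv_of_real divide_simps mult_ac)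
qed

text \<open>
  Fubini for \<open>exp (s * u)\<close> times \<open>1 / (1 + exp (2 * u)) = \<integral> exp v * exp (- exp v * (1 + exp (2 * u))) dv\<close>.
\<close>
lemma logistic_exp_integral:
  assumes "0 < Re s" "Re s < 2"
  shows "has_bochner_integral lborel (\<lambda>u. exp (s * of_real u) / of_real (1 + exp (2 * u)))
           (Gamma (s / 2) * Gamma (1 - s / 2) / 2)"
proof -
  define K where "K s v u = exp (of_real v :: complex) * of_real (exp (- exp v)) *
      (exp (s * of_real u) * of_real (exp (- exp (v + 2 * u))))" for s v u
  have inner_u: "has_bochner_integral lborel (K s v)
      (exp (of_real v) * of_real (exp (- exp v)) * (exp (- s / 2 * of_real v) * Gamma (s / 2) / 2))"
    if "Re s > 0" for s v
    unfolding K_def by (intro has_bochner_integral_mult_right) (use exp_add_exp_integral[OF that] in auto)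
  \<comment> \<open>Apart from \<open>exp (s * u)\<close> the kernel is positive, so its norm is the
    same kernel at \<open>Re s\<close>; the closed forms of the integrals then also settle absolute
    integrability.\<close>
  have norm_K: "norm (K s v u) = Re (K (of_real (Re s)) v u)" for s v u
    by (simp add: K_def norm_mult exp_of_real flip: of_real_mult)
  have inner_norm: "(LINT u|lborel. norm (K s v u)) =
     Re (exp ((1 - of_real (Re s) / 2) * of_real v) * of_real (exp (- exp v)) * (Gamma (of_real (Re s) / 2) / 2))" for v
  proof -
    have "(LINT u|lborel. norm (K s v u)) = Re (LINT u|lborel. K (of_real (Re s)) v u)"
      unfolding norm_K using inner_u[of "of_real (Re s)" v] assms
      by (subst integral_Re) (auto simp: has_bochner_integral_iff)
    also have "(LINT u|lborel. K (of_real (Re s)) v u) =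
       exp (of_real v) * of_real (exp (- exp v)) * (exp (- of_real (Re s) / 2 * of_real v) * Gamma (of_real (Re s) / 2) / 2)"
      using inner_u[of "of_real (Re s)" v] assms by (auto simp: has_bochner_integral_iff)
    also have "\<dots> = exp ((1 - of_real (Re s) / 2) * of_real v) * of_real (exp (- exp v)) * (Gamma (of_real (Re s) / 2) / 2)"
      by (simp add: algebra_simps flip: exp_add)
    finally show ?thesis .
  qed
  have "continuous_on UNIV (\<lambda>(v, u). K s v u)"
    unfolding K_def case_prod_beta by (intro continuous_intros)
  then have meas: "(\<lambda>(v, u). K s v u) \<in> borel_measurable (lborel \<Otimes>\<^sub>M lborel)"
    using borel_measurable_continuous_onI by (simp add: lborel_prod)
  have int_v: "has_bochner_integral lborel
     (\<lambda>v. exp ((1 - s / 2) * of_real v) * of_real (exp (- exp v)) * (Gamma (s / 2) / 2))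
     (Gamma (1 - s / 2) * (Gamma (s / 2) / 2))" if "0 < Re s" "Re s < 2" for s
    by (intro has_bochner_integral_mult_left Gamma_exp_integral) (use that in auto)
  have int: "integrable (lborel \<Otimes>\<^sub>M lborel) (\<lambda>(v, u). K s v u)"
  proof (rule lborel_pair.Fubini_integrable)
    show "integrable lborel (\<lambda>v. LINT u|lborel. norm (case (v, u) of (v, u) \<Rightarrow> K s v u))"
      unfolding prod.case inner_norm using int_v[of "of_real (Re s)"] assms
      by (intro integrable_Re) (auto simp: has_bochner_integral_iff)
    show "AE v in lborel. integrable lborel (\<lambda>u. case (v, u) of (v, u) \<Rightarrow> K s v u)"
      using inner_u[OF assms(1)] by (intro AE_I2) (auto simp: has_bochner_integral_iff)
  qed fact
  have inner_v: "(LINT v|lborel. K s v u) = exp (s * of_real u) / of_real (1 + exp (2 * u))" for u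
  proof -
    \<comment> \<open>With this \<open>a\<close> the factor \<open>1 + exp (2 * u)\<close> is
      absorbed into a translation by \<open>a\<close>, and the inner integral becomes Gamma at
      1.\<close>
    define a where "a = ln (1 + exp (2 * u))"
    have pos: "1 + exp (2 * u) > 0" by (simp add: add_pos_pos)
    have a: "exp a = 1 + exp (2 * u)" using pos by (simp add: a_def)
    have "has_bochner_integral lborel (\<lambda>v. exp (1 * of_real v) * complex_of_real (exp (- exp v))) (Gamma 1)"
      by (rule Gamma_exp_integral) simp
    note has_bochner_integral_translate[OF this, of a]
    then have "has_bochner_integral lborel
       (\<lambda>v. exp (s * of_real u) / of_real (exp a) * (exp (1 * of_real (a + v)) * of_real (exp (- exp (a + v)))))
       (exp (s * of_real u) / of_real (exp a) * Gamma 1)"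
      by (intro has_bochner_integral_mult_right)
    then have "(LINT v|lborel. exp (s * of_real u) / of_real (exp a) * (exp (of_real (a + v)) * of_real (exp (- exp (a + v)))))
        = exp (s * of_real u) / of_real (exp a)"
      by (simp add: has_bochner_integral_iff)
    also have "(\<lambda>v. exp (s * of_real u) / of_real (exp a) * (exp (of_real (a + v)) * of_real (exp (- exp (a + v))))) =
       (\<lambda>v. K s v u)"
    proof
      fix v
      have "exp (- exp (a + v)) = exp (- exp v) * exp (- exp (v + 2 * u))"
        by (simp add: exp_add a algebra_simps flip: exp_add[of "- _"] exp_add)
           (simp add: exp_add a algebra_simps)
      then show "exp (s * of_real u) / of_real (exp a) * (exp (of_real (a + v)) * of_real (exp (- exp (a + v)))) = K s v u"
        by (simp add: K_def exp_add exp_of_real[symmetric])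
    qed
    finally show ?thesis by (simp add: a)
  qed
  have "(LINT v|lborel. LINT u|lborel. K s v u) = (LINT u|lborel. LINT v|lborel. K s v u)"
    using lborel_pair.Fubini_integral[OF int] by simp
  also have "\<dots> = (LINT u|lborel. exp (s * of_real u) / of_real (1 + exp (2 * u)))"
    by (simp only: inner_v)
  also have "(LINT v|lborel. LINT u|lborel. K s v u) =
     (LINT v|lborel. exp ((1 - s / 2) * of_real v) * of_real (exp (- exp v)) * (Gamma (s / 2) / 2))"
  proof (rule Bochner_Integration.integral_cong[OF refl])
    fix v
    have "(LINT u|lborel. K s v u) = exp (of_real v) * of_real (exp (- exp v)) * (exp (- s / 2 * of_real v) * Gamma (s / 2) / 2)"
      using inner_u[OF assms(1)] by (auto simp: has_bochner_integral_iff)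
    also have "exp ((1 - s / 2) * of_real v) = exp (of_real v) * exp (- s / 2 * of_real v)"
      by (simp add: algebra_simps flip: exp_add)
    ultimately show "(LINT u|lborel. K s v u) = exp ((1 - s / 2) * of_real v) * of_real (exp (- exp v)) * (Gamma (s / 2) / 2)"
      by simp
  qed
  also have "\<dots> = Gamma (1 - s / 2) * (Gamma (s / 2) / 2)"
    using int_v[OF assms] by (simp add: has_bochner_integral_iff)
  finally have v: "Gamma (1 - s / 2) * (Gamma (s / 2) / 2) = (LINT u|lborel. exp (s * of_real u) / of_real (1 + exp (2 * u)))" .
  have val: "(LINT u|lborel. exp (s * of_real u) / of_real (1 + exp (2 * u))) = Gamma (s / 2) * Gamma (1 - s / 2) / 2"
    unfolding v[symmetric] by simp
  have "integrable lborel (\<lambda>u. LINT v|lborel. K s v u)"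
    using lborel_pair.integrable_snd[OF int] by simp
  then show ?thesis using val unfolding inner_v by (simp add: has_bochner_integral_iff)
qed

text \<open>The logarithmic derivative of the reflection formula expresses pi * cot (pi * z) as a
  difference of two Digamma values, and the series defining \<open>Digamma\<close> supplies the
  partial fractions. The point z = i * x / (2 * pi) turns the cotangent into coth (x / 2), which is
  1 + 2 / (exp x - 1).\<close>

lemma coth_partial_fractions:
  assumes x: "x > (0::real)"
  shows "(\<lambda>n. 2 * x / (x\<^sup>2 + (2 * pi * real (Suc n))\<^sup>2)) sums (1 / (exp x - 1) - 1 / x + 1 / 2)"
proof -
  define y where "y = x / (2 * pi)"
  have y: "y > 0" using x by (simp add: y_def)
  define z where "z = \<i> * of_real y"
  have z: "z \<notin> \<int>" "z \<noteq> 0"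
    using y by (auto simp: z_def Ints_def complex_eq_iff)
  then have nz: "z \<notin> \<int>\<^sub>\<le>\<^sub>0" "1 - z \<notin> \<int>\<^sub>\<le>\<^sub>0"
    using nonpos_Ints_Int[of "1-z"] by (auto dest: nonpos_Ints_Int simp: Ints_1)
  have d1: "((\<lambda>z. rGamma z * rGamma (1 - z)) has_field_derivative
      (- rGamma z * Digamma z * rGamma (1 - z) + rGamma z * (rGamma (1 - z) * Digamma (1 - z)))) (at z)"
    using nz by (auto intro!: derivative_eq_intros simp: algebra_simps)
  have d2: "(\<lambda>z::complex. rGamma z * rGamma (1 - z)) = (\<lambda>z. sin (of_real pi * z) / of_real pi)"
    by (simp add: rGamma_reflection_complex fun_eq_iff)
  have d3: "((\<lambda>z. sin (of_real pi * z) / of_real pi) has_field_derivative cos (of_real pi * z)) (at z)"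
    by (auto intro!: derivative_eq_intros)
  have "- rGamma z * Digamma z * rGamma (1 - z) + rGamma z * (rGamma (1 - z) * Digamma (1 - z)) = cos (of_real pi * z)"
    by (rule DERIV_unique[OF d1[unfolded d2] d3])
  then have "rGamma z * rGamma (1 - z) * (Digamma (1 - z) - Digamma z) = cos (of_real pi * z)"
    by (simp add: algebra_simps)
  then have 1: "sin (of_real pi * z) * (Digamma (1 - z) - Digamma z) = of_real pi * cos (of_real pi * z)"
    by (simp add: rGamma_reflection_complex field_simps)
  have z1: "1 - z \<noteq> 0" "1 + z \<noteq> 0" using y by (auto simp: z_def complex_eq_iff)
  have "(\<lambda>k. (inverse (of_nat (Suc k)) - inverse ((1 - z) + of_nat k)) -
             (inverse (of_nat (Suc k)) - inverse ((1 + z) + of_nat k)))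
     sums ((Digamma (1 - z) + euler_mascheroni) - (Digamma (1 + z) + euler_mascheroni))"
    unfolding Digamma_def using summable_Digamma[OF z1(1)] summable_Digamma[OF z1(2)]
    by (intro sums_diff) (auto simp: summable_sums)
  also have "(\<lambda>k. (inverse (of_nat (Suc k)) - inverse ((1 - z) + of_nat k)) -
             (inverse (of_nat (Suc k)) - inverse ((1 + z) + of_nat k)))
       = (\<lambda>k. - \<i> * of_real (2 * y / (y\<^sup>2 + (real (Suc k))\<^sup>2)))"
  proof
    fix k
    define N where "N = real (Suc k)"
    have N: "N > 0" by (simp add: N_def)
    have "of_real N + z \<noteq> 0" "of_real N - z \<noteq> 0" using y N by (auto simp: z_def complex_eq_iff)
    moreover have "(of_real N + z) * (of_real N - z) = of_real (y\<^sup>2 + N\<^sup>2)"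
      by (simp add: z_def algebra_simps power2_eq_square)
    ultimately have "inverse (of_real N + z) - inverse (of_real N - z) = - 2 * z / of_real (y\<^sup>2 + N\<^sup>2)"
      by (simp add: field_simps)
    moreover have e: "1 - z + of_nat k = of_real N - z" "1 + z + of_nat k = of_real N + z"
      by (auto simp: N_def)
    ultimately have "(inverse (of_nat (Suc k)) - inverse ((1 - z) + of_nat k)) -
             (inverse (of_nat (Suc k)) - inverse ((1 + z) + of_nat k)) = - 2 * z / of_real (y\<^sup>2 + N\<^sup>2)"
      unfolding e by simp
    then show "(inverse (of_nat (Suc k)) - inverse ((1 - z) + of_nat k)) -
             (inverse (of_nat (Suc k)) - inverse ((1 + z) + of_nat k)) = - \<i> * of_real (2 * y / (y\<^sup>2 + (real (Suc k))\<^sup>2))"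
      by (simp add: z_def N_def)
  qed
  \<comment> \<open>The recurrence from \<open>1 + z\<close> back to \<open>z\<close> brings in
    \<open>1 / z\<close>, the source of the term \<open>1 / x\<close> in the statement.\<close>
  also have "(Digamma (1 - z) + euler_mascheroni) - (Digamma (1 + z) + euler_mascheroni) = Digamma (1 - z) - Digamma z - 1 / z"
    using Digamma_plus1[OF z(2)] by (simp add: add.commute)
  finally have "(\<lambda>k. \<i> * (- \<i> * of_real (2 * y / (y\<^sup>2 + (real (Suc k))\<^sup>2)))) sums (\<i> * (Digamma (1 - z) - Digamma z - 1 / z))"
    by (rule sums_mult)
  then have s: "(\<lambda>k. of_real (2 * y / (y\<^sup>2 + (real (Suc k))\<^sup>2))) sums (\<i> * (Digamma (1 - z) - Digamma z - 1 / z))"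
    by simp
  have piz: "of_real pi * z = \<i> * of_real (x / 2)" by (simp add: z_def y_def)
  have sh: "sinh (x / 2) \<noteq> 0" using x by simp
  have "sin (of_real pi * z) = \<i> * of_real (sinh (x/2))" "cos (of_real pi * z) = of_real (cosh (x/2))"
    unfolding piz sin_i_times cos_i_times exp_of_real sinh_field_def cosh_field_def
    by (simp_all add: exp_minus)
  with 1 have "\<i> * of_real (sinh (x/2)) * (Digamma (1 - z) - Digamma z) = of_real pi * of_real (cosh (x/2))"
    by simp
  then have "- \<i> * (\<i> * of_real (sinh (x/2)) * (Digamma (1 - z) - Digamma z)) = - \<i> * of_real (pi * cosh (x/2))"
    by simp
  then have "of_real (sinh (x/2)) * (Digamma (1 - z) - Digamma z) = - \<i> * of_real (pi * cosh (x/2))"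
    by (simp only: mult.assoc[symmetric]) simp
  with sh have D: "Digamma (1 - z) - Digamma z = - \<i> * of_real (pi * cosh (x/2) / sinh (x/2))"
    by (simp add: field_simps)
  have "\<i> * (Digamma (1 - z) - Digamma z - 1 / z) = of_real (pi * cosh (x/2) / sinh (x/2) - 1 / y)"
    unfolding D using y by (simp add: z_def field_simps)
  with s have "(\<lambda>k. 2 * y / (y\<^sup>2 + (real (Suc k))\<^sup>2)) sums (pi * cosh (x/2) / sinh (x/2) - 1 / y)"
    by (simp only: sums_of_real_iff)
  from sums_mult[OF this, of "1 / (2 * pi)"]
  have "(\<lambda>k. 1 / (2 * pi) * (2 * y / (y\<^sup>2 + (real (Suc k))\<^sup>2))) sums (1 / (2 * pi) * (pi * cosh (x/2) / sinh (x/2) - 1 / y))" .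
  also have "(\<lambda>k. 1 / (2 * pi) * (2 * y / (y\<^sup>2 + (real (Suc k))\<^sup>2))) = (\<lambda>n. 2 * x / (x\<^sup>2 + (2 * pi * real (Suc n))\<^sup>2))"
  proof
    fix k
    have "x\<^sup>2 + (2 * pi * real (Suc k))\<^sup>2 = 4 * pi\<^sup>2 * (y\<^sup>2 + (real (Suc k))\<^sup>2)"
      by (simp add: y_def power2_eq_square field_simps)
    moreover have "x = 2 * pi * y" by (simp add: y_def)
    ultimately show "1 / (2 * pi) * (2 * y / (y\<^sup>2 + (real (Suc k))\<^sup>2)) = 2 * x / (x\<^sup>2 + (2 * pi * real (Suc k))\<^sup>2)"
      by (simp add: power2_eq_square del: of_nat_Suc)
  qed
  also have "1 / (2 * pi) * (pi * cosh (x/2) / sinh (x/2) - 1 / y) = 1 / (exp x - 1) - 1 / x + 1 / 2"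
  proof -
    define E where "E = exp (x / 2)"
    have E: "E > 1" using x by (simp add: E_def)
    have e: "exp x = E * E" by (simp add: E_def flip: exp_add)
    have "E * E > 1" using E by (simp add: less_1_mult)
    then have "cosh (x/2) / sinh (x/2) = (E * E + 1) / (E * E - 1)"
      using E unfolding cosh_field_def sinh_field_def by (simp add: E_def[symmetric] exp_minus field_simps)
    moreover have "1 / (2 * pi) * (pi * cosh (x/2) / sinh (x/2) - 1 / y) = cosh (x/2) / sinh (x/2) / 2 - 1 / x"
      using x by (simp add: y_def right_diff_distrib)
    moreover have "(E * E + 1) / (E * E - 1) / 2 = 1 / (E * E - 1) + 1 / 2"
      using \<open>E * E > 1\<close> by (simp add: divide_simps)
    ultimately show ?thesis unfolding e by simp
  qed
  finally show ?thesis .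
qed

subsection \<open>Functional equation in the strip\<close>

text \<open>Termwise integration in the form that serves all four expansions: of the two Mellin
  integrals behind the functional equation and of the kernel on the two vertical lines. The
  majorants \<open>J\<close> need not be the exact integrals of the norms.\<close>

lemma has_bochner_integral_suminf:
  fixes f :: "nat \<Rightarrow> 'a \<Rightarrow> 'b :: {banach, second_countable_topology}"
  assumes f: "\<And>n. has_bochner_integral M (f n) (I n)"
    and J: "\<And>n. (LINT x|M. norm (f n x)) \<le> J n" "summable J"
    and sm: "\<And>x. x \<in> space M \<Longrightarrow> summable (\<lambda>n. norm (f n x))"
    and g: "\<And>x. x \<in> space M \<Longrightarrow> (\<lambda>n. f n x) sums g x"
  shows "has_bochner_integral M g (suminf I)"
proof -
  have int: "integrable M (f n)" for n using f by (auto simp: has_bochner_integral_iff)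
  have AE: "AE x in M. summable (\<lambda>n. norm (f n x))" using sm by (intro AE_I2) auto
  have sJ: "summable (\<lambda>n. LINT x|M. norm (f n x))"
    by (rule summable_comparison_test'[OF J(2), of 0]) (use J(1) in \<open>simp add: integral_nonneg_AE\<close>)
  have "integrable M (\<lambda>x. \<Sum>n. f n x)" by (rule integrable_suminf[OF int AE sJ])
  moreover have "(LINT x|M. (\<Sum>n. f n x)) = (\<Sum>n. integral\<^sup>L M (f n))"
    by (rule integral_suminf[OF int AE sJ])
  moreover have "integral\<^sup>L M (f n) = I n" for n using f by (auto simp: has_bochner_integral_iff)
  ultimately have "has_bochner_integral M (\<lambda>x. \<Sum>n. f n x) (suminf I)"
    by (simp add: has_bochner_integral_iff)
  then show ?thesis
    by (rule has_bochner_integral_cong[THEN iffD1, rotated -1]) (use g in \<open>auto simp: sums_iff\<close>)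
qed

lemma Gamma_exp_integral_shift:
  assumes "Re s > 0"
  shows "has_bochner_integral lborel (\<lambda>u. exp (s * of_real u) * of_real (exp (- exp (a + u))))
           (exp (- s * of_real a) * Gamma s)"
proof -
  have "has_bochner_integral lborel
     (\<lambda>u. exp (- s * of_real a) * (exp (s * of_real (a + u)) * complex_of_real (exp (- exp (a + u)))))
     (exp (- s * of_real a) * Gamma s)"
    by (rule has_bochner_integral_mult_right)
       (rule has_bochner_integral_translate[OF Gamma_exp_integral[OF assms]])
  also have "(\<lambda>u. exp (- s * of_real a) * (exp (s * of_real (a + u)) * complex_of_real (exp (- exp (a + u)))))
     = (\<lambda>u. exp (s * of_real u) * of_real (exp (- exp (a + u))))"
    unfolding mult.assoc[symmetric] exp_add[symmetric] by (simp add: algebra_simps)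
  finally show ?thesis .
qed

lemma integral_norm_of_real:
  assumes "has_bochner_integral M (\<lambda>x. complex_of_real (g x)) I" "\<And>x. norm (f x) = g x"
  shows "(LINT x|M. norm (f x)) = Re I"
  using assms integral_Re[of M "\<lambda>x. complex_of_real (g x)"] by (simp add: has_bochner_integral_iff)

text \<open>The geometric series expands \<open>1 / (exp y - 1)\<close> into exponentials
  \<open>exp (- n * y)\<close> with n >= 1. In the variable \<open>u = ln y\<close> each of them is
  the Gamma integrand translated by ln n, which contributes the factor n powr (-s).\<close>

lemma zeta_Gamma_integral:
  assumes s: "Re s > 1"
  shows "has_bochner_integral lborel (\<lambda>u. exp (s * of_real u) * of_real (1 / (exp (exp u) - 1)))
           (Gamma s * (zeta_pre s / (s - 1)))"
proof -
  define f where "f n u = exp (s * of_real u) * complex_of_real (exp (- exp (ln (real (Suc n)) + u)))" for n u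
  have e: "exp (- exp (ln (real (Suc n)) + u)) = exp (- exp u) ^ Suc n" for n u
  proof -
    have "exp (ln (real (Suc n)) + u) = real (Suc n) * exp u" by (simp add: exp_add)
    then show ?thesis by (simp add: exp_of_nat_mult[symmetric] algebra_simps del: power_Suc)
  qed
  have geo: "(\<lambda>n. exp (- exp u) ^ Suc n) sums (1 / (exp (exp u) - 1))" for u :: real
  proof -
    have q: "exp (- exp u) < 1" "exp (exp u) > 1" by auto
    have "(\<lambda>n. exp (- exp u) * exp (- exp u) ^ n) sums (exp (- exp u) * (1 / (1 - exp (- exp u))))"
      using q by (intro sums_mult geometric_sums) auto
    also have "exp (- exp u) * (1 / (1 - exp (- exp u))) = 1 / (exp (exp u) - 1)"
      using q by (simp add: exp_minus field_simps)
    finally show ?thesis by simp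
  qed
  have "has_bochner_integral lborel (\<lambda>u. exp (s * of_real u) * of_real (1 / (exp (exp u) - 1)))
          (\<Sum>n. exp (- s * of_real (ln (real (Suc n)))) * Gamma s)"
  proof (rule has_bochner_integral_suminf[where f = f])
    show "has_bochner_integral lborel (f n) (exp (- s * of_real (ln (real (Suc n)))) * Gamma s)" for n
      unfolding f_def by (rule Gamma_exp_integral_shift) (use s in auto)
    show "(LINT u|lborel. norm (f n u)) \<le> real (Suc n) powr (- Re s) * norm (Gamma (complex_of_real (Re s)))" for n
    proof -
      have "has_bochner_integral lborel
          (\<lambda>u. complex_of_real (exp (Re s * u) * exp (- exp (ln (real (Suc n)) + u))))
          (exp (- of_real (Re s) * of_real (ln (real (Suc n)))) * Gamma (of_real (Re s)))"
        using Gamma_exp_integral_shift[of "of_real (Re s)" "ln (real (Suc n))"] s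
        by (simp add: exp_of_real[symmetric] del: of_nat_Suc)
      then have "(LINT u|lborel. norm (f n u)) = Re (exp (- of_real (Re s) * of_real (ln (real (Suc n)))) * Gamma (of_real (Re s)))"
        by (rule integral_norm_of_real) (simp add: f_def norm_mult)
      also have "\<dots> \<le> norm (exp (- complex_of_real (Re s) * of_real (ln (real (Suc n)))) * Gamma (of_real (Re s)))"
        by (rule complex_Re_le_cmod)
      also have "\<dots> = real (Suc n) powr (- Re s) * norm (Gamma (complex_of_real (Re s)))"
        by (simp add: norm_mult powr_def del: of_nat_Suc)
      finally show ?thesis .
    qed
    show "summable (\<lambda>n. real (Suc n) powr (- Re s) * norm (Gamma (complex_of_real (Re s))))"
      using s by (intro summable_mult2 summable_Suc_powr) auto
    show "summable (\<lambda>n. norm (f n u))" for u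
    proof -
      have "norm (f n u) = exp (Re s * u) * exp (- exp u) ^ Suc n" for n
        unfolding f_def norm_mult norm_of_real e by (simp del: power_Suc)
      then show ?thesis using sums_summable[OF geo[of u]] by (simp only: summable_mult)
    qed
    show "(\<lambda>n. f n u) sums (exp (s * of_real u) * of_real (1 / (exp (exp u) - 1)))" for u
      unfolding f_def e using geo[of u] by (intro sums_mult) (simp only: sums_of_real_iff)
  qed
  also have "(\<lambda>n. exp (- s * of_real (ln (real (Suc n)))) * Gamma s) = (\<lambda>n. Gamma s * of_nat (Suc n) powr (-s))"
    by (simp add: powr_def Ln_of_nat mult.commute del: of_nat_Suc)
  also have "suminf \<dots> = Gamma s * (zeta_pre s / (s - 1))"
    using sums_mult[OF zeta_pre_sums[OF s], of "Gamma s"] by (rule sums_unique[symmetric])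
  finally show ?thesis .
qed

text \<open>Translation by \<open>a n = ln (2 * pi * (n + 1))\<close> carries each partial fraction
  of the hyperbolic cotangent to the logistic kernel with exponent \<open>s + 1\<close>, whose real
  part lies between 0 and 1. The factors \<open>exp ((s - 1) * a n)\<close> then sum to the series
  of zeta at \<open>1 - s\<close>, which converges because \<open>Re s < 0\<close>.\<close>

lemma zeta_reflection_integral:
  assumes s: "-1 < Re s" "Re s < 0"
  shows "has_bochner_integral lborel
           (\<lambda>u. exp (s * of_real u) * of_real (1 / (exp (exp u) - 1) - exp (- u) + 1 / 2))
           (of_real (2 * pi) powr (s - 1) * Gamma ((1 + s) / 2) * Gamma ((1 - s) / 2) * (zeta_pre (1 - s) / (- s)))"
proof -
  define a where "a n = ln (2 * pi * real (Suc n))" for n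
  have ea: "exp (a n) = 2 * pi * real (Suc n)" for n by (simp add: a_def del: of_nat_Suc)
  define f where "f s n u = exp (s * of_real u) * complex_of_real (2 * exp u / ((exp u)\<^sup>2 + (2 * pi * real (Suc n))\<^sup>2))" for s n u
  have f: "has_bochner_integral lborel (f s n)
      (exp ((s - 1) * of_real (a n)) * (Gamma ((1 + s) / 2) * Gamma ((1 - s) / 2)))"
    if s: "-1 < Re s" "Re s < 0" for s n
  proof -
    have "has_bochner_integral lborel
      (\<lambda>u. 2 * exp ((s - 1) * of_real (a n)) * (exp ((s + 1) * of_real (- a n + u)) / of_real (1 + exp (2 * (- a n + u)))))
      (2 * exp ((s - 1) * of_real (a n)) * (Gamma ((s + 1) / 2) * Gamma (1 - (s + 1) / 2) / 2))"
      by (intro has_bochner_integral_mult_right has_bochner_integral_translate logistic_exp_integral) (use s in auto)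
    also have "(\<lambda>u. 2 * exp ((s - 1) * of_real (a n)) * (exp ((s + 1) * of_real (- a n + u)) / of_real (1 + exp (2 * (- a n + u)))))
       = f s n"
    proof
      fix u
      have p: "1 + exp (2 * (- a n + u)) > 0" by (simp add: add_pos_pos)
      have "(exp u)\<^sup>2 + (exp (a n))\<^sup>2 = exp (2 * a n) * (1 + exp (2 * (- a n + u)))"
        by (simp add: algebra_simps power2_eq_square flip: exp_add)
      then have "2 * exp u / ((exp u)\<^sup>2 + (2 * pi * real (Suc n))\<^sup>2) = 2 * exp (u - 2 * a n) / (1 + exp (2 * (- a n + u)))"
        unfolding ea[symmetric] using p by (simp add: exp_diff)
      then have "f s n u = 2 * (exp (s * of_real u) * of_real (exp (u - 2 * a n))) / of_real (1 + exp (2 * (- a n + u)))"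
        by (simp add: f_def)
      also have "exp (s * of_real u) * of_real (exp (u - 2 * a n)) =
           exp ((s - 1) * of_real (a n)) * exp ((s + 1) * of_real (- a n + u))"
        by (simp add: exp_of_real[symmetric] algebra_simps flip: exp_add)
      finally show "2 * exp ((s - 1) * of_real (a n)) * (exp ((s + 1) * of_real (- a n + u)) / of_real (1 + exp (2 * (- a n + u)))) = f s n u"
        by simp
    qed
    also have "1 - (s + 1) / 2 = (1 - s) / 2" by (simp add: field_simps)
    finally show ?thesis by (simp add: add.commute)
  qed
  have norm_f: "norm (f s n u) = exp (Re s * u) * (2 * exp u / ((exp u)\<^sup>2 + (2 * pi * real (Suc n))\<^sup>2))" for n u
    unfolding f_def norm_mult norm_of_real by simp
  have cothp: "(\<lambda>n. 2 * exp u / ((exp u)\<^sup>2 + (2 * pi * real (Suc n))\<^sup>2)) sums (1 / (exp (exp u) - 1) - exp (- u) + 1 / 2)" for u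
    using coth_partial_fractions[of "exp u"] by (simp add: exp_minus field_simps)
  let ?G = "Gamma ((1 + s) / 2) * Gamma ((1 - s) / 2)"
  let ?G' = "Gamma ((1 + of_real (Re s)) / 2) * Gamma ((1 - of_real (Re s)) / 2) :: complex"
  have "has_bochner_integral lborel
           (\<lambda>u. exp (s * of_real u) * of_real (1 / (exp (exp u) - 1) - exp (- u) + 1 / 2))
           (\<Sum>n. exp ((s - 1) * of_real (a n)) * ?G)"
  proof (rule has_bochner_integral_suminf[where f = "f s"])
    show "has_bochner_integral lborel (f s n) (exp ((s - 1) * of_real (a n)) * ?G)" for n by (rule f[OF s])
    show "(LINT u|lborel. norm (f s n u)) \<le> (2 * pi) powr (Re s - 1) * real (Suc n) powr (Re s - 1) * norm ?G'" for n
    proof -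
      have "has_bochner_integral lborel
          (\<lambda>u. complex_of_real (exp (Re s * u) * (2 * exp u / ((exp u)\<^sup>2 + (2 * pi * real (Suc n))\<^sup>2))))
          (exp ((of_real (Re s) - 1) * of_real (a n)) * ?G')"
        using f[of "of_real (Re s)" n] s by (simp add: f_def[abs_def] exp_of_real[symmetric] del: of_nat_Suc)
      then have "(LINT u|lborel. norm (f s n u)) = Re (exp ((of_real (Re s) - 1) * of_real (a n)) * ?G')"
        by (rule integral_norm_of_real) (rule norm_f)
      also have "\<dots> \<le> norm (exp ((of_real (Re s) - 1) * of_real (a n)) * ?G')"
        by (rule complex_Re_le_cmod)
      also have "\<dots> = exp (a n * (Re s - 1)) * norm ?G'"
        by (simp add: norm_mult mult.commute)
      also have "exp (a n * (Re s - 1)) = (2 * pi * real (Suc n)) powr (Re s - 1)"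
        by (simp add: powr_def a_def mult.commute del: of_nat_Suc)
      also have "\<dots> = (2 * pi) powr (Re s - 1) * real (Suc n) powr (Re s - 1)"
        by (subst powr_mult) auto
      finally show ?thesis .
    qed
    show "summable (\<lambda>n. (2 * pi) powr (Re s - 1) * real (Suc n) powr (Re s - 1) * norm ?G')"
      using s by (intro summable_mult2 summable_mult summable_Suc_powr) auto
    show "summable (\<lambda>n. norm (f s n u))" for u
      unfolding norm_f using sums_summable[OF cothp[of u]] by (intro summable_mult)
    show "(\<lambda>n. f s n u) sums (exp (s * of_real u) * of_real (1 / (exp (exp u) - 1) - exp (- u) + 1 / 2))" for u
      unfolding f_def using cothp[of u] by (intro sums_mult) (simp only: sums_of_real_iff)
  qed
  also have "(\<lambda>n. exp ((s - 1) * of_real (a n)) * ?G) =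
      (\<lambda>n. of_real (2 * pi) powr (s - 1) * ?G * of_nat (Suc n) powr (- (1 - s)))"
  proof
    fix n
    have "complex_of_real (2 * pi * real (Suc n)) powr (s - 1) = of_real (2 * pi) powr (s - 1) * of_real (real (Suc n)) powr (s - 1)"
      unfolding of_real_mult[of "2 * pi"] by (rule powr_times_real) auto
    moreover have "exp ((s - 1) * of_real (a n)) = complex_of_real (2 * pi * real (Suc n)) powr (s - 1)"
      unfolding powr_def a_def by (subst Ln_of_real) (auto simp del: of_nat_Suc)
    ultimately show "exp ((s - 1) * of_real (a n)) * ?G = of_real (2 * pi) powr (s - 1) * ?G * of_nat (Suc n) powr (- (1 - s))"
      by simp
  qed
  also have "suminf \<dots> = of_real (2 * pi) powr (s - 1) * ?G * (zeta_pre (1 - s) / (1 - s - 1))"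
    using s by (intro sums_unique[symmetric] sums_mult zeta_pre_sums) auto
  finally show ?thesis by (simp add: mult.assoc)
qed

section \<open>Exponentials on half-lines, and the comparison of the two Mellin integrals\<close>

lemma has_bochner_integral_exp_Ioi:
  assumes "Re c < 0"
  shows "has_bochner_integral lborel (\<lambda>u. exp (c * of_real u) * of_real (indicator {0<..} u)) (- 1 / c)"
proof -
  have c: "c \<noteq> 0" using assms by auto
  have "set_integrable lborel {0<..} (\<lambda>u. exp (Re c * u))"
  proof -
    have "((\<lambda>u. exp (- (- Re c) * u)) has_integral exp (- (- Re c) * 0) / (- Re c)) {0..}"
      using assms by (intro has_integral_exp_minus_to_infinity) auto
    then have "(\<lambda>u. exp (Re c * u)) absolutely_integrable_on {0..}"
      by (intro nonnegative_absolutely_integrable_1) (auto simp: has_integral_iff)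
    then have "set_integrable lborel {0..} (\<lambda>u. exp (Re c * u))"
      by (simp add: set_integrable_def integrable_completion)
    then show ?thesis by (rule set_integrable_subset) auto
  qed
  then have int: "set_integrable lborel {0<..} (\<lambda>u. exp (c * of_real u))"
    by (rule set_integrable_bound) (auto simp: set_borel_measurable_def)
  have lim: "((\<lambda>u. exp (c * of_real u) / c) \<longlongrightarrow> 0) at_top"
  proof (rule tendsto_norm_zero_cancel)
    have "((\<lambda>u. exp (Re c * u) / norm c) \<longlongrightarrow> 0) at_top" using assms c by real_asymp
    then show "((\<lambda>u. norm (exp (c * of_real u) / c)) \<longlongrightarrow> 0) at_top"
      by (simp add: norm_divide)
  qed
  have "(LBINT u=ereal 0..\<infinity>. exp (c * of_real u)) = 0 - exp (c * of_real 0) / c"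
  proof (rule interval_integral_FTC_integrable[where F = "\<lambda>u. exp (c * of_real u) / c"])
    show "((\<lambda>u. exp (c * of_real u) / c) has_vector_derivative exp (c * of_real u)) (at u)" for u
      using c by (intro has_vector_derivative_real_field) (auto intro!: derivative_eq_intros)
    show "set_integrable lborel (einterval (ereal 0) \<infinity>) (\<lambda>u. exp (c * of_real u))"
      using int by (simp add: einterval_eq zero_ereal_def)
    show "(((\<lambda>u. exp (c * of_real u) / c) \<circ> real_of_ereal) \<longlongrightarrow> exp (c * of_real 0) / c) (at_right (ereal 0))"
      unfolding ereal_tendsto_simps using c by (intro tendsto_intros)
    show "(((\<lambda>u. exp (c * of_real u) / c) \<circ> real_of_ereal) \<longlongrightarrow> 0) (at_left \<infinity>)"
      unfolding ereal_tendsto_simps by (rule lim)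
  qed (auto intro!: continuous_intros)
  then have "(LINT u:{0<..}|lborel. exp (c * of_real u)) = - 1 / c"
    by (simp add: interval_lebesgue_integral_def einterval_eq zero_ereal_def)
  then show ?thesis
    using int by (simp add: has_bochner_integral_iff set_integrable_def set_lebesgue_integral_def
      scaleR_conv_of_real mult.commute)
qed

lemma has_bochner_integral_exp_Iio:
  assumes "Re c > 0"
  shows "has_bochner_integral lborel (\<lambda>u. exp (c * of_real u) * of_real (indicator {..<0} u)) (1 / c)"
proof -
  have "has_bochner_integral lborel (\<lambda>u. exp (- c * of_real u) * complex_of_real (indicator {0<..} u)) (- 1 / (- c))"
    using assms by (intro has_bochner_integral_exp_Ioi) auto
  then have "has_bochner_integral lborel (\<lambda>u. exp (- c * of_real (0 + (-1) * u)) * complex_of_real (indicator {0<..} (0 + (-1) * u))) ((- 1 / (- c)) /\<^sub>R \<bar>-1\<bar>)"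
    by (subst (asm) lborel_has_bochner_integral_real_affine_iff[of "-1" _ _ 0]) auto
  then show ?thesis
    by (simp add: indicator_def)
qed

lemma has_bochner_integral_exp_Ici:
  assumes "Re c < 0"
  shows "has_bochner_integral lborel (\<lambda>u. exp (c * of_real u) * of_real (indicator {0..} u)) (- 1 / c)"
proof -
  have ae: "AE u in lborel. exp (c * of_real u) * complex_of_real (indicator {0<..} u) = exp (c * of_real u) * of_real (indicator {0..} u)"
    using AE_lborel_singleton[of 0] by eventually_elim (auto simp: indicator_def)
  show ?thesis
    by (rule has_bochner_integralI_AE[OF has_bochner_integral_exp_Ioi[OF assms] _ ae]) auto
qed

text \<open>
  The Mellin integrals for \<open>Re s > 1\<close> and for \<open>-1 < Re s < 0\<close> differ from the function \<open>K\<close>, which is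
  holomorphic on the whole strip, by the same rational function.
\<close>
lemma zeta_pre_functional_strip:
  assumes s: "-1 < Re s" "Re s < 0"
  shows "Gamma (s + 1) * zeta_pre s =
    (1 - s) * of_real (2 * pi) powr (s - 1) * Gamma ((1 + s) / 2) * Gamma ((1 - s) / 2) * zeta_pre (1 - s)"
proof -
  \<comment> \<open>The midpoint of -1 and \<open>Re s\<close>: a real point to the left of
    \<open>s\<close> at which the Mellin integral of \<open>h\<close> still converges.\<close>
  define a where "a = (Re s - 1) / 2"
  have a: "-1 < a" "a < Re s" "a < 0" using s by (auto simp: a_def)
  define S where "S = {z. a < Re z \<and> Re z < 2}"
  define h where "h u = 1 / (exp (exp u) - 1) - exp (- u) + 1 / 2" for u :: real
  define b where "b u = 1 / (exp (exp u) - 1 :: real)" for u :: real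
  have h0: "h u \<ge> 0" for u
  proof -
    have "h u = 1 / (exp (exp u) - 1) - 1 / exp u + 1 / 2" by (simp add: h_def exp_minus divide_simps)
    moreover have "0 \<le> 1 / (exp (exp u) - 1) - 1 / exp u + 1 / 2"
      by (rule sums_le[OF _ sums_zero coth_partial_fractions]) auto
    ultimately show ?thesis by simp
  qed
  have b0: "b u \<ge> 0" for u by (simp add: b_def)
  \<comment> \<open>The singular part of \<open>1 / (exp y - 1)\<close> at y = 0 is removed for y <
    1 only. Thus \<open>k\<close> is built from \<open>h\<close> on the negative half-line and from
    \<open>b\<close> on the rest, and both ends decay for all exponents in \<open>S\<close>.\<close>
  define k where "k z u = exp (z * of_real u) * complex_of_real (b u - indicator {..<0} u * (exp (- u) - 1 / 2))" for z u
  define K where "K z = (LINT u|lborel. k z u)" for z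
  have "open {z. a < Re z}" "open {z. Re z < 2}"
    by (rule open_halfspace_Re_gt open_halfspace_Re_lt)+
  then have opS: "open S" unfolding S_def by (simp add: Collect_conj_eq open_Int)
  have cvS: "convex S"
    unfolding S_def Collect_conj_eq by (intro convex_Int convex_halfspace_Re_gt convex_halfspace_Re_lt)
  have hint: "has_bochner_integral lborel (\<lambda>u. exp (z * of_real u) * of_real (h u))
      (of_real (2 * pi) powr (z - 1) * Gamma ((1 + z) / 2) * Gamma ((1 - z) / 2) * (zeta_pre (1 - z) / (- z)))"
    if "-1 < Re z" "Re z < 0" for z
    unfolding h_def by (rule zeta_reflection_integral[OF that])
  have bint: "has_bochner_integral lborel (\<lambda>u. exp (z * of_real u) * of_real (b u)) (Gamma z * (zeta_pre z / (z - 1)))"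
    if "Re z > 1" for z
    unfolding b_def by (rule zeta_Gamma_integral[OF that])
  \<comment> \<open>For negative \<open>u\<close> the worst exponent in \<open>S\<close> is
    \<open>a\<close>, otherwise it is 2; the two known integrals at exactly these points show that
    the majorant is integrable.\<close>
  define g where "g u = exp (a * u) * h u + exp (2 * u) * b u" for u
  have gint: "integrable lborel g"
  proof -
    have "integrable lborel (\<lambda>u. Re (exp (of_real a * of_real u) * of_real (h u) + exp (2 * of_real u) * of_real (b u)))"
      using hint[of "of_real a"] bint[of 2] a by (intro integrable_Re Bochner_Integration.integrable_add) (auto simp: has_bochner_integral_iff)
    also have "(\<lambda>u. Re (exp (of_real a * of_real u) * of_real (h u) + exp (2 * of_real u) * of_real (b u))) = g"
      by (auto simp: g_def Re_exp)
    finally show ?thesis .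
  qed
  have "K holomorphic_on S"
    unfolding K_def
  proof (rule holomorphic_lebesgue_integral[OF opS _ _ gint])
    show "(\<lambda>z. k z u) holomorphic_on S" for u
      unfolding k_def by (intro holomorphic_intros)
    show "k z \<in> borel_measurable lborel" for z
      unfolding k_def b_def by measurable
    show "norm (k z u) \<le> g u" if "z \<in> S" for z u
    proof (cases "u < 0")
      case True
      have "norm (k z u) = exp (Re z * u) * \<bar>h u\<bar>"
        using True unfolding k_def norm_mult norm_of_real by (simp add: b_def h_def algebra_simps)
      also have "\<dots> = exp (Re z * u) * h u" using h0[of u] by simp
      also have "\<dots> \<le> exp (a * u) * h u"
        using that True h0[of u] by (intro mult_right_mono) (auto simp: S_def intro: mult_right_mono_neg)
      also have "\<dots> \<le> g u" using b0[of u] by (simp add: g_def)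
      finally show ?thesis .
    next
      case False
      have "norm (k z u) = exp (Re z * u) * b u"
        using False b0[of u] unfolding k_def norm_mult norm_of_real by simp
      also have "\<dots> \<le> exp (2 * u) * b u"
        using that False b0[of u] by (intro mult_right_mono) (auto simp: S_def intro: mult_right_mono)
      also have "\<dots> \<le> g u" using h0[of u] by (simp add: g_def)
      finally show ?thesis .
    qed
  qed
  \<comment> \<open>The removed part integrates to \<open>1 / (z - 1) - 1 / (2 * z)\<close>;
    multiplying by \<open>z * (z - 1)\<close> clears both poles, which lie in
    \<open>S\<close>.\<close>
  then have hol1: "(\<lambda>z. z * (z - 1) * K z + z - (z - 1) / 2) holomorphic_on S"
    by (intro holomorphic_intros) auto
  have "zeta_pre holomorphic_on S"
    by (rule holomorphic_on_subset[OF zeta_pre_holomorphic]) (use a in \<open>auto simp: S_def\<close>)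
  then have hol2: "(\<lambda>z. Gamma (z + 1) * zeta_pre z) holomorphic_on S"
    using a by (intro holomorphic_intros) (auto simp: S_def nonpos_Ints_def complex_eq_iff)
  have K1: "z * (z - 1) * K z + z - (z - 1) / 2 = Gamma (z + 1) * zeta_pre z" if z: "1 < Re z" "Re z < 2" for z
  proof -
    have z0: "z \<noteq> 0" "z \<noteq> 1" using z by auto
    have "has_bochner_integral lborel
       (\<lambda>u. exp (z * of_real u) * of_real (b u)
             - (exp ((z - 1) * of_real u) * of_real (indicator {..<0} u) - 1/2 * (exp (z * of_real u) * of_real (indicator {..<0} u))))
       (Gamma z * (zeta_pre z / (z - 1)) - (1 / (z - 1) - 1/2 * (1 / z)))"
      by (intro has_bochner_integral_diff has_bochner_integral_mult_right has_bochner_integral_exp_Iio bint) (use z in auto)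
    also have "(\<lambda>u. exp (z * of_real u) * of_real (b u)
             - (exp ((z - 1) * of_real u) * of_real (indicator {..<0} u) - 1/2 * (exp (z * of_real u) * of_real (indicator {..<0} u)))) = k z"
      by (auto simp: k_def fun_eq_iff left_diff_distrib exp_diff exp_minus exp_of_real[symmetric] field_simps)
    finally have "K z = Gamma z * (zeta_pre z / (z - 1)) - (1 / (z - 1) - 1/2 * (1 / z))"
      by (simp add: K_def has_bochner_integral_iff)
    moreover have "Gamma (z + 1) = z * Gamma z" using z by (intro Gamma_plus1) (auto simp: nonpos_Ints_def)
    moreover have "z * w * (G * (Z / w) - (1 / w - 1/2 * (1 / z))) + z - w / 2 = z * G * Z"
      if "w \<noteq> 0" for w G Z :: complex
      using that z0 by (simp add: field_simps)
    ultimately show ?thesis using z0 by simp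
  qed
  have f1: "s * (s - 1) * K s + s - (s - 1) / 2 = Gamma (s + 1) * zeta_pre s"
  proof (rule analytic_continuation_open[OF _ opS _ _ _ hol1 hol2])
    have "open {z. 1 < Re z}" "open {z. Re z < 2}"
      by (rule open_halfspace_Re_gt open_halfspace_Re_lt)+
    then show "open {z. 1 < Re z \<and> Re z < 2}" by (simp add: Collect_conj_eq open_Int)
    have "Complex (3/2) 0 \<in> {z. 1 < Re z \<and> Re z < 2}" by simp
    then show "{z. 1 < Re z \<and> Re z < 2} \<noteq> {}" by blast
    show "connected S" using cvS by (rule convex_connected)
    show "s \<in> S" using a s by (auto simp: S_def)
  qed (use a K1 in \<open>auto simp: S_def\<close>)
  have f2: "K s = of_real (2 * pi) powr (s - 1) * Gamma ((1 + s) / 2) * Gamma ((1 - s) / 2) * (zeta_pre (1 - s) / (- s))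
     + (- 1 / (s - 1) - 1/2 * (- 1 / s))"
  proof -
    have "has_bochner_integral lborel
       (\<lambda>u. exp (s * of_real u) * of_real (h u)
             + (exp ((s - 1) * of_real u) * of_real (indicator {0..} u) - 1/2 * (exp (s * of_real u) * of_real (indicator {0..} u))))
       (of_real (2 * pi) powr (s - 1) * Gamma ((1 + s) / 2) * Gamma ((1 - s) / 2) * (zeta_pre (1 - s) / (- s))
         + (- 1 / (s - 1) - 1/2 * (- 1 / s)))"
      by (intro has_bochner_integral_add has_bochner_integral_diff has_bochner_integral_mult_right has_bochner_integral_exp_Ici hint) (use s in auto)
    also have "(\<lambda>u. exp (s * of_real u) * of_real (h u)
             + (exp ((s - 1) * of_real u) * of_real (indicator {0..} u) - 1/2 * (exp (s * of_real u) * of_real (indicator {0..} u)))) = k s"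
    proof
      fix u
      have hb: "h u = b u - exp (- u) + 1 / 2" by (simp add: h_def b_def)
      have e: "exp ((s - 1) * of_real u) = exp (s * of_real u) * complex_of_real (exp (- u))"
        by (simp add: exp_of_real[symmetric] left_diff_distrib flip: exp_add)
      show "exp (s * of_real u) * of_real (h u)
             + (exp ((s - 1) * of_real u) * of_real (indicator {0..} u) - 1/2 * (exp (s * of_real u) * of_real (indicator {0..} u))) = k s u"
        unfolding e k_def hb by (cases "u < 0") (simp_all add: algebra_simps)
    qed
    finally show ?thesis by (simp add: K_def has_bochner_integral_iff)
  qed
  have f3: "s * w * (P * (Z / (- s)) + (- 1 / w - 1/2 * (- 1 / s))) + s - w / 2 = - w * P * Z"
    if "w \<noteq> 0" for w P Z :: complex
    using that s by (auto simp: field_simps)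
  have "s - 1 \<noteq> 0" using s by auto
  from trans[OF f1[unfolded f2, symmetric] f3[OF this]] show ?thesis
    by (simp add: algebra_simps)
qed

subsection \<open>Continuation to the plane\<close>

lemma sin_of_real_pi_times_nonzero:
  assumes "s \<notin> \<int>" shows "sin (complex_of_real pi * s) \<noteq> 0"
proof
  assume "sin (complex_of_real pi * s) = 0"
  then obtain n :: int where "complex_of_real pi * s = of_real (of_int n * pi)"
    unfolding sin_eq_0 by blast
  then have "complex_of_real pi * s = complex_of_real pi * of_int n" by (simp only: of_real_mult of_real_of_int_eq mult.commute)
  then have "s = of_int n" by simp
  with assms show False by simp
qed

text \<open>The reflection formula at \<open>(1 + s) / 2\<close> gives pi / cos (pi * s / 2), and at
  \<open>- s\<close> it gives \<open>Gamma (s + 1) * Gamma (1 - s) = s * pi / sin (pi * s)\<close>.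
  By the double angle formula only \<open>2 * sin (pi * s / 2)\<close> survives in the
  quotient.\<close>

lemma zeta_pre_reflect_strip:
  assumes s: "-1 < Re s" "Re s < 0"
  shows "zeta_pre s / (s - 1) =
    2 * of_real (2 * pi) powr (s - 1) * sin (of_real pi * s / 2) * Gamma (1 - s) * (zeta_pre (1 - s) / (- s))"
proof -
  define S where "S = sin (of_real pi * s / 2)"
  define C where "C = cos (of_real pi * s / 2)"
  define P where "P = complex_of_real (2 * pi) powr (s - 1)"
  have sZ: "s \<notin> \<int>" using s by (auto simp: Ints_def)
  have SC: "sin (of_real pi * s) = 2 * S * C"
    using sin_double[of "of_real pi * s / 2"] by (simp add: S_def C_def)
  have "sin (of_real pi * s) \<noteq> 0"
    by (rule sin_of_real_pi_times_nonzero[OF sZ])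
  then have nz: "S \<noteq> 0" "C \<noteq> 0" by (auto simp: SC)
  have s0: "s \<noteq> 0" "s \<noteq> 1" using s by auto
  have "Gamma ((1 + s) / 2) * Gamma (1 - (1 + s) / 2) = of_real pi / sin (of_real pi * ((1 + s) / 2))"
    by (rule Gamma_reflection_complex)
  also have "1 - (1 + s) / 2 = (1 - s) / 2" by (simp add: field_simps)
  also have "sin (of_real pi * ((1 + s) / 2)) = C"
    by (simp add: C_def sin_add distrib_left add_divide_distrib sin_cos_eq cos_of_real flip: of_real_divide) 
  finally have 1: "Gamma ((1 + s) / 2) * Gamma ((1 - s) / 2) = of_real pi / C" .
  have "Gamma (- s) * Gamma (1 - (- s)) = of_real pi / sin (of_real pi * (- s))"
    by (rule Gamma_reflection_complex)
  moreover have "Gamma (1 - s) = - s * Gamma (- s)"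
    using Gamma_plus1[of "-s"] sZ nonpos_Ints_Int[of "-s"] by (auto simp: minus_in_Ints_iff)
  ultimately have "Gamma (s + 1) * Gamma (1 - s) = s * of_real pi / sin (of_real pi * s)"
    by (simp add: add.commute mult_ac)
  then have 2: "Gamma (s + 1) * Gamma (1 - s) = s * of_real pi / (2 * S * C)"
    unfolding SC .
  have "Gamma (s + 1) * zeta_pre s * Gamma (1 - s) = (1 - s) * P * (Gamma ((1 + s) / 2) * Gamma ((1 - s) / 2)) * zeta_pre (1 - s) * Gamma (1 - s)"
    using zeta_pre_functional_strip[OF s] by (simp add: P_def mult.assoc)
  then have "(Gamma (s + 1) * Gamma (1 - s)) * zeta_pre s = (1 - s) * P * (Gamma ((1 + s) / 2) * Gamma ((1 - s) / 2)) * zeta_pre (1 - s) * Gamma (1 - s)"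
    by (simp only: mult_ac)
  then have "s * of_real pi / (2 * S * C) * zeta_pre s = (1 - s) * P * (of_real pi / C) * zeta_pre (1 - s) * Gamma (1 - s)"
    unfolding 1 2 .
  moreover have "s * zeta_pre s = 2 * S * C / of_real pi * (s * of_real pi / (2 * S * C) * zeta_pre s)"
    using nz by simp
  moreover have "2 * S * C / of_real pi * ((1 - s) * P * (of_real pi / C) * X * Y) = (1 - s) * P * 2 * S * X * Y" for X Y
    using nz by simp
  ultimately have "s * zeta_pre s = (1 - s) * P * 2 * S * zeta_pre (1 - s) * Gamma (1 - s)"
    by (simp only:)
  then have e: "zeta_pre s = (1 - s) * (P * 2 * S * zeta_pre (1 - s) * Gamma (1 - s)) / s"
    using s0 by (simp add: field_simps)
  have "(1 - s) * x / s / (s - 1) = - x / s" for x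
  proof -
    have "- w * x / s / w = - x / s" if "w \<noteq> 0" for w using that by simp
    from this[of "s - 1"] show ?thesis using s0 by simp
  qed
  then have "zeta_pre s / (s - 1) = - (P * 2 * S * zeta_pre (1 - s) * Gamma (1 - s)) / s"
    by (subst e)
  then show ?thesis by (simp add: P_def S_def mult_ac)
qed

text \<open>Although the case split is at -1, both formulas are valid in the strip
  \<open>-1 < Re s < 0\<close>, and this overlap makes the glued function holomorphic. At 1 the
  division by zero yields 0, the value prescribed for \<open>riemann_zeta\<close>.\<close>

definition zeta_cont :: "complex \<Rightarrow> complex" where
  "zeta_cont s = (if Re s > -1 then zeta_pre s / (s - 1)
     else 2 * of_real (2 * pi) powr (s - 1) * sin (of_real pi * s / 2) * Gamma (1 - s) * (zeta_pre (1 - s) / (- s)))"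

lemma zeta_cont_reflect:
  assumes "Re s < 0"
  shows "zeta_cont s = 2 * of_real (2 * pi) powr (s - 1) * sin (of_real pi * s / 2) * Gamma (1 - s) * (zeta_pre (1 - s) / (- s))"
  using zeta_pre_reflect_strip[of s] assms by (simp add: zeta_cont_def)

lemma zeta_cont_holomorphic: "zeta_cont holomorphic_on (- {1})"
proof -
  have "(\<lambda>s. zeta_pre s / (s - 1)) holomorphic_on {s. Re s > -1} - {1}"
    by (intro holomorphic_intros holomorphic_on_subset[OF zeta_pre_holomorphic]) auto
  then have 1: "zeta_cont holomorphic_on {s. Re s > -1} - {1}"
    by (rule holomorphic_transform) (simp add: zeta_cont_def)
  have "(\<lambda>s. zeta_pre (1 - s)) holomorphic_on {s. Re s < 0}"
    by (rule holomorphic_on_compose_gen[of "\<lambda>s. 1 - s", unfolded o_def, OF _ zeta_pre_holomorphic])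
       (auto intro!: holomorphic_intros)
  then have "(\<lambda>s. 2 * of_real (2 * pi) powr (s - 1) * sin (of_real pi * s / 2) * Gamma (1 - s) * (zeta_pre (1 - s) / (- s)))
       holomorphic_on {s. Re s < 0}"
    by (intro holomorphic_intros) (auto simp: nonpos_Ints_def complex_eq_iff)
  then have 2: "zeta_cont holomorphic_on {s. Re s < 0}"
    by (rule holomorphic_transform) (simp add: zeta_cont_reflect)
  have o: "open ({s. Re s > -1} - {1})" "open {s. Re s < 0}"
    by (auto intro!: open_halfspace_Re_gt open_halfspace_Re_lt open_Diff)
  have "zeta_cont holomorphic_on (({s. Re s > -1} - {1}) \<union> {s. Re s < 0})"
    by (rule holomorphic_on_Un[OF 1 2 o])
  moreover have "({s. Re s > -1} - {1}) \<union> {s. Re s < 0} = - {1}" by auto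
  ultimately show ?thesis by simp
qed

lemma zeta_cont_sums:
  assumes "Re s > 1" shows "(\<lambda>n. of_nat (Suc n) powr (- s)) sums zeta_cont s"
proof -
  have "zeta_cont s = zeta_pre s / (s - 1)" using assms by (simp add: zeta_cont_def)
  then show ?thesis using zeta_pre_sums[OF assms] by (simp only:)
qed

section \<open>Identification with \<open>riemann_zeta\<close> and the functional equation in the
  plane\<close>

lemma connected_minus_1: "connected (- {1::complex})"
  by (rule connected_punctured_universe) simp

lemma riemann_zeta_eq_zeta_cont: "riemann_zeta = zeta_cont"
  unfolding riemann_zeta_def
proof (rule the_equality)
  show "zeta_cont holomorphic_on - {1} \<and> zeta_cont 1 = 0 \<and>
     (\<forall>s. Re s > 1 \<longrightarrow> (\<lambda>n. of_nat (Suc n) powr (- s)) sums zeta_cont s)"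
    using zeta_cont_holomorphic zeta_cont_sums by (auto simp: zeta_cont_def[of 1])
next
  fix f assume f: "f holomorphic_on - {1} \<and> f 1 = 0 \<and>
     (\<forall>s. Re s > 1 \<longrightarrow> (\<lambda>n. of_nat (Suc n) powr (- s)) sums f s)"
  show "f = zeta_cont"
  proof
    fix s show "f s = zeta_cont s"
    proof (cases "s = 1")
      case False
      have "2 \<in> {s. Re s > 1}" by simp
      then have ne: "{s. Re s > 1} \<noteq> {}" by blast
      show ?thesis
      proof (rule analytic_continuation_open[of "{s. Re s > 1}" "- {1}" f zeta_cont])
        show "f z = zeta_cont z" if "z \<in> {s. Re s > 1}" for z
          using f zeta_cont_sums[of z] that by (auto dest: sums_unique2)
      qed (use f zeta_cont_holomorphic False ne in \<open>auto intro: open_halfspace_Re_gt connected_minus_1\<close>)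
    qed (use f in \<open>simp add: zeta_cont_def\<close>)
  qed
qed

lemma riemann_zeta_eq: "Re s > -1 \<Longrightarrow> riemann_zeta s = zeta_pre s / (s - 1)"
  by (simp add: riemann_zeta_eq_zeta_cont zeta_cont_def)

lemma riemann_zeta_holomorphic: "riemann_zeta holomorphic_on - {1}"
  by (simp add: riemann_zeta_eq_zeta_cont zeta_cont_holomorphic)

lemma riemann_zeta_sums: "Re s > 1 \<Longrightarrow> (\<lambda>n. of_nat (Suc n) powr (- s)) sums riemann_zeta s"
  unfolding riemann_zeta_eq_zeta_cont by (rule zeta_cont_sums)

lemma riemann_zeta_reflect:
  assumes "Re s < 0"
  shows "riemann_zeta s = 2 * of_real (2 * pi) powr (s - 1) * sin (of_real pi * s / 2) * Gamma (1 - s) * riemann_zeta (1 - s)"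
  using zeta_cont_reflect[OF assms] assms by (simp add: riemann_zeta_eq_zeta_cont zeta_cont_def[of "1 - s"])

text \<open>For \<open>Re s > 1\<close> this is the reflection formula at \<open>1 - s\<close>. It
  continues to the complement of 1 and of the poles of Gamma, which is connected because a countable
  set is removed.\<close>

lemma riemann_zeta_functional:
  assumes "s \<notin> \<int>\<^sub>\<le>\<^sub>0" "s \<noteq> 1"
  shows "riemann_zeta (1 - s) = 2 * of_real (2 * pi) powr (- s) * cos (of_real pi * s / 2) * Gamma s * riemann_zeta s"
proof -
  define D where "D = (- insert 1 \<int>\<^sub>\<le>\<^sub>0 :: complex set)"
  have cl: "closed (insert 1 \<int>\<^sub>\<le>\<^sub>0 :: complex set)" by (intro closed_insert closed_nonpos_Ints)
  have "countable (insert 1 \<int>\<^sub>\<le>\<^sub>0 :: complex set)"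
    by (intro countable_insert countable_subset[of "\<int>\<^sub>\<le>\<^sub>0" "range of_int"]) (auto simp: nonpos_Ints_def)
  then have conn: "connected D" unfolding D_def
    by (intro path_connected_imp_connected path_connected_complement_countable) auto
  have opD: "open D" using cl by (simp add: D_def open_Compl)
  have h1: "(\<lambda>s. riemann_zeta (1 - s)) holomorphic_on D"
    by (rule holomorphic_on_compose_gen[of "\<lambda>s. 1 - s", unfolded o_def, OF _ riemann_zeta_holomorphic])
       (auto simp: D_def intro!: holomorphic_intros)
  have h2: "(\<lambda>s. 2 * of_real (2 * pi) powr (- s) * cos (of_real pi * s / 2) * Gamma s * riemann_zeta s) holomorphic_on D"
    by (intro holomorphic_intros holomorphic_on_subset[OF riemann_zeta_holomorphic]) (auto simp: D_def)
  have "2 \<in> {s. Re s > 1}" by simp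
  then have ne: "{s. Re s > 1} \<noteq> {}" by blast
  show ?thesis
  proof (rule analytic_continuation_open[OF _ opD ne conn _ h1 h2])
    show "open {s. Re s > 1}" by (rule open_halfspace_Re_gt)
    show "{s. Re s > 1} \<subseteq> D" by (auto simp: D_def nonpos_Ints_def)
    show "s \<in> D" using assms by (simp add: D_def)
    show "riemann_zeta (1 - z) = 2 * of_real (2 * pi) powr (- z) * cos (of_real pi * z / 2) * Gamma z * riemann_zeta z"
      if "z \<in> {s. Re s > 1}" for z
    proof -
      have "sin (of_real pi * (1 - z) / 2) = cos (of_real pi * z / 2)"
        by (simp add: right_diff_distrib diff_divide_distrib sin_diff sin_of_real cos_of_real flip: of_real_divide)
      then show ?thesis using riemann_zeta_reflect[of "1 - z"] that by simp
    qed
  qed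
qed

text \<open>The functional equation is applied at \<open>s\<close> and at \<open>2 * s - 1\<close>.
  At the latter the cosine becomes sin (pi * s) = 2 * sin (pi * s / 2) * cos (pi * s / 2), whose
  cosine cancels the one from zeta (1 - s).\<close>

lemma zeta_quotient_eq:
  assumes s: "s \<notin> \<int>" and s2: "2 * s - 1 \<notin> \<int>\<^sub>\<le>\<^sub>0"
  shows "riemann_zeta (2 - 2 * s) / (riemann_zeta (1 - s) * (4 * of_real pi * sin (of_real pi * s / 2))) =
         riemann_zeta (2 * s - 1) * Gamma (2 * s - 1) / (riemann_zeta s * Gamma s * of_real (2 * pi) powr s)"
proof -
  define S where "S = sin (of_real pi * s / 2)"
  define C where "C = cos (of_real pi * s / 2)"
  define P where "P = complex_of_real (2 * pi) powr s"
  have SC: "sin (of_real pi * s) = 2 * S * C"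
    using sin_double[of "of_real pi * s / 2"] by (simp add: S_def C_def)
  have "sin (of_real pi * s) \<noteq> 0"
    by (rule sin_of_real_pi_times_nonzero[OF s])
  then have nz: "S \<noteq> 0" "C \<noteq> 0" by (auto simp: SC)
  have P0: "P \<noteq> 0" by (simp add: P_def)
  have ns: "s \<notin> \<int>\<^sub>\<le>\<^sub>0" "s \<noteq> 1" using s by (auto dest: nonpos_Ints_Int)
  have G0: "Gamma s \<noteq> 0" using ns by (simp add: Gamma_eq_zero_iff)
  have 1: "riemann_zeta (1 - s) = 2 / P * C * Gamma s * riemann_zeta s"
    using riemann_zeta_functional[OF ns] unfolding P_def C_def powr_minus_divide by simp
  have c: "cos (of_real pi * (2 * s - 1) / 2) = 2 * S * C"
    unfolding SC[symmetric]
    by (simp add: right_diff_distrib diff_divide_distrib cos_diff sin_of_real cos_of_real flip: of_real_divide)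
  have p: "of_real (2 * pi) powr (- (2 * s - 1)) = of_real (2 * pi) / (P * P)"
  proof -
    have "- (2 * s - 1) = 1 - (s + s)" by simp
    then show ?thesis unfolding P_def by (simp only: powr_diff powr_add) simp
  qed
  have "2 * s - 1 \<noteq> 1" using ns by auto
  from riemann_zeta_functional[OF s2 this]
  have 2: "riemann_zeta (2 - 2 * s) = 2 * (of_real (2 * pi) / (P * P)) * (2 * S * C) * Gamma (2 * s - 1) * riemann_zeta (2 * s - 1)"
    unfolding c p by (simp add: algebra_simps)
  show ?thesis
  \<comment> \<open>At a zero both denominators vanish, so both sides are 0 by the convention for
    division.\<close>
  proof (cases "riemann_zeta s = 0")
    case False
    then show ?thesis unfolding 1 2 S_def[symmetric] P_def[symmetric]
      using nz P0 G0 by (simp add: field_simps)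
  qed (simp add: 1)
qed

subsection \<open>Dirichlet series\<close>

lemma has_sum_Times:
  fixes f g :: "'a \<Rightarrow> complex"
  assumes f: "(f has_sum S) A" "(\<lambda>x. norm (f x)) summable_on A"
    and g: "(g has_sum T) B" "(\<lambda>x. norm (g x)) summable_on B"
  shows "((\<lambda>(a, b). f a * g b) has_sum (S * T)) (A \<times> B)"
    and "(\<lambda>(a, b). norm (f a * g b)) summable_on (A \<times> B)"
proof -
  have "(\<lambda>(a, b). norm (f a * g b)) summable_on Sigma A (\<lambda>_. B)"
  proof (rule summable_on_SigmaI)
    show "((\<lambda>b. case (a, b) of (a, b) \<Rightarrow> norm (f a * g b)) has_sum norm (f a) * infsum (\<lambda>x. norm (g x)) B) B" for a
      unfolding prod.case norm_mult using g(2) by (intro has_sum_cmult_right has_sum_infsum)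
    show "(\<lambda>a. norm (f a) * infsum (\<lambda>x. norm (g x)) B) summable_on A"
      using f(2) by (intro summable_on_cmult_left)
  qed auto
  then show sm: "(\<lambda>(a, b). norm (f a * g b)) summable_on (A \<times> B)" .
  show "((\<lambda>(a, b). f a * g b) has_sum (S * T)) (A \<times> B)"
  proof (rule has_sum_SigmaI)
    show "((\<lambda>b. case (a, b) of (a, b) \<Rightarrow> f a * g b) has_sum f a * T) B" for a
      unfolding prod.case using g(1) by (intro has_sum_cmult_right)
    show "((\<lambda>a. f a * T) has_sum S * T) A"
      using f(1) by (intro has_sum_cmult_left)
    have "(\<lambda>x. norm (case x of (a, b) \<Rightarrow> f a * g b)) summable_on (A \<times> B)"
      using sm by (simp add: case_prod_unfold)
    then show "(\<lambda>(a, b). f a * g b) summable_on A \<times> B"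
      by (rule abs_summable_summable)
  qed
qed

lemma bij_betw_Suc_greaterThan_0: "bij_betw Suc UNIV {0<..}"
  by (rule bij_betwI[of _ _ _ "\<lambda>n. n - 1"]) auto

lemma norm_nat_powr: "n > 0 \<Longrightarrow> norm (of_nat n powr s :: complex) = real n powr Re s"
  using norm_powr_real_powr[of "of_nat n" s] by simp

lemma nat_powr_norm_summable:
  assumes "Re s > 1"
  shows "(\<lambda>n. norm (of_nat n powr (-s) :: complex)) summable_on {0<..}"
proof -
  have "summable (\<lambda>n. real (Suc n) powr (- Re s))" using assms by (intro summable_Suc_powr) auto
  then have "(\<lambda>n. real (Suc n) powr (- Re s)) summable_on UNIV"
    by (subst summable_on_UNIV_nonneg_real_iff) auto
  then have "(\<lambda>n. norm (of_nat (Suc n) powr (-s) :: complex)) summable_on UNIV"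
    by (subst norm_nat_powr) auto
  then show ?thesis
    by (subst (asm) summable_on_reindex_bij_betw[OF bij_betw_Suc_greaterThan_0])
qed

lemma riemann_zeta_has_sum:
  assumes "Re s > 1"
  shows "((\<lambda>n. of_nat n powr (-s)) has_sum riemann_zeta s) {0<..}"
proof -
  have "summable (\<lambda>n. norm (of_nat (Suc n) powr (-s) :: complex))"
    using summable_Suc_powr[of "- Re s"] assms by (subst norm_nat_powr) auto
  then have "((\<lambda>n. of_nat (Suc n) powr (-s)) has_sum riemann_zeta s) UNIV"
    using riemann_zeta_sums[OF assms] by (rule norm_summable_imp_has_sum)
  then show ?thesis
    by (subst (asm) has_sum_reindex_bij_betw[OF bij_betw_Suc_greaterThan_0])
qed

section \<open>The Moebius function and the reciprocal of zeta\<close>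

lemma moebius_prime_mult:
  assumes p: "prime p" and e: "squarefree e" "\<not> p dvd e"
  shows "squarefree (p * e)" "moebius (p * e) = - moebius e"
proof -
  have cop: "coprime p e" using p e(2) by (rule prime_imp_coprime)
  show sq: "squarefree (p * e)"
    using squarefree_mult_coprime[OF cop squarefree_prime[OF p] e(1)] .
  have "e \<noteq> 0" using e(2) by (cases "e = 0") auto
  then have "prime_factors (p * e) = insert p (prime_factors e)"
    using p prime_factors_product[of p e] by (auto simp: prime_prime_factors)
  moreover have "p \<notin> prime_factors e" using e(2) by auto
  ultimately have "card (prime_factors (p * e)) = Suc (card (prime_factors e))" by simp
  then show "moebius (p * e) = - moebius e" using sq e(1) by (simp add: moebius_def)
qed

text \<open>For a prime \<open>p\<close> dividing \<open>n\<close>, the squarefree divisors pair up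
  as \<open>d\<close> and \<open>p * d\<close> with \<open>d\<close> prime to \<open>p\<close>, and
  each pair cancels.\<close>

lemma sum_moebius_divisors:
  assumes n: "n > 0"
  shows "(\<Sum>d | d dvd n. moebius d) = (if n = 1 then 1 else 0)"
proof (cases "n = 1")
  case False
  then obtain p where p: "prime p" "p dvd n" using prime_factor_nat by blast
  define S where "S = {d. d dvd n \<and> squarefree d}"
  define S0 where "S0 = {d \<in> S. \<not> p dvd d}"
  have fin: "finite {d. d dvd n}" using n by (rule finite_divisors_nat)
  then have finS: "finite S0" by (intro finite_subset[OF _ fin]) (auto simp: S0_def S_def)
  have "S = S0 \<union> (*) p ` S0"
  proof (intro subset_antisym subsetI)
    fix d assume d: "d \<in> S"
    show "d \<in> S0 \<union> (*) p ` S0"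
    proof (cases "p dvd d")
      case True
      then obtain e where e: "d = p * e" by auto
      have "\<not> p dvd e"
      proof
        assume "p dvd e"
        then have "p ^ 2 dvd d" by (auto simp: e power2_eq_square)
        then show False using squarefreeD[of d p] d p by (auto simp: S_def)
      qed
      moreover have "squarefree e" using d squarefree_mono[of e d] by (auto simp: e S_def)
      moreover have "e dvd n" using d dvd_mult_right[of p e n] by (simp add: e S_def)
      ultimately show ?thesis by (auto simp: S0_def S_def e)
    qed (use d in \<open>auto simp: S0_def\<close>)
  next
    fix d assume "d \<in> S0 \<union> (*) p ` S0"
    then consider "d \<in> S0" | e where "e \<in> S0" "d = p * e" by blast
    then show "d \<in> S"
    proof cases
      case 2
      then have e: "squarefree e" "\<not> p dvd e" "e dvd n" by (auto simp: S0_def S_def)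
      have "coprime p e" using p(1) e(2) by (rule prime_imp_coprime)
      then have "p * e dvd n" using p(2) e(3) by (simp add: divides_mult)
      then show ?thesis using moebius_prime_mult(1)[OF p(1) e(1,2)] by (simp add: S_def 2)
    qed (simp add: S0_def)
  qed
  moreover have "S0 \<inter> (*) p ` S0 = {}" by (auto simp: S0_def)
  ultimately have "(\<Sum>d\<in>S. moebius d) = (\<Sum>d\<in>S0. moebius d) + (\<Sum>d\<in>(*) p ` S0. moebius d)"
    using finS by (simp add: sum.union_disjoint)
  also have "(\<Sum>d\<in>(*) p ` S0. moebius d) = (\<Sum>d\<in>S0. moebius (p * d))"
    using p by (subst sum.reindex) (auto simp: inj_on_def)
  also have "\<dots> = (\<Sum>d\<in>S0. - moebius d)"
    by (intro sum.cong moebius_prime_mult p) (auto simp: S0_def S_def)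
  finally have "(\<Sum>d\<in>S. moebius d) = 0" by (simp add: sum_negf)
  moreover have "(\<Sum>d | d dvd n. moebius d) = (\<Sum>d\<in>S. moebius d)"
    using fin by (intro sum.mono_neutral_right) (auto simp: S_def moebius_def)
  ultimately show ?thesis using False by simp
qed (simp add: moebius_def)

lemma of_nat_mult_powr:
  "of_nat (m * n) powr s = of_nat m powr s * (of_nat n powr s :: complex)"
  using powr_times_real[of "of_nat m" "of_nat n" s] by simp

lemma moebius_norm_le: "norm (of_int (moebius n) :: complex) \<le> 1"
  by (simp add: moebius_def)

definition moebius_series :: "complex \<Rightarrow> complex" where
  "moebius_series s = (\<Sum>\<^sub>\<infinity>n\<in>{0<..}. of_int (moebius n) * of_nat n powr (-s))"

lemma moebius_series_norm_summable:
  assumes "Re s > 1"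
  shows "(\<lambda>n. norm (of_int (moebius n) * of_nat n powr (-s) :: complex)) summable_on {0<..}"
proof (rule summable_on_comparison_test[OF nat_powr_norm_summable[OF assms]])
  show "norm (of_int (moebius n) * of_nat n powr (-s) :: complex) \<le> norm (of_nat n powr (-s) :: complex)" for n
    using mult_right_mono[OF moebius_norm_le[of n] norm_ge_zero] by (simp add: norm_mult)
qed auto

lemma moebius_series_has_sum:
  assumes "Re s > 1"
  shows "((\<lambda>n. of_int (moebius n) * of_nat n powr (-s)) has_sum moebius_series s) {0<..}"
  unfolding moebius_series_def
  by (rule has_sum_infsum[OF abs_summable_summable[OF moebius_series_norm_summable[OF assms]]])

text \<open>The absolutely convergent double series over pairs \<open>(a, b)\<close> is regrouped by
  the product \<open>n = a * b\<close>, so that \<open>b\<close> runs through the divisors of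
  \<open>n\<close> and only \<open>n = 1\<close> survives.\<close>

lemma zeta_times_moebius_series:
  assumes s: "Re s > 1"
  shows "riemann_zeta s * moebius_series s = 1"
proof -
  have "((\<lambda>(a, b). of_nat a powr (-s) * (of_int (moebius b) * of_nat b powr (-s))) has_sum
      (riemann_zeta s * moebius_series s)) ({0<..} \<times> {0<..})"
    by (intro has_sum_Times riemann_zeta_has_sum nat_powr_norm_summable moebius_series_norm_summable moebius_series_has_sum s)
  also have "?this \<longleftrightarrow> ((\<lambda>(n, d). of_int (moebius d) * of_nat n powr (-s)) has_sum (riemann_zeta s * moebius_series s))
      (SIGMA n:{0<..}. {d. d dvd n})"
  proof (rule has_sum_reindex_bij_witness[where i = "\<lambda>(n, d). (n div d, d)" and j = "\<lambda>(a, b). (a * b, b)"])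
    fix x :: "nat \<times> nat" assume "x \<in> (SIGMA n:{0<..}. {d. d dvd n})"
    then obtain n d where x: "x = (n, d)" "n > 0" "d dvd n" by auto
    then obtain c where "n = d * c" by auto
    then show "(case (case x of (n, d) \<Rightarrow> (n div d, d)) of (a, b) \<Rightarrow> (a * b, b)) = x"
      and "(case x of (n, d) \<Rightarrow> (n div d, d)) \<in> {0<..} \<times> {0<..}"
      using x by auto
  next
    fix y :: "nat \<times> nat" assume "y \<in> {0<..} \<times> {0<..}"
    then obtain a b where y: "y = (a, b)" "a > 0" "b > 0" by auto
    then show "(case (case y of (a, b) \<Rightarrow> (a * b, b)) of (n, d) \<Rightarrow> (n div d, d)) = y"
      and "(case y of (a, b) \<Rightarrow> (a * b, b)) \<in> (SIGMA n:{0<..}. {d. d dvd n})"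
      by auto
    show "(case (case y of (a, b) \<Rightarrow> (a * b, b)) of (n, d) \<Rightarrow> of_int (moebius d) * of_nat n powr (-s)) =
          (case y of (a, b) \<Rightarrow> of_nat a powr (-s) * (of_int (moebius b) * (of_nat b powr (-s) :: complex)))"
      unfolding y(1) prod.case of_nat_mult_powr by (simp only: mult_ac)
  qed simp
  finally have 1: "((\<lambda>(n, d). of_int (moebius d) * of_nat n powr (-s)) has_sum (riemann_zeta s * moebius_series s))
      (SIGMA n:{0<..}. {d. d dvd n})" .
  have "((\<lambda>n. if n = 1 then 1 else 0) has_sum (riemann_zeta s * moebius_series s)) {0::nat<..}"
  proof (rule has_sum_SigmaD[OF 1])
    fix n :: nat assume n: "n \<in> {0<..}"
    have "(\<Sum>d | d dvd n. of_int (moebius d) * of_nat n powr (-s)) = of_int (\<Sum>d | d dvd n. moebius d) * (of_nat n powr (-s) :: complex)"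
      by (simp add: sum_distrib_right)
    also have "\<dots> = (if n = 1 then 1 else 0)"
      using n by (subst sum_moebius_divisors) auto
    finally show "((\<lambda>d. case (n, d) of (n, d) \<Rightarrow> of_int (moebius d) * of_nat n powr (-s)) has_sum (if n = 1 then 1 else 0)) {d. d dvd n}"
      using n by (intro has_sum_finiteI) auto
  qed
  moreover have "((\<lambda>n. if n = 1 then 1 else 0 :: complex) has_sum 1) {0::nat<..}"
    by (rule has_sum_finite_neutralI[of "{1}"]) auto
  ultimately show ?thesis by (rule has_sum_unique)
qed

lemma riemann_zeta_nonzero: "Re s > 1 \<Longrightarrow> riemann_zeta s \<noteq> 0"
  using zeta_times_moebius_series[of s] by auto

section \<open>Square times squarefree: the series of \<open>liouville\<close> and
  \<open>c_coeff\<close>\<close>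

lemma square_part_mult_squarefree:
  fixes m k :: nat
  assumes m: "m > 0" and k: "squarefree k"
  shows "square_part (m\<^sup>2 * k) = m" "squarefree_part (m\<^sup>2 * k) = k"
proof -
  have "m dvd square_part (m\<^sup>2 * k)" by (subst dvd_square_part_iff) auto
  then obtain t where t: "square_part (m\<^sup>2 * k) = m * t" by auto
  have "(m * t)\<^sup>2 dvd m\<^sup>2 * k" using square_part_square_dvd[of "m\<^sup>2 * k"] by (simp add: t)
  then have "t\<^sup>2 dvd k" using m by (simp add: power_mult_distrib)
  then have "t = 1" using squarefreeD[OF k] by simp
  with t show *: "square_part (m\<^sup>2 * k) = m" by simp
  have "m\<^sup>2 * k = squarefree_part (m\<^sup>2 * k) * square_part (m\<^sup>2 * k) ^ 2" by (rule squarefree_decompose)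
  then show "squarefree_part (m\<^sup>2 * k) = k" using m by (simp add: *)
qed

lemma size_prime_factorization_squarefree:
  fixes k :: nat
  assumes "squarefree k"
  shows "size (prime_factorization k) = card (prime_factors k)"
proof -
  have "count (prime_factorization k) p = 1" if "p \<in> prime_factors k" for p
  proof -
    have "multiplicity p k \<le> 1" using assms that squarefree_factorial_semiring'[of k] by (cases "k = 0") auto
    moreover have "count (prime_factorization k) p > 0" using that by simp
    ultimately show ?thesis using that by (auto simp: count_prime_factorization)
  qed
  then show ?thesis by (simp add: size_multiset_overloaded_eq)
qed

text \<open>The square contributes an even number of prime factors, and for squarefree
  \<open>k\<close> counting with or without multiplicity is the same.\<close>

lemma liouville_square_mult:
  assumes m: "m > 0" and k: "squarefree k"
  shows "liouville (m\<^sup>2 * k) = moebius k"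
proof -
  have "k \<noteq> 0" using k by (cases "k = 0") auto
  then have "prime_factorization (m\<^sup>2 * k) = prime_factorization m + prime_factorization m + prime_factorization k"
    using m by (simp add: power2_eq_square prime_factorization_mult)
  then show ?thesis using k
    by (simp add: liouville_def moebius_def size_prime_factorization_squarefree power_add flip: power_mult_distrib)
qed

text \<open>Common source of both series: \<open>z = 2 * s\<close> gives \<open>liouville\<close>
  and \<open>z = 2 * s - 1\<close> gives \<open>c_coeff\<close>. The product of zeta at
  \<open>z\<close> with the Moebius series is a sum over pairs \<open>(m, k)\<close>; pairs whose
  \<open>k\<close> is not squarefree contribute 0, and the others correspond bijectively to the
  positive integers by \<open>m\<^sup>2 * k\<close>.\<close>

lemma square_squarefree_has_sum:
  fixes h :: "nat \<Rightarrow> complex"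
  assumes s: "Re s > 1" and z: "Re z > 1"
    and h: "\<And>m k. m > 0 \<Longrightarrow> squarefree k \<Longrightarrow> h (m\<^sup>2 * k) = of_nat m powr (-z) * (of_int (moebius k) * of_nat k powr (-s))"
  shows "(h has_sum (riemann_zeta z / riemann_zeta s)) {0<..}"
    and "(\<lambda>n. norm (h n)) summable_on {0<..}"
proof -
  have M: "moebius_series s = 1 / riemann_zeta s"
    using zeta_times_moebius_series[OF s] by (auto simp: divide_simps mult.commute)
  let ?f = "\<lambda>(m, k). of_nat m powr (-z) * (of_int (moebius k) * of_nat k powr (-s))"
  have sub: "({0<..} \<times> {0<..}) = ({0<..} \<times> {k::nat. squarefree k}) \<union> ({0::nat<..} \<times> {k. k > 0 \<and> \<not> squarefree k})"
    by (auto intro!: Nat.gr0I)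
  have 1: "(?f has_sum (riemann_zeta z * moebius_series s)) ({0<..} \<times> {0<..})"
      "(\<lambda>x. norm (?f x)) summable_on ({0<..} \<times> {0<..})"
    using has_sum_Times[OF riemann_zeta_has_sum[OF z] nat_powr_norm_summable[OF z] moebius_series_has_sum[OF s] moebius_series_norm_summable[OF s]]
    by (simp_all add: case_prod_unfold)
  have 2: "(?f has_sum (riemann_zeta z * moebius_series s)) ({0<..} \<times> {k. squarefree k})"
    by (rule has_sum_cong_neutral[THEN iffD1, OF _ _ _ 1(1)]) (auto simp: sub moebius_def)
  have 3: "(\<lambda>x. norm (?f x)) summable_on ({0<..} \<times> {k. squarefree k})"
    using 1(2) by (rule summable_on_subset) (auto simp: sub)
  have w: "(case (square_part n, squarefree_part n) of (m, k) \<Rightarrow> m\<^sup>2 * k) = n" for n :: nat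
    using squarefree_decompose[of n] by (simp add: mult.commute)
  have bij: "bij_betw (\<lambda>(m, k). m\<^sup>2 * k) ({0<..} \<times> {k. squarefree k}) {0::nat<..}"
    by (rule bij_betwI[of _ _ _ "\<lambda>n. (square_part n, squarefree_part n)"])
       (auto simp: square_part_mult_squarefree w[simplified] intro!: Nat.gr0I)
  have eq: "h (case x of (m, k) \<Rightarrow> m\<^sup>2 * k) = ?f x" if "x \<in> {0<..} \<times> {k. squarefree k}" for x
    using that h by auto
  show "(h has_sum (riemann_zeta z / riemann_zeta s)) {0<..}"
    using 2 unfolding has_sum_reindex_bij_betw[OF bij, symmetric] M
    by (subst has_sum_cong[OF eq]) auto
  show "(\<lambda>n. norm (h n)) summable_on {0<..}"
    unfolding summable_on_reindex_bij_betw[OF bij, symmetric]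
    by (subst summable_on_cong[OF arg_cong[where f = norm, OF eq]]) (use 3 in auto)
qed

lemma of_nat_square_powr: "of_nat (m\<^sup>2 * k) powr (-s) = of_nat m powr (- (2 * s)) * (of_nat k powr (-s) :: complex)"
proof -
  have "of_nat (m\<^sup>2 * k) powr (-s) = of_nat m powr (-s) * of_nat m powr (-s) * (of_nat k powr (-s) :: complex)"
    unfolding power2_eq_square of_nat_mult_powr ..
  then show ?thesis by (simp add: powr_add[symmetric])
qed

lemma liouville_series:
  assumes s: "Re s > 1"
  shows "((\<lambda>n. of_int (liouville n) * of_nat n powr (-s)) has_sum (riemann_zeta (2 * s) / riemann_zeta s)) {0<..}"
proof (rule square_squarefree_has_sum(1)[OF s])
  fix m k :: nat assume "m > 0" "squarefree k"
  then show "of_int (liouville (m\<^sup>2 * k)) * of_nat (m\<^sup>2 * k) powr (-s) =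
      of_nat m powr (- (2 * s)) * (of_int (moebius k) * (of_nat k powr (-s) :: complex))"
    unfolding of_nat_square_powr by (simp add: liouville_square_mult)
qed (use s in auto)

lemma c_coeff_series:
  assumes s: "Re s > 1"
  shows "((\<lambda>n. of_int (c_coeff n) * of_nat n powr (-s)) has_sum (riemann_zeta (2 * s - 1) / riemann_zeta s)) {0<..}"
    and "(\<lambda>n. norm (of_int (c_coeff n) * of_nat n powr (-s) :: complex)) summable_on {0<..}"
proof -
  have *: "of_int (c_coeff (m\<^sup>2 * k)) * of_nat (m\<^sup>2 * k) powr (-s) =
      of_nat m powr (- (2 * s - 1)) * (of_int (moebius k) * (of_nat k powr (-s) :: complex))"
    if "m > 0" "squarefree k" for m k
  proof -
    have "of_nat m powr (- (2 * s - 1)) = of_nat m * (of_nat m powr (- (2 * s)) :: complex)"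
    proof -
      have "- (2 * s - 1) = 1 + - (2 * s)" by simp
      then show ?thesis using that by (simp only: powr_add) simp
    qed
    moreover have "c_coeff (m\<^sup>2 * k) = int m * moebius k"
      unfolding c_coeff_def square_part_mult_squarefree[OF that] ..
    ultimately show ?thesis unfolding of_nat_square_powr by simp
  qed
  show "((\<lambda>n. of_int (c_coeff n) * of_nat n powr (-s)) has_sum (riemann_zeta (2 * s - 1) / riemann_zeta s)) {0<..}"
    and "(\<lambda>n. norm (of_int (c_coeff n) * of_nat n powr (-s) :: complex)) summable_on {0<..}"
    using square_squarefree_has_sum[OF s _ *] s by auto
qed

subsection \<open>Minimum modulus\<close>

text \<open>The local factorization at \<open>a\<close> extends to all of \<open>S\<close>, since
  the quotient by the power is holomorphic away from \<open>a\<close>; where \<open>g a\<close> is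
  nonzero the exponent is 0.\<close>

lemma holomorphic_divide_zero_order:
  assumes S: "open S" "connected S" and g: "g holomorphic_on S" "\<exists>z\<in>S. g z \<noteq> 0" and a: "a \<in> S"
  obtains h n where "h holomorphic_on S" "h a \<noteq> 0" "\<And>z. z \<in> S \<Longrightarrow> g z = (z - a) ^ n * h z"
proof (cases "g a = 0")
  case True
  have "\<not> g constant_on S" using g(2) True a by (force simp: constant_on_def)
  from holomorphic_factor_zero_nonconstant[OF g(1) S a True this]
  obtain h0 n r where n: "0 < n" and r: "0 < r" "ball a r \<subseteq> S" and h0: "h0 holomorphic_on ball a r"
    and eq: "\<And>w. w \<in> ball a r \<Longrightarrow> g w = (w - a) ^ n * h0 w" and nz: "\<And>w. w \<in> ball a r \<Longrightarrow> h0 w \<noteq> 0"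
    by metis
  define h where "h z = (if z = a then h0 a else g z / (z - a) ^ n)" for z
  have "(\<lambda>z. g z / (z - a) ^ n) holomorphic_on S - {a}"
    by (intro holomorphic_intros holomorphic_on_subset[OF g(1)]) auto
  then have 1: "h holomorphic_on S - {a}"
    by (rule holomorphic_transform) (simp add: h_def)
  have 2: "h holomorphic_on ball a r"
    by (rule holomorphic_transform[OF h0]) (simp add: h_def eq)
  have "h holomorphic_on (S - {a}) \<union> ball a r"
    by (intro holomorphic_on_Un 1 2 open_ball open_Diff S) auto
  moreover have "(S - {a}) \<union> ball a r = S" using r a by auto
  ultimately have "h holomorphic_on S" by simp
  moreover have "h a \<noteq> 0" using nz[of a] r by (simp add: h_def)
  moreover have "g z = (z - a) ^ n * h z" if "z \<in> S" for z
    using True n by (auto simp: h_def)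
  ultimately show ?thesis by (rule that)
next
  case False
  show ?thesis by (rule that[of g 0]) (use g False in auto)
qed

text \<open>The points are treated one at a time. A list rather than a set of zeros records
  multiplicities as repetitions.\<close>

lemma holomorphic_factor_finite:
  fixes f :: "complex \<Rightarrow> complex"
  assumes S: "open S" "connected S" and f: "f holomorphic_on S" "\<exists>z\<in>S. f z \<noteq> 0"
    and Z: "finite Z" "Z \<subseteq> S"
  shows "\<exists>as g. set as \<subseteq> Z \<and> g holomorphic_on S \<and> (\<forall>z\<in>Z. g z \<noteq> 0) \<and>
           (\<forall>z\<in>S. f z = g z * (\<Prod>a\<leftarrow>as. z - a))"
  using Z
proof (induction Z)
  case empty
  show ?case using f by (intro exI[of _ "[]"] exI[of _ f]) auto
next
  case (insert b Z)
  then obtain as g where g: "set as \<subseteq> Z" "g holomorphic_on S" "\<forall>z\<in>Z. g z \<noteq> 0"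
      "\<forall>z\<in>S. f z = g z * (\<Prod>a\<leftarrow>as. z - a)"
    by auto
  have "\<exists>z\<in>S. g z \<noteq> 0" using f(2) g(4) by force
  moreover have "b \<in> S" using insert by auto
  ultimately obtain h n where h: "h holomorphic_on S" "h b \<noteq> 0" "\<And>z. z \<in> S \<Longrightarrow> g z = (z - b) ^ n * h z"
    using holomorphic_divide_zero_order[OF S g(2)] by metis
  have "(\<Prod>a\<leftarrow>replicate n b @ as. z - a) = (z - b) ^ n * (\<Prod>a\<leftarrow>as. z - a)" for z
    by (simp add: prod_list_replicate)
  then have "\<forall>z\<in>S. f z = h z * (\<Prod>a\<leftarrow>replicate n b @ as. z - a)"
    using g(4) h(3) by simp
  moreover have "\<forall>z\<in>insert b Z. h z \<noteq> 0"
    using h g(3) insert.prems by force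
  moreover have "set (replicate n b @ as) \<subseteq> insert b Z" using g(1) by auto
  ultimately show ?case using h(1) by blast
qed

lemma holomorphic_factor_zeros:
  fixes f :: "complex \<Rightarrow> complex"
  assumes S: "open S" "connected S" and f: "f holomorphic_on S" "\<exists>z\<in>S. f z \<noteq> 0"
    and K: "compact K" "K \<subseteq> S"
  obtains as g where "set as \<subseteq> K" "g holomorphic_on S" "\<And>z. z \<in> K \<Longrightarrow> g z \<noteq> 0"
    "\<And>z. z \<in> S \<Longrightarrow> f z = g z * (\<Prod>a\<leftarrow>as. z - a)"
proof -
  define Z where "Z = {z\<in>K. f z = 0}"
  have "\<not> f constant_on S \<or> Z = {}"
    using f(2) K by (force simp: constant_on_def Z_def)
  then have "finite Z"
    using holomorphic_compact_finite_zeros[OF f(1) S K] unfolding Z_def by (metis finite.emptyI)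
  then obtain as g where g: "set as \<subseteq> Z" "g holomorphic_on S" "\<forall>z\<in>Z. g z \<noteq> 0"
      "\<forall>z\<in>S. f z = g z * (\<Prod>a\<leftarrow>as. z - a)"
  proof -
    have "Z \<subseteq> S" using K by (auto simp: Z_def)
    from holomorphic_factor_finite[OF S f \<open>finite Z\<close> this] that show thesis by blast
  qed
  show ?thesis
  proof (rule that)
    show "set as \<subseteq> K" using g(1) by (auto simp: Z_def)
    show "g z \<noteq> 0" if "z \<in> K" for z
      using g(3,4) that K by (cases "z \<in> Z") (auto simp: Z_def)
  qed (use g in auto)
qed

text \<open>The map v / (2 * A - v) sends the half-plane \<open>Re v < A\<close> into the unit disc
  and fixes 0. Schwarz's lemma then bounds \<open>norm (u z)\<close> by \<open>r1 / r\<close> times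
  \<open>2 * A + norm (u z)\<close>, and solving this for \<open>norm (u z)\<close> gives the
  claim.\<close>

lemma Borel_Caratheodory_centred:
  assumes u: "u holomorphic_on ball 0 r" "u 0 = 0" and re: "\<And>z. norm z < r \<Longrightarrow> Re (u z) < A"
    and A: "A > 0" and z: "norm z \<le> r1" "r1 < r" "0 \<le> r1"
  shows "norm (u z) \<le> 2 * r1 / (r - r1) * A"
proof -
  have r: "r > 0" using z by linarith
  define p where "p w = u (of_real r * w) / (2 * of_real A - u (of_real r * w))" for w
  have rw: "norm (of_real r * w) < r" if "norm w < 1" for w :: complex
    using that r by (simp add: norm_mult)
  have nz: "2 * of_real A - u (r * w) \<noteq> 0" if "norm w < 1" for w :: complex
  proof
    assume "2 * of_real A - u (r * w) = 0"
    then have "Re (u (r * w)) = 2 * A" by (simp add: complex_eq_iff)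
    then show False using re[OF rw[OF that]] A by simp
  qed
  have hu: "(\<lambda>w. u (of_real r * w)) holomorphic_on ball 0 1"
    by (rule holomorphic_on_compose_gen[of "\<lambda>w. of_real r * w", unfolded o_def, OF _ u(1)])
       (use rw in \<open>auto intro!: holomorphic_intros\<close>)
  have hp: "p holomorphic_on ball 0 1"
    unfolding p_def using nz by (intro holomorphic_intros hu) auto
  have p1: "norm (p w) < 1" if "norm w < 1" for w :: complex
  proof -
    define v where "v = u (r * w)"
    have v: "Re v < A" using re[OF rw[OF that]] by (simp add: v_def)
    have "(norm (2 * of_real A - v))\<^sup>2 - (norm v)\<^sup>2 = 4 * A * (A - Re v)"
      unfolding cmod_power2 by (simp add: power2_eq_square algebra_simps)
    moreover have "4 * A * (A - Re v) > 0" using v A by simp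
    ultimately have "(norm v)\<^sup>2 < (norm (2 * of_real A - v))\<^sup>2" by linarith
    then have "norm v < norm (2 * of_real A - v)"
      by (rule power2_less_imp_less) simp
    then show ?thesis by (simp add: p_def v_def[symmetric] norm_divide divide_simps)
  qed
  define w where "w = z / of_real r"
  have w: "norm w < 1" "of_real r * w = z" using z r by (auto simp: w_def norm_divide)
  have "norm (p w) \<le> norm w"
    by (rule Schwarz_Lemma(1)[OF hp _ p1 w(1)]) (use u(2) in \<open>auto simp: p_def\<close>)
  then have "norm (u z) \<le> norm w * norm (2 * of_real A - u z)"
  proof -
    have "norm (u z) = norm (p w) * norm (2 * of_real A - u z)"
      using nz[OF w(1)] unfolding p_def w(2) by (simp add: norm_divide)
    then show ?thesis using mult_right_mono[OF \<open>norm (p w) \<le> norm w\<close> norm_ge_zero] by simp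
  qed
  also have "\<dots> \<le> (r1 / r) * (2 * A + norm (u z))"
  proof (intro mult_mono)
    show "norm w \<le> r1 / r" using z r by (simp add: w_def norm_divide divide_right_mono)
    show "norm (2 * of_real A - u z) \<le> 2 * A + norm (u z)"
      using norm_triangle_ineq4[of "2 * of_real A" "u z"] A by (simp add: norm_mult)
  qed (use z r in auto)
  finally have "norm (u z) * r \<le> r1 * (2 * A + norm (u z))"
    using r by (simp add: field_simps)
  then have "norm (u z) * (r - r1) \<le> 2 * r1 * A" by (simp add: algebra_simps)
  then show ?thesis using z by (simp add: field_simps)
qed

lemma prod_list_map_mono_nonneg:
  fixes f g :: "'a \<Rightarrow> real"
  assumes "\<And>a. a \<in> set as \<Longrightarrow> 0 \<le> f a" "\<And>a. a \<in> set as \<Longrightarrow> f a \<le> g a"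
  shows "0 \<le> (\<Prod>a\<leftarrow>as. f a) \<and> (\<Prod>a\<leftarrow>as. f a) \<le> (\<Prod>a\<leftarrow>as. g a)"
  using assms
proof (induction as)
  case (Cons b as)
  have "0 \<le> f b" "f b \<le> g b" using Cons.prems by auto
  moreover have "0 \<le> g b" using calculation by linarith
  ultimately show ?case using Cons by (auto intro!: mult_mono)
qed auto

lemma norm_prod_list: "norm (\<Prod>a\<leftarrow>as. f a) = (\<Prod>a\<leftarrow>as. norm (f a :: complex))"
  by (induction as) (auto simp: norm_mult)

lemma prod_list_map_mult: "(\<Prod>a\<leftarrow>as. f a * g a) = (\<Prod>a\<leftarrow>as. f a) * (\<Prod>a\<leftarrow>as. g a :: 'a :: comm_monoid_mult)"
  by (induction as) (auto simp: mult_ac)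

lemma norm_Blaschke_boundary:
  assumes "norm z = R"
  shows "norm (of_real (R\<^sup>2) - cnj a * z) = R * norm (z - a)"
proof -
  have "of_real (R\<^sup>2) = z * cnj z" using assms by (simp add: complex_norm_square[symmetric])
  then have "of_real (R\<^sup>2) - cnj a * z = z * cnj (z - a)" by (simp add: algebra_simps)
  then show ?thesis using assms by (simp only: norm_mult complex_mod_cnj)
qed

text \<open>
  Dividing out the zeros by Blaschke factors leaves a zero-free function whose logarithm is
  controlled by the Borel--Caratheodory inequality.
\<close>
lemma minimum_modulus:
  fixes f :: "complex \<Rightarrow> complex"
  assumes r: "0 \<le> r1" "r1 < r" "r < R" "R < R'" and f: "f holomorphic_on ball 0 R'"
    and M: "\<And>z. norm z \<le> R \<Longrightarrow> norm (f z) \<le> M" and f0: "f 0 \<noteq> 0"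
  obtains as where "set as \<subseteq> cball 0 r" "(R / r) ^ length as \<le> M / norm (f 0)"
    "\<And>z. norm z \<le> r1 \<Longrightarrow> norm (f 0) * exp (- (2 * r1 / (r - r1)) * ln (2 * M / norm (f 0))) *
        (\<Prod>a\<leftarrow>as. norm (z - a) / (2 * R)) \<le> norm (f z)"
proof -
  have rp: "r > 0" "R > 0" using r by auto
  have "\<exists>z\<in>ball 0 R'. f z \<noteq> 0" using f0 r by (intro bexI[of _ 0]) auto
  from holomorphic_factor_zeros[OF open_ball connected_ball f this compact_cball[of 0 r]]
  obtain as g where as: "set as \<subseteq> cball 0 r" and g: "g holomorphic_on ball 0 R'"
    and gnz: "\<And>z. z \<in> cball 0 r \<Longrightarrow> g z \<noteq> 0"
    and fg: "\<And>z. z \<in> ball 0 R' \<Longrightarrow> f z = g z * (\<Prod>a\<leftarrow>as. z - a)"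
    using r by (auto simp: subset_iff)
  have M0: "norm (f 0) \<le> M" using M[of 0] rp by simp
  have nf0: "norm (f 0) > 0" using f0 by simp
  have Mp: "M > 0" using M0 nf0 by linarith
  \<comment> \<open>Scaled so that \<open>b a z\<close> has the modulus of \<open>z - a\<close> on
    the circle of radius \<open>R\<close>; it has no zero inside because \<open>norm a\<close> is at
    most \<open>r < R\<close>. Replacing each \<open>z - a\<close> by \<open>b a z\<close> keeps the
    bound \<open>M\<close> on the circle, hence on the disc by the maximum principle.\<close>
  define b where "b a z = (of_real (R\<^sup>2) - cnj a * z) / of_real R" for a z
  define G where "G z = g z * (\<Prod>a\<leftarrow>as. b a z)" for z
  have b_bound: "norm (cnj a * z) \<le> R * r" if "a \<in> set as" "norm z \<le> R" for a z
  proof -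
    have "norm a \<le> r" using as that by auto
    then have "norm z * norm a \<le> R * r" using that rp by (intro mult_mono) auto
    then show ?thesis by (simp add: norm_mult mult.commute)
  qed
  have bnz: "b a z \<noteq> 0" if "a \<in> set as" "norm z \<le> R" for a z
  proof
    assume "b a z = 0"
    then have "of_real (R\<^sup>2) = cnj a * z" using rp by (simp add: b_def)
    then have "norm (cnj a * z) = R\<^sup>2" by (metis norm_of_real abs_power2)
    with b_bound[OF that] show False using r rp by (simp add: power2_eq_square)
  qed
  have bhol: "(\<lambda>z. \<Prod>a\<leftarrow>bs. b a z) holomorphic_on A" for bs A
    unfolding b_def by (induction bs) (auto intro!: holomorphic_intros)
  have Ghol: "G holomorphic_on ball 0 R'"
    unfolding G_def by (intro holomorphic_intros g bhol)
  have Gf: "norm (G z) \<le> M" if "norm z = R" for z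
  proof -
    have "norm (b a z) = norm (z - a)" for a
      using norm_Blaschke_boundary[OF that, of a] rp by (simp add: b_def norm_divide)
    then have "norm (G z) = norm (f z)"
      using fg[of z] r that by (simp add: G_def norm_mult norm_prod_list)
    then show ?thesis using M[of z] that by simp
  qed
  have GM: "norm (G z) \<le> M" if "norm z \<le> R" for z
  proof (rule maximum_modulus_frontier[of G "cball 0 R" M z])
    show "G holomorphic_on interior (cball 0 R)"
      by (rule holomorphic_on_subset[OF Ghol]) (use r in auto)
    show "continuous_on (closure (cball 0 R)) G"
      by (rule holomorphic_on_imp_continuous_on, rule holomorphic_on_subset[OF Ghol]) (use r in auto)
  qed (use that Gf in auto)
  have Gnz: "G z \<noteq> 0" if "norm z \<le> r" for z
    using gnz[of z] bnz[of _ z] that r by (auto simp: G_def prod_list_zero_iff)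
  \<comment> \<open>At the origin a factor of modulus at most \<open>r\<close> is exchanged for
    \<open>R\<close>, a gain of at least \<open>R / r\<close> per zero. Combined with the bound
    \<open>M\<close> for \<open>G\<close> this counts the zeros.\<close>
  have G0: "norm (f 0) * (R / r) ^ length as \<le> norm (G 0)"
  proof -
    have "f 0 = g 0 * (\<Prod>a\<leftarrow>as. - a)" using fg[of 0] r by simp
    then have "norm (f 0) = norm (g 0) * (\<Prod>a\<leftarrow>as. norm a)" by (simp add: norm_mult norm_prod_list)
    also have "(\<Prod>a\<leftarrow>as. norm a) \<le> (\<Prod>a\<leftarrow>as. r)"
      using as by (intro prod_list_map_mono_nonneg[THEN conjunct2]) auto
    also have "\<dots> = r ^ length as" by (induction as) auto
    finally have 1: "norm (f 0) \<le> norm (g 0) * r ^ length as" by (simp add: mult_left_mono)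
    have "(\<Prod>a\<leftarrow>as. b a 0) = of_real R ^ length as"
      using rp by (induction as) (auto simp: b_def power2_eq_square)
    then have "norm (G 0) = norm (g 0) * R ^ length as"
      using rp by (simp add: G_def norm_mult norm_power)
    moreover have "norm (f 0) * (R / r) ^ length as \<le> (norm (g 0) * r ^ length as) * (R / r) ^ length as"
      using 1 rp by (intro mult_right_mono) auto
    ultimately show ?thesis using rp by (simp add: power_divide)
  qed
  have G0': "norm (f 0) \<le> norm (G 0)"
  proof -
    have "1 \<le> (R / r) ^ length as" using r rp by (intro one_le_power) auto
    then have "norm (f 0) * 1 \<le> norm (f 0) * (R / r) ^ length as" by (intro mult_left_mono) auto
    then show ?thesis using G0 by linarith
  qed
  have "simply_connected (ball (0::complex) r)" by (simp add: convex_imp_simply_connected)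
  moreover have "G holomorphic_on ball 0 r" by (rule holomorphic_on_subset[OF Ghol]) (use r in auto)
  ultimately obtain h where h: "h holomorphic_on ball 0 r" "\<And>z. z \<in> ball 0 r \<Longrightarrow> G z = exp (h z)"
    using simply_connected_imp_holomorphic_log[of G "ball 0 r"] Gnz convex_imp_locally_path_connected[of "ball 0 r"]
    by (metis convex_ball dist_0_norm less_imp_le mem_ball)
  define u where "u z = h z - h 0" for z
  have normG: "norm (G z) = norm (G 0) * exp (Re (u z))" if "norm z < r" for z
  proof -
    have "G z = G 0 * exp (u z)" using h(2)[of z] h(2)[of 0] that rp by (simp add: u_def exp_diff)
    then show ?thesis by (simp add: norm_mult)
  qed
  \<comment> \<open>The factor 2 makes \<open>A\<close> positive and the bound for
    \<open>Re (u z)\<close> strict, even when \<open>norm (f 0)\<close> equals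
    \<open>M\<close>.\<close>
  define A where "A = ln (2 * M / norm (f 0))"
  have "norm (f 0) < 2 * M" using M0 Mp by linarith
  then have "1 < 2 * M / norm (f 0)" using nf0 by (simp add: less_divide_eq)
  then have A: "A > 0" unfolding A_def by (rule ln_gt_zero)
  have re: "Re (u z) < A" if "norm z < r" for z
  proof -
    have "norm (f 0) * exp (Re (u z)) \<le> norm (G 0) * exp (Re (u z))"
      using G0' by (intro mult_right_mono) auto
    also have "\<dots> \<le> M" using GM[of z] normG[OF that] that r by simp
    also have "\<dots> < 2 * M" using Mp by simp
    finally have "exp (Re (u z)) < 2 * M / norm (f 0)" using nf0 by (simp add: field_simps)
    then show ?thesis unfolding A_def by (metis exp_gt_zero ln_exp ln_less_cancel_iff order.strict_trans)
  qed
  have u: "u holomorphic_on ball 0 r" "u 0 = 0"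
    unfolding u_def using h(1) by (auto intro!: holomorphic_intros)
  show ?thesis
  proof (rule that[OF as])
    show "(R / r) ^ length as \<le> M / norm (f 0)"
    proof -
      have "norm (f 0) * (R / r) ^ length as \<le> M"
        by (rule order.trans[OF G0 GM]) (use rp in simp)
      then show ?thesis using nf0 by (simp only: pos_le_divide_eq mult.commute)
    qed
  next
    fix z :: complex assume z: "norm z \<le> r1"
    have zR: "norm z < r" "norm z \<le> R" "z \<in> ball 0 R'" using z r by auto
    have "norm (u z) \<le> 2 * r1 / (r - r1) * A"
      by (rule Borel_Caratheodory_centred[OF u re A z]) (use r in auto)
    then have "- (2 * r1 / (r - r1)) * A \<le> Re (u z)"
      using abs_Re_le_cmod[of "u z"] by simp
    then have "norm (f 0) * exp (- (2 * r1 / (r - r1)) * A) \<le> norm (G 0) * exp (Re (u z))"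
      using G0' by (intro mult_mono) auto
    then have 1: "norm (f 0) * exp (- (2 * r1 / (r - r1)) * A) \<le> norm (G z)"
      using normG[OF zR(1)] by simp
    have "(\<Prod>a\<leftarrow>as. norm (z - a) / (2 * R)) \<le> (\<Prod>a\<leftarrow>as. norm ((z - a) / b a z))"
    proof (rule prod_list_map_mono_nonneg[THEN conjunct2])
      fix a assume a: "a \<in> set as"
      have "norm (of_real (R\<^sup>2) - cnj a * z) \<le> R\<^sup>2 + norm (cnj a * z)"
        using norm_triangle_ineq4[of "of_real (R\<^sup>2)" "cnj a * z"] by (simp add: norm_power)
      also have "\<dots> \<le> R\<^sup>2 + R * r" using b_bound[OF a zR(2)] by simp
      also have "R * r \<le> R * R" using r rp by (intro mult_left_mono) auto
      finally have "norm (of_real (R\<^sup>2) - cnj a * z) \<le> 2 * R * R" by (simp add: power2_eq_square)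
      then have "norm (b a z) \<le> 2 * R" using rp by (simp add: b_def norm_divide pos_divide_le_eq)
      then show "norm (z - a) / (2 * R) \<le> norm ((z - a) / b a z)"
        using bnz[OF a zR(2)] unfolding norm_divide by (intro divide_left_mono) (use rp in auto)
    qed (use rp in auto)
    then have "norm (f 0) * exp (- (2 * r1 / (r - r1)) * A) * (\<Prod>a\<leftarrow>as. norm (z - a) / (2 * R)) \<le>
        norm (G z) * (\<Prod>a\<leftarrow>as. norm ((z - a) / b a z))"
      using 1 rp by (intro mult_mono prod_list_map_mono_nonneg[THEN conjunct1]) auto
    also have "\<dots> = norm (g z * (\<Prod>a\<leftarrow>as. b a z * ((z - a) / b a z)))"
      by (simp only: G_def norm_mult norm_prod_list prod_list_map_mult mult.assoc)
    also have "(\<Prod>a\<leftarrow>as. b a z * ((z - a) / b a z)) = (\<Prod>a\<leftarrow>as. z - a)"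
      using bnz[OF _ zR(2)] by (intro arg_cong[where f = prod_list] map_cong) auto
    also have "g z * \<dots> = f z" using fg[OF zR(3)] by simp
    finally show "norm (f 0) * exp (- (2 * r1 / (r - r1)) * ln (2 * M / norm (f 0))) *
        (\<Prod>a\<leftarrow>as. norm (z - a) / (2 * R)) \<le> norm (f z)" unfolding A_def .
  qed
qed

text \<open>Pigeonhole principle: the n + 1 points \<open>T + k / (n + 1)\<close> are at least 1 /
  (n + 1) apart, so a listed value can lie within less than half that distance of at most one of
  them, and n values cannot spoil them all.\<close>

lemma exists_height_avoiding:
  fixes bs :: "real list"
  obtains t where "T \<le> t" "t \<le> T + 1" "\<And>b. b \<in> set bs \<Longrightarrow> 1 / (2 * (real (length bs) + 1)) \<le> \<bar>t - b\<bar>"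
proof -
  define n where "n = length bs"
  define p where "p k = T + real k / (real n + 1)" for k
  have "\<exists>k\<le>n. \<forall>b\<in>set bs. 1 / (2 * (real n + 1)) \<le> \<bar>p k - b\<bar>"
  proof (rule ccontr)
    assume "\<not> ?thesis"
    then have "\<exists>b. b \<in> set bs \<and> \<bar>p k - b\<bar> < 1 / (2 * (real n + 1))" if "k \<in> {..n}" for k
      using that by (metis atMost_iff not_le)
    then obtain c where c: "\<And>k. k \<in> {..n} \<Longrightarrow> c k \<in> set bs \<and> \<bar>p k - c k\<bar> < 1 / (2 * (real n + 1))"
      by metis
    have "inj_on c {..n}"
    proof (rule inj_onI)
      fix j k assume jk: "j \<in> {..n}" "k \<in> {..n}" "c j = c k"
      then have "\<bar>p j - p k\<bar> < 1 / (2 * (real n + 1)) + 1 / (2 * (real n + 1))"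
        using c[of j] c[of k] by linarith
      also have "\<dots> = 1 / (real n + 1)" by (simp add: field_simps)
      also have "p j - p k = (real j - real k) / (real n + 1)" by (simp add: p_def diff_divide_distrib)
      finally have "\<bar>real j - real k\<bar> < 1" by (simp add: abs_divide divide_simps)
      then show "j = k" by linarith
    qed
    then have "card {..n} \<le> card (set bs)"
      using c by (intro card_inj_on_le[of c]) auto
    also have "\<dots> \<le> n" by (simp add: n_def card_length)
    finally show False by simp
  qed
  then obtain k where k: "k \<le> n" "\<forall>b\<in>set bs. 1 / (2 * (real n + 1)) \<le> \<bar>p k - b\<bar>" by blast
  have "T \<le> p k" "p k \<le> T + 1" using k(1) by (auto simp: p_def field_simps)
  with k(2) that show ?thesis by (simp add: n_def)
qed

subsection \<open>Mellin inversion\<close>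

text \<open>
  Levy's inversion formula for the interval from \<open>x\<close> to \<open>x + h\<close>, divided by \<open>h\<close>, in the limit \<open>h \<rightarrow> 0\<close>.
\<close>
lemma fourier_inversion_density:
  fixes p :: "real \<Rightarrow> real"
  assumes p0: "\<And>u. 0 \<le> p u" and cont: "continuous_on UNIV p" and int: "integrable lborel p"
    and pos: "0 < (LINT u|lborel. p u)"
    and phi: "\<And>t. (LINT u|lborel. of_real (p u) * iexp (t * u)) = \<phi> t" and phi_int: "integrable lborel \<phi>"
  shows "(LINT t|lborel. iexp (- (t * x)) * \<phi> t) = of_real (2 * pi * p x)"
proof -
  define I where "I = (LINT u|lborel. p u)"
  have I: "I > 0" using pos by (simp add: I_def)
  define q where "q u = p u / I" for u
  have q0: "0 \<le> q u" for u using p0 I by (simp add: q_def)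
  have qmeas [measurable]: "q \<in> borel_measurable borel"
    unfolding q_def using cont by (intro borel_measurable_divide borel_measurable_continuous_onI) auto
  have qint: "integrable lborel q" unfolding q_def using int by simp
  have qI: "(LINT u|lborel. q u) = 1" unfolding q_def using I by (simp add: I_def[symmetric])
  define M where "M = density lborel (\<lambda>u. ennreal (q u))"
  have "emeasure M (space M) = (\<integral>\<^sup>+u. ennreal (q u) \<partial>lborel)"
    by (simp add: M_def emeasure_density)
  also have "\<dots> = 1" using q0 qint qI by (subst nn_integral_eq_integral) auto
  finally have "prob_space M" by (intro prob_spaceI)
  then interpret M: real_distribution M
    by (intro real_distribution.intro real_distribution_axioms.intro) (auto simp: M_def)
  have ms: "measure M A = (LINT u:A|lborel. q u)" if "A \<in> sets borel" for A
  proof -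
    have "emeasure M A = (\<integral>\<^sup>+u. ennreal (q u) * indicator A u \<partial>lborel)"
      using that by (simp add: M_def emeasure_density)
    also have "\<dots> = (\<integral>\<^sup>+u. ennreal (indicator A u * q u) \<partial>lborel)"
      by (intro nn_integral_cong) (auto simp: indicator_def)
    also have "\<dots> = ennreal (LINT u:A|lborel. q u)"
      unfolding set_lebesgue_integral_def using that q0 qint
      by (subst nn_integral_eq_integral) (auto intro!: integrable_mult_indicator[of A lborel q, simplified])
    finally show ?thesis
      using q0 by (simp add: measure_def set_lebesgue_integral_def integral_nonneg_AE)
  qed
  have char: "char M t = \<phi> t / I" for t
  proof -
    have "char M t = (LINT u|lborel. q u *\<^sub>R iexp (t * u))"
      unfolding char_def M_def using q0 by (subst integral_density) auto
    also have "\<dots> = (LINT u|lborel. of_real (p u) * iexp (t * u) / I)"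
      by (intro Bochner_Integration.integral_cong) (auto simp: q_def scaleR_conv_of_real)
    also have "\<dots> = \<phi> t / I" using phi[of t] by simp
    finally show ?thesis .
  qed
  have psi_int: "integrable lborel (char M)"
    unfolding char using phi_int by simp
  \<comment> \<open>Levy's formula requires that the endpoints of the interval are not
    atoms.\<close>
  have pt: "measure M {a} = 0" for a
  proof -
    have "AE u in lborel. indicator {a} u *\<^sub>R q u = 0"
      using AE_lborel_singleton[of a] by eventually_elim (auto simp: indicator_def)
    then show ?thesis by (subst ms) (auto simp: set_lebesgue_integral_def intro: integral_eq_zero_AE)
  qed
  \<comment> \<open>At \<open>t = 0\<close> this is 0 by the convention for division, which respects
    the bound \<open>b - a\<close>; one point does not affect the integrals.\<close>
  define k where "k a b t = (iexp (- (t * a)) - iexp (- (t * b))) / (\<i> * t)" for a b t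
  have k_bound: "norm (k a b t) \<le> b - a" if "a \<le> b" for a b t
  proof (cases "t = 0")
    case False
    have "k a b t = (iexp ((-t) * b) - iexp ((-t) * a)) / (\<i> * (-t))"
      using False by (simp add: k_def field_simps)
    then show ?thesis using Levy_Inversion_aux2[of a b "-t"] that False by simp
  qed (use that in \<open>simp add: k_def\<close>)
  have k_meas [measurable]: "k a b \<in> borel_measurable borel" for a b
    unfolding k_def[abs_def] by measurable
  have levy: "(LINT t|lborel. k a b t * char M t) = of_real (2 * pi * measure M {a<..b})" if ab: "a \<le> b" for a b
  proof -
    \<comment> \<open>Levy's formula is a limit of truncated integrals. Since the characteristic
      function is integrable here, the limit is the integral over the whole line.\<close>
    have "(\<lambda>T::nat. LINT t|lborel. indicator {-real T<..<real T} t *\<^sub>R (k a b t * char M t)) \<longlonglongrightarrow> (LINT t|lborel. k a b t * char M t)"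
    proof (rule integral_dominated_convergence[where w = "\<lambda>t. (b - a) * norm (char M t)"])
      show "AE t in lborel. (\<lambda>T::nat. indicator {-real T<..<real T} t *\<^sub>R (k a b t * char M t)) \<longlonglongrightarrow> k a b t * char M t"
      proof (intro AE_I2 tendsto_eventually)
        fix t :: real
        obtain N :: nat where N: "\<bar>t\<bar> < real N" using reals_Archimedean2 by blast
        show "\<forall>\<^sub>F T::nat in sequentially. indicator {-real T<..<real T} t *\<^sub>R (k a b t * char M t) = k a b t * char M t"
          using eventually_ge_at_top[of N] by eventually_elim (use N in \<open>auto simp: indicator_def\<close>)
      qed
      show "AE t in lborel. norm (indicator {-real T<..<real T} t *\<^sub>R (k a b t * char M t)) \<le> (b - a) * norm (char M t)" for T :: nat
        using k_bound[OF ab] ab by (intro AE_I2) (auto simp: indicator_def norm_mult intro!: mult_right_mono)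
    qed (use psi_int in \<open>auto\<close>)
    then have "(\<lambda>T::nat. 1 / (2 * pi) * (LINT t|lborel. indicator {-real T<..<real T} t *\<^sub>R (k a b t * char M t)))
        \<longlonglongrightarrow> 1 / (2 * pi) * (LINT t|lborel. k a b t * char M t)"
      by (intro tendsto_intros)
    moreover have "(CLBINT t=-real T..real T. k a b t * char M t) =
        (LINT t|lborel. indicator {-real T<..<real T} t *\<^sub>R (k a b t * char M t))" for T :: nat
      by (simp add: interval_lebesgue_integral_def set_lebesgue_integral_def einterval_eq)
    ultimately have "(\<lambda>T::nat. 1 / (2 * pi) * (CLBINT t=-real T..real T. k a b t * char M t))
        \<longlonglongrightarrow> 1 / (2 * pi) * (LINT t|lborel. k a b t * char M t)"
      by simp
    moreover have "(\<lambda>T::nat. 1 / (2 * pi) * (CLBINT t=-real T..real T. k a b t * char M t)) \<longlonglongrightarrow> of_real (measure M {a<..b})"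
      unfolding k_def using M.Levy_Inversion[OF ab pt pt] by simp
    ultimately have "1 / (2 * pi) * (LINT t|lborel. k a b t * char M t) = of_real (measure M {a<..b})"
      by (rule LIMSEQ_unique)
    then show ?thesis by (simp add: field_simps)
  qed
  define h where "h n = 1 / real (Suc n)" for n
  have h: "h n > 0" "h n \<le> 1" for n by (auto simp: h_def)
  have h0: "h \<longlonglongrightarrow> 0" unfolding h_def by real_asymp
  have lim1: "(\<lambda>n. measure M {x<..x + h n} / h n) \<longlonglongrightarrow> q x"
  proof -
    have cq: "continuous_on {x..x+1} q"
      unfolding q_def by (intro continuous_intros continuous_on_subset[OF cont]) (use I in auto)
    have eq: "measure M {x<..x + h n} = integral {x..x + h n} q" for n
    proof -
      have "set_integrable lborel {x<..x + h n} q"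
        using qint unfolding set_integrable_def by (intro integrable_mult_indicator) auto
      then have "measure M {x<..x + h n} = integral {x<..x + h n} q"
        by (subst ms) (auto simp: set_borel_integral_eq_integral)
      also have "\<dots> = integral {x..x + h n} q"
        by (rule integral_subset_negligible[symmetric, THEN sym])
           (auto intro: negligible_subset[of "{x}"])
      finally show ?thesis .
    qed
    have "((\<lambda>y. integral {x..y} q) has_real_derivative q x) (at x within {x..x+1})"
      by (rule integral_has_real_derivative[OF cq]) auto
    then have "((\<lambda>y. (integral {x..y} q - integral {x..x} q) / (y - x)) \<longlongrightarrow> q x) (at x within {x..x+1})"
      by (simp add: has_field_derivative_iff)
    moreover have "filterlim (\<lambda>n. x + h n) (at x within {x..x+1}) sequentially"
      unfolding filterlim_at
    proof
      show "\<forall>\<^sub>F n in sequentially. x + h n \<in> {x..x + 1} \<and> x + h n \<noteq> x"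
      proof (intro always_eventually allI)
        fix n show "x + h n \<in> {x..x + 1} \<and> x + h n \<noteq> x" using h[of n] by auto
      qed
      show "(\<lambda>n. x + h n) \<longlonglongrightarrow> x" using tendsto_add[OF tendsto_const h0, of x] by simp
    qed
    ultimately have "(\<lambda>n. (integral {x..x + h n} q - integral {x..x} q) / ((x + h n) - x)) \<longlonglongrightarrow> q x"
      by (rule filterlim_compose)
    then show ?thesis by (simp add: eq)
  qed
  have lim2: "(\<lambda>n. LINT t|lborel. k x (x + h n) t / h n * char M t) \<longlonglongrightarrow> (LINT t|lborel. iexp (- (t * x)) * char M t)"
  proof (rule integral_dominated_convergence[where w = "\<lambda>t. norm (char M t)"])
    show "AE t in lborel. norm (k x (x + h n) t / h n * char M t) \<le> norm (char M t)" for n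
    proof (intro AE_I2)
      fix t :: real
      have "norm (k x (x + h n) t / h n) \<le> 1"
        using k_bound[of x "x + h n" t] h[of n] by (simp add: norm_divide divide_simps)
      then show "norm (k x (x + h n) t / h n * char M t) \<le> norm (char M t)"
        unfolding norm_mult by (intro mult_left_le_one_le) auto
    qed
    have ptw: "(\<lambda>n. k x (x + h n) t / h n) \<longlonglongrightarrow> iexp (- (t * x))" if t: "t \<noteq> 0" for t
    proof -
      \<comment> \<open>A primitive of the exponential: its difference quotients are exactly
        \<open>k x (x + h n) t / h n\<close>, so their limit is a derivative.\<close>
      define F where "F z = - exp (- \<i> * t * z) / (\<i> * t)" for z
      have "(F has_field_derivative exp (- \<i> * t * x)) (at (of_real x))"
        unfolding F_def using t by (auto intro!: derivative_eq_intros)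
      then have "((\<lambda>e. (F (of_real x + e) - F (of_real x)) / e) \<longlongrightarrow> exp (- \<i> * t * x)) (at 0)"
        by (simp add: DERIV_def)
      moreover have "filterlim (\<lambda>n. complex_of_real (h n)) (at 0) sequentially"
        using h0 h(1) by (auto simp: filterlim_at tendsto_of_real_iff[of h 0, simplified] intro!: always_eventually) (metis less_irrefl)
      ultimately have "(\<lambda>n. (F (of_real x + of_real (h n)) - F (of_real x)) / of_real (h n)) \<longlonglongrightarrow> exp (- \<i> * t * x)"
        by (rule filterlim_compose)
      moreover have "(F (of_real x + of_real (h n)) - F (of_real x)) / of_real (h n) = k x (x + h n) t / h n" for n
        unfolding F_def k_def using t by (simp add: diff_divide_distrib algebra_simps)
      ultimately show ?thesis by (simp add: algebra_simps)
    qed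
    show "AE t in lborel. (\<lambda>n. k x (x + h n) t / h n * char M t) \<longlonglongrightarrow> iexp (- (t * x)) * char M t"
      using AE_lborel_singleton[of 0] by eventually_elim (rule tendsto_mult[OF ptw tendsto_const])
  qed (use psi_int in auto)
  have e1: "(LINT t|lborel. k x (x + h n) t / h n * char M t) = of_real (2 * pi * (measure M {x<..x + h n} / h n))" for n
  proof -
    have "(LINT t|lborel. k x (x + h n) t / h n * char M t) = (LINT t|lborel. k x (x + h n) t * char M t / h n)"
      by (simp add: mult_ac)
    also have "\<dots> = (LINT t|lborel. k x (x + h n) t * char M t) / h n" by simp
    finally show ?thesis using levy[of x "x + h n"] h[of n] by simp
  qed
  have e2: "(\<lambda>n. complex_of_real (2 * pi * (measure M {x<..x + h n} / h n))) \<longlonglongrightarrow> of_real (2 * pi * q x)"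
    by (intro tendsto_intros lim1)
  have "(LINT t|lborel. iexp (- (t * x)) * char M t) = of_real (2 * pi * q x)"
    by (rule LIMSEQ_unique[OF lim2[unfolded e1] e2])
  moreover have "(LINT t|lborel. iexp (- (t * x)) * char M t) = (LINT t|lborel. iexp (- (t * x)) * \<phi> t) / I"
    unfolding char by simp
  ultimately show ?thesis using I by (simp add: q_def field_simps)
qed

lemma integrable_inverse_square_bound:
  fixes \<phi> :: "real \<Rightarrow> complex"
  assumes cont: "continuous_on UNIV \<phi>" and c: "c > 0"
    and bound: "\<And>t. norm (\<phi> t) \<le> C / (c\<^sup>2 + t\<^sup>2)"
  shows "integrable lborel \<phi>"
proof -
  have C: "C \<ge> 0" using order.trans[OF norm_ge_zero bound[of 0]] c by (simp add: zero_le_divide_iff)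
  have "integrable lborel (\<lambda>t::real. inverse (1 + t\<^sup>2))"
    using integrable_inverse_1_plus_square by (simp add: einterval_eq set_integrable_def)
  then have "integrable lborel (\<lambda>t. C * (1 + 1 / c\<^sup>2) * inverse (1 + t\<^sup>2))"
    by (rule integrable_mult_right)
  then show ?thesis
  proof (rule Bochner_Integration.integrable_bound)
    show "\<phi> \<in> borel_measurable lborel" using cont by (simp add: borel_measurable_continuous_onI)
    show "AE t in lborel. norm (\<phi> t) \<le> norm (C * (1 + 1 / c\<^sup>2) * inverse (1 + t\<^sup>2))"
    proof (intro AE_I2)
      fix t
      have "1 + t\<^sup>2 \<le> (1 + 1 / c\<^sup>2) * (c\<^sup>2 + t\<^sup>2)"
        using c by (simp add: algebra_simps add_nonneg_nonneg)
      then have "1 / (c\<^sup>2 + t\<^sup>2) \<le> (1 + 1 / c\<^sup>2) * inverse (1 + t\<^sup>2)"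
        using c by (simp add: divide_simps add_pos_nonneg mult.commute)
      then have "C * (1 / (c\<^sup>2 + t\<^sup>2)) \<le> C * ((1 + 1 / c\<^sup>2) * inverse (1 + t\<^sup>2))"
        using C by (rule mult_left_mono)
      then have "norm (\<phi> t) \<le> C * (1 + 1 / c\<^sup>2) * inverse (1 + t\<^sup>2)"
        using bound[of t] by (simp add: mult.assoc)
      then show "norm (\<phi> t) \<le> norm (C * (1 + 1 / c\<^sup>2) * inverse (1 + t\<^sup>2))"
        by (metis abs_ge_self order.trans real_norm_def)
    qed
  qed
qed

section \<open>Decay of Gamma on vertical lines and the two Mellin pairs\<close>

lemma nonpos_Ints_Re_le_0: "z \<in> \<int>\<^sub>\<le>\<^sub>0 \<Longrightarrow> Re z \<le> 0"
  by (auto elim!: nonpos_Ints_cases)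

lemma norm_Gamma_le:
  assumes "Re s > 0" shows "norm (Gamma s) \<le> Re (Gamma (of_real (Re s)))"
proof -
  have "has_bochner_integral lborel (\<lambda>u. complex_of_real (exp (Re s * u) * exp (- exp u))) (Gamma (of_real (Re s)))"
    using Gamma_exp_integral[of "of_real (Re s)"] assms by (simp add: exp_of_real[symmetric])
  then have "(LINT u|lborel. norm (exp (s * of_real u) * complex_of_real (exp (- exp u)))) = Re (Gamma (of_real (Re s)))"
    using integral_Re[of lborel "\<lambda>u. complex_of_real (exp (Re s * u) * exp (- exp u))"]
    by (simp add: has_bochner_integral_iff norm_mult)
  moreover have "Gamma s = (LINT u|lborel. exp (s * of_real u) * complex_of_real (exp (- exp u)))"
    using Gamma_exp_integral[OF assms] by (simp add: has_bochner_integral_iff)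
  ultimately show ?thesis by (metis integral_norm_bound)
qed

text \<open>Two steps of the recurrence express Gamma at \<open>s\<close> as the quotient of Gamma
  at \<open>s + 2\<close>, which is bounded on the line, by \<open>s * (s + 1)\<close>. This
  quadratic decay makes the function integrable along the line.\<close>

lemma norm_Gamma_decay:
  assumes s: "Re s = \<sigma>" "\<sigma> > 0"
  shows "norm (Gamma s) \<le> Re (Gamma (of_real (\<sigma> + 2))) / (\<sigma>\<^sup>2 + (Im s)\<^sup>2)"
proof -
  have n: "s \<notin> \<int>\<^sub>\<le>\<^sub>0" "s + 1 \<notin> \<int>\<^sub>\<le>\<^sub>0" using s by (auto dest: nonpos_Ints_Re_le_0)
  have "Gamma (s + 2) = (s + 1) * s * Gamma s"
    using Gamma_plus1[OF n(1)] Gamma_plus1[OF n(2)] by (simp add: add.assoc mult.assoc)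
  then have "norm (s + 1) * norm s * norm (Gamma s) = norm (Gamma (s + 2))" by (simp add: norm_mult)
  also have "\<dots> \<le> Re (Gamma (of_real (\<sigma> + 2)))" using norm_Gamma_le[of "s + 2"] s by simp
  finally have 1: "norm (s + 1) * norm s * norm (Gamma s) \<le> Re (Gamma (of_real (\<sigma> + 2)))" .
  have "norm s \<le> norm (s + 1)" unfolding cmod_def using s by (intro real_sqrt_le_mono) (auto simp: power2_eq_square algebra_simps)
  then have "norm s * norm s \<le> norm (s + 1) * norm s" by (intro mult_right_mono) auto
  moreover have "norm s * norm s = \<sigma>\<^sup>2 + (Im s)\<^sup>2" using cmod_power2[of s] s by (simp add: power2_eq_square)
  ultimately have "(\<sigma>\<^sup>2 + (Im s)\<^sup>2) * norm (Gamma s) \<le> norm (s + 1) * norm s * norm (Gamma s)"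
    by (intro mult_right_mono) auto
  with 1 have "norm (Gamma s) * (\<sigma>\<^sup>2 + (Im s)\<^sup>2) \<le> Re (Gamma (of_real (\<sigma> + 2)))" by (simp add: mult.commute)
  moreover have "\<sigma>\<^sup>2 + (Im s)\<^sup>2 > 0" using s by (simp add: add_pos_nonneg)
  ultimately show ?thesis by (simp add: pos_le_divide_eq)
qed

lemma continuous_on_Gamma_compose:
  fixes f :: "real \<Rightarrow> complex"
  assumes "continuous_on A f" "\<And>x. x \<in> A \<Longrightarrow> f x \<notin> \<int>\<^sub>\<le>\<^sub>0"
  shows "continuous_on A (\<lambda>x. Gamma (f x))"
proof (rule continuous_on_compose2[of "- \<int>\<^sub>\<le>\<^sub>0" Gamma A f])
  show "continuous_on (- \<int>\<^sub>\<le>\<^sub>0) (Gamma :: complex \<Rightarrow> complex)"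
    by (intro holomorphic_on_imp_continuous_on holomorphic_intros) auto
qed (use assms in auto)

lemma exp_Complex_of_real: "exp (Complex \<sigma> t * of_real u) = of_real (exp (\<sigma> * u)) * iexp (t * u)"
  by (simp add: Complex_eq exp_of_real[symmetric] distrib_right mult.assoc flip: exp_add)

text \<open>On the line with real part \<open>\<sigma>\<close>, Gamma is the Fourier transform of
  the positive function \<open>exp (\<sigma> * u) * exp (- exp u)\<close>. After inversion the
  factor \<open>exp (- \<sigma> * v)\<close> removes the tilt, so the result is independent of the
  line.\<close>

lemma Gamma_mellin_inversion:
  assumes \<sigma>: "\<sigma> > 0"
  shows "has_bochner_integral lborel (\<lambda>t. exp (- Complex \<sigma> t * of_real v) * Gamma (Complex \<sigma> t)) (of_real (2 * pi * exp (- exp v)))"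
    and "integrable lborel (\<lambda>t. Gamma (Complex \<sigma> t))"
proof -
  have nn: "Complex \<sigma> t \<notin> \<int>\<^sub>\<le>\<^sub>0" for t using \<sigma> by (auto dest: nonpos_Ints_Re_le_0)
  show int: "integrable lborel (\<lambda>t. Gamma (Complex \<sigma> t))"
  proof (rule integrable_inverse_square_bound[OF _ \<sigma>])
    show "continuous_on UNIV (\<lambda>t. Gamma (Complex \<sigma> t))"
      using nn unfolding Complex_eq by (intro continuous_on_Gamma_compose continuous_intros) auto
    show "norm (Gamma (Complex \<sigma> t)) \<le> Re (Gamma (of_real (\<sigma> + 2))) / (\<sigma>\<^sup>2 + t\<^sup>2)" for t
      using norm_Gamma_decay[of "Complex \<sigma> t" \<sigma>] \<sigma> by simp
  qed
  have G: "has_bochner_integral lborel (\<lambda>u. of_real (exp (\<sigma> * u) * exp (- exp u)) * iexp (t * u)) (Gamma (Complex \<sigma> t))" for t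
    using Gamma_exp_integral[of "Complex \<sigma> t"] \<sigma> unfolding exp_Complex_of_real by (simp add: mult_ac)
  have G0: "has_bochner_integral lborel (\<lambda>u. complex_of_real (exp (\<sigma> * u) * exp (- exp u))) (of_real (Gamma \<sigma>))"
  proof -
    have "Complex \<sigma> 0 = of_real \<sigma>" by (simp add: complex_eq_iff)
    then show ?thesis using G[of 0] by (simp add: Gamma_complex_of_real)
  qed
  then have p: "integrable lborel (\<lambda>u. exp (\<sigma> * u) * exp (- exp u))" "(LINT u|lborel. exp (\<sigma> * u) * exp (- exp u)) = Gamma \<sigma>"
    using integrable_Re[of lborel "\<lambda>u. complex_of_real (exp (\<sigma> * u) * exp (- exp u))"]
      integral_Re[of lborel "\<lambda>u. complex_of_real (exp (\<sigma> * u) * exp (- exp u))"]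
    by (auto simp: has_bochner_integral_iff simp del: of_real_mult)
  have inv: "(LINT t|lborel. iexp (- (t * v)) * Gamma (Complex \<sigma> t)) = of_real (2 * pi * (exp (\<sigma> * v) * exp (- exp v)))"
  proof (rule fourier_inversion_density[OF _ _ p(1) _ _ int])
    show "(LINT u|lborel. of_real (exp (\<sigma> * u) * exp (- exp u)) * iexp (t * u)) = Gamma (Complex \<sigma> t)" for t
      using G[of t] by (simp only: has_bochner_integral_iff)
  qed (use \<sigma> p in \<open>auto intro!: continuous_intros Gamma_real_pos\<close>)
  have shift: "exp (- Complex \<sigma> t * of_real v) * Gamma (Complex \<sigma> t) = of_real (exp (- \<sigma> * v)) * (iexp (- (t * v)) * Gamma (Complex \<sigma> t))" for t
    using exp_Complex_of_real[of "\<sigma>" t "- v"] by simp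
  have "integrable lborel (\<lambda>t. iexp (- (t * v)) * Gamma (Complex \<sigma> t))"
    by (rule Bochner_Integration.integrable_bound[OF int]) (use int in \<open>auto simp: norm_mult\<close>)
  then have "has_bochner_integral lborel (\<lambda>t. iexp (- (t * v)) * Gamma (Complex \<sigma> t)) (of_real (2 * pi * (exp (\<sigma> * v) * exp (- exp v))))"
    using inv by (simp only: has_bochner_integral_iff)
  then have "has_bochner_integral lborel (\<lambda>t. exp (- Complex \<sigma> t * of_real v) * Gamma (Complex \<sigma> t)) (of_real (exp (- \<sigma> * v)) * of_real (2 * pi * (exp (\<sigma> * v) * exp (- exp v))))"
    unfolding shift by (intro has_bochner_integral_mult_right)
  also have "of_real (exp (- \<sigma> * v)) * of_real (2 * pi * (exp (\<sigma> * v) * exp (- exp v))) = complex_of_real (2 * pi * exp (- exp v))"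
    unfolding of_real_mult[symmetric] by (simp add: exp_minus)
  finally show "has_bochner_integral lborel (\<lambda>t. exp (- Complex \<sigma> t * of_real v) * Gamma (Complex \<sigma> t)) (of_real (2 * pi * exp (- exp v)))" .
qed

lemma Gamma_reflect_half:
  "Gamma (s / 2) * Gamma (1 - s / 2) / 2 = complex_of_real pi / (2 * sin (of_real pi * s / 2))"
  using Gamma_reflection_complex[of "s / 2"] by simp

text \<open>The same argument with the density
  \<open>exp (\<sigma> * u) / (1 + exp (2 * u))\<close>. Written as a product of two Gamma factors,
  the transform takes its quadratic decay from the first factor, while the second is merely
  bounded.\<close>

lemma logistic_mellin_inversion:
  assumes \<sigma>: "0 < \<sigma>" "\<sigma> < 2"
  shows "has_bochner_integral lborel
      (\<lambda>t. exp (- Complex \<sigma> t * of_real v) * (of_real pi / (2 * sin (of_real pi * Complex \<sigma> t / 2))))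
      (of_real (2 * pi / (1 + exp (2 * v))))"
    and "integrable lborel (\<lambda>t. of_real pi / (2 * sin (of_real pi * Complex \<sigma> t / 2)))"
proof -
  define \<phi> where "\<phi> t = Gamma (Complex \<sigma> t / 2) * Gamma (1 - Complex \<sigma> t / 2) / 2" for t
  have \<phi>: "\<phi> t = of_real pi / (2 * sin (of_real pi * Complex \<sigma> t / 2))" for t
    unfolding \<phi>_def by (rule Gamma_reflect_half)
  have nn: "Complex \<sigma> t / 2 \<notin> \<int>\<^sub>\<le>\<^sub>0" "1 - Complex \<sigma> t / 2 \<notin> \<int>\<^sub>\<le>\<^sub>0" for t using \<sigma> by (auto dest: nonpos_Ints_Re_le_0)
  have int: "integrable lborel \<phi>"
  proof (rule integrable_inverse_square_bound[OF _ \<sigma>(1)])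
    show "continuous_on UNIV \<phi>"
      using nn unfolding \<phi>_def Complex_eq by (intro continuous_on_Gamma_compose continuous_intros) auto
    define C1 where "C1 = Re (Gamma (of_real (\<sigma> / 2 + 2)))"
    define C2 where "C2 = Re (Gamma (of_real (1 - \<sigma> / 2)))"
    show "norm (\<phi> t) \<le> 2 * C1 * C2 / (\<sigma>\<^sup>2 + t\<^sup>2)" for t
    proof -
      have 1: "norm (Gamma (Complex \<sigma> t / 2)) \<le> C1 / ((\<sigma> / 2)\<^sup>2 + (t / 2)\<^sup>2)"
        using norm_Gamma_decay[of "Complex \<sigma> t / 2" "\<sigma> / 2"] \<sigma> by (simp add: C1_def)
      have 2: "norm (Gamma (1 - Complex \<sigma> t / 2)) \<le> C2"
        using norm_Gamma_le[of "1 - Complex \<sigma> t / 2"] \<sigma> by (simp add: C2_def)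
      have "norm (\<phi> t) \<le> C1 / ((\<sigma> / 2)\<^sup>2 + (t / 2)\<^sup>2) * C2 / 2"
      proof -
        have "norm (Gamma (Complex \<sigma> t / 2)) * norm (Gamma (1 - Complex \<sigma> t / 2)) \<le> C1 / ((\<sigma> / 2)\<^sup>2 + (t / 2)\<^sup>2) * C2"
          using 1 2 order.trans[OF norm_ge_zero 1] by (intro mult_mono) auto
        then have "norm (Gamma (Complex \<sigma> t / 2)) * norm (Gamma (1 - Complex \<sigma> t / 2)) / 2 \<le> C1 / ((\<sigma> / 2)\<^sup>2 + (t / 2)\<^sup>2) * C2 / 2"
          by (intro divide_right_mono) auto
        then show ?thesis by (simp only: \<phi>_def norm_mult norm_divide norm_numeral)
      qed
      also have "(\<sigma> / 2)\<^sup>2 + (t / 2)\<^sup>2 = (\<sigma>\<^sup>2 + t\<^sup>2) / 4" by (simp add: power_divide add_divide_distrib)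
      also have "C1 / ((\<sigma>\<^sup>2 + t\<^sup>2) / 4) * C2 / 2 = 2 * C1 * C2 / (\<sigma>\<^sup>2 + t\<^sup>2)"
      proof -
        have "C1 / (X / 4) * C2 / 2 = 2 * C1 * C2 / X" for X by simp
        then show ?thesis .
      qed
      finally show ?thesis .
    qed
  qed
  then show "integrable lborel (\<lambda>t. of_real pi / (2 * sin (of_real pi * Complex \<sigma> t / 2)))"
    unfolding \<phi>[abs_def] .
  have G: "has_bochner_integral lborel (\<lambda>u. of_real (exp (\<sigma> * u) / (1 + exp (2 * u))) * iexp (t * u)) (\<phi> t)" for t
    using logistic_exp_integral[of "Complex \<sigma> t"] \<sigma> unfolding exp_Complex_of_real \<phi>_def by simp
  define J where "J = (LINT u|lborel. exp (\<sigma> * u) / (1 + exp (2 * u)))"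
  have pos: "exp (\<sigma> * u) / (1 + exp (2 * u)) > 0" for u by (intro divide_pos_pos add_pos_pos) auto
  have p: "integrable lborel (\<lambda>u. exp (\<sigma> * u) / (1 + exp (2 * u)))"
    using G[of 0] integrable_Re[of lborel "\<lambda>u. complex_of_real (exp (\<sigma> * u) / (1 + exp (2 * u)))"]
    by (auto simp: has_bochner_integral_iff simp del: of_real_mult of_real_divide of_real_add)
  have J: "J > 0"
  proof -
    have "J \<noteq> 0"
    proof
      assume "J = 0"
      then have "AE u in lborel. exp (\<sigma> * u) / (1 + exp (2 * u)) = 0"
        unfolding J_def using p pos by (subst (asm) integral_nonneg_eq_0_iff_AE) (auto simp: less_imp_le)
      then have "AE u in (lborel :: real measure). False"
      proof eventually_elim
        fix u assume "exp (\<sigma> * u) / (1 + exp (2 * u)) = 0"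
        with pos[of u] show False by simp
      qed
      then show False by (simp add: AE_iff_null null_sets_def)
    qed
    moreover have "J \<ge> 0" unfolding J_def using pos by (intro integral_nonneg_AE AE_I2) (auto simp: less_imp_le)
    ultimately show ?thesis by simp
  qed
  have inv: "(LINT t|lborel. iexp (- (t * v)) * \<phi> t) = of_real (2 * pi * (exp (\<sigma> * v) / (1 + exp (2 * v))))"
  proof (rule fourier_inversion_density[OF _ _ p _ _ int])
    show "(LINT u|lborel. of_real (exp (\<sigma> * u) / (1 + exp (2 * u))) * iexp (t * u)) = \<phi> t" for t
      using G[of t] by (simp only: has_bochner_integral_iff)
    have "1 + exp (2 * u) \<noteq> 0" for u :: real using add_pos_pos[of 1 "exp (2 * u)"] by simp
    then show "continuous_on UNIV (\<lambda>u. exp (\<sigma> * u) / (1 + exp (2 * u)))" by (intro continuous_intros) auto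
  qed (use J pos in \<open>auto simp: J_def less_imp_le\<close>)
  have shift: "exp (- Complex \<sigma> t * of_real v) * \<phi> t = of_real (exp (- \<sigma> * v)) * (iexp (- (t * v)) * \<phi> t)" for t
    using exp_Complex_of_real[of "\<sigma>" t "- v"] by simp
  have "integrable lborel (\<lambda>t. iexp (- (t * v)) * \<phi> t)"
    by (rule Bochner_Integration.integrable_bound[OF int]) (use int in \<open>auto simp: norm_mult\<close>)
  then have "has_bochner_integral lborel (\<lambda>t. iexp (- (t * v)) * \<phi> t) (of_real (2 * pi * (exp (\<sigma> * v) / (1 + exp (2 * v)))))"
    using inv by (simp only: has_bochner_integral_iff)
  then have "has_bochner_integral lborel (\<lambda>t. exp (- Complex \<sigma> t * of_real v) * \<phi> t) (of_real (exp (- \<sigma> * v)) * of_real (2 * pi * (exp (\<sigma> * v) / (1 + exp (2 * v)))))"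
    unfolding shift by (intro has_bochner_integral_mult_right)
  also have "of_real (exp (- \<sigma> * v)) * of_real (2 * pi * (exp (\<sigma> * v) / (1 + exp (2 * v)))) = complex_of_real (2 * pi / (1 + exp (2 * v)))"
    unfolding of_real_mult[symmetric] by (simp add: exp_minus)
  finally show "has_bochner_integral lborel
      (\<lambda>t. exp (- Complex \<sigma> t * of_real v) * (of_real pi / (2 * sin (of_real pi * Complex \<sigma> t / 2))))
      (of_real (2 * pi / (1 + exp (2 * v))))"
    unfolding \<phi> .
qed

subsection \<open>Zeta on suitable horizontal lines\<close>

lemma prod_list_ge_power:
  fixes f :: "'a \<Rightarrow> real"
  assumes "0 \<le> q" "\<And>a. a \<in> set as \<Longrightarrow> q \<le> f a"
  shows "q ^ length as \<le> (\<Prod>a\<leftarrow>as. f a)"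
  using assms
proof (induction as)
  case (Cons b as)
  then have "0 \<le> f b" by (meson list.set_intros(1) order.trans)
  with Cons show ?case by (auto intro!: mult_mono)
qed auto

text \<open>Supplies the lower bound at the centre of the disc, without which a minimum modulus
  estimate says nothing. The terms of the series after the first add up to at most
  \<open>pi\<^sup>2 / 6 - 1\<close>, which is below 3/4.\<close>

lemma norm_zeta_2_ge:
  assumes "Re s = 2"
  shows "norm (riemann_zeta s) \<ge> 1 / 4"
proof -
  have sm: "(\<lambda>n. 1 / real (Suc n) ^ 2) sums (pi\<^sup>2 / 6)" using inverse_squares_sums by (simp add: add.commute)
  have sums: "(\<lambda>n. of_nat (Suc n) powr (-s)) sums riemann_zeta s"
    using assms by (intro riemann_zeta_sums) auto
  have nrm: "norm (of_nat (Suc n) powr (-s) :: complex) = 1 / real (Suc n) ^ 2" for n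
    using norm_nat_powr[of "Suc n" "-s"] assms
    by (simp add: powr_minus powr_numeral divide_inverse)
  have s1: "(\<lambda>n. of_nat (Suc (Suc n)) powr (-s)) sums (riemann_zeta s - 1)"
    using sums_split_initial_segment[OF sums, of 1] by simp
  have s2: "(\<lambda>n. 1 / real (Suc (Suc n)) ^ 2) sums (pi\<^sup>2 / 6 - 1)"
    using sums_split_initial_segment[OF sm, of 1] by simp
  have "norm (riemann_zeta s - 1) \<le> pi\<^sup>2 / 6 - 1"
    using norm_suminf_le[of "\<lambda>n. of_nat (Suc (Suc n)) powr (-s)" "\<lambda>n. 1 / real (Suc (Suc n)) ^ 2"]
      nrm[of "Suc _"] s1 s2 by (simp add: sums_iff)
  moreover have "pi\<^sup>2 \<le> (32/10)\<^sup>2" using pi_approx by (intro power_mono) auto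
  moreover have "(32/10)\<^sup>2 = (1024/100 :: real)" by (simp add: power2_eq_square)
  ultimately have "norm (riemann_zeta s - 1) \<le> 3 / 4" by linarith
  moreover have "1 - norm (riemann_zeta s - 1) \<le> norm (riemann_zeta s)"
    using norm_triangle_ineq2[of 1 "1 - riemann_zeta s"] by (simp add: norm_minus_commute)
  ultimately show ?thesis by linarith
qed

text \<open>
  The bound that the minimum modulus estimate gives on discs of radii \<open>11/5\<close>, \<open>12/5\<close> and \<open>13/5\<close> around
  \<open>2 + \<i> * (T + 1/2)\<close>: there \<open>Q\<close> bounds the modulus and \<open>N\<close> the number of zeros.
\<close>
definition zeta_pre_lower :: "real \<Rightarrow> real \<Rightarrow> real" where
  "zeta_pre_lower K T = (let Q = K * (T + 7) ^ 3; N = ln Q / ln (13/12)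
     in 1 / 4 * Q powr (-22) * exp (- N * ln (11 * (N + 1))))"

text \<open>Around the centre 2 + i * (T + 1/2), the disc of radius 13/5 stays to the right of -3/4,
  where the cubic bound holds, and radius 3 to the right of -1. Radius 11/5 covers the required
  piece of the strip, because (17/8)^2 + (1/2)^2 < (11/5)^2. The exponent 22 is 2 * r1 / (r - r1)
  for r1 = 11/5 and r = 12/5.\<close>

lemma zeta_pre_lower_bound_heights:
  obtains K where "K > 0" "\<And>T. T \<ge> 5 \<Longrightarrow> \<exists>t. T \<le> t \<and> t \<le> T + 1 \<and>
      (\<forall>s. Im s = t \<longrightarrow> -1/8 \<le> Re s \<longrightarrow> Re s \<le> 3/2 \<longrightarrow>
         zeta_pre_lower K T \<le> norm (zeta_pre s))"
proof -
  obtain K0 where K0: "K0 > 0" "\<And>s. Re s \<ge> -3/4 \<Longrightarrow> norm (zeta_pre s) \<le> K0 * (1 + norm s) ^ 3"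
    using zeta_pre_bound by metis
  \<comment> \<open>The 8 is 2 divided by the lower bound 1/4 at the centre, so \<open>Q\<close>
    dominates \<open>2 * M / norm (f 0)\<close>; the added 1 makes \<open>Q\<close> at least 8 and
    hence \<open>N\<close> nonnegative.\<close>
  define K where "K = 8 * (K0 + 1)"
  have "\<exists>t. T \<le> t \<and> t \<le> T + 1 \<and>
      (\<forall>s. Im s = t \<longrightarrow> -1/8 \<le> Re s \<longrightarrow> Re s \<le> 3/2 \<longrightarrow>
         zeta_pre_lower K T \<le> norm (zeta_pre s))" if T: "T \<ge> 5" for T
  proof -
    define Q where "Q = K * (T + 7) ^ 3"
    have T7: "1 \<le> (T + 7) ^ 3" using T by (intro one_le_power) auto
    have "8 * 1 * 1 \<le> 8 * (K0 + 1) * (T + 7) ^ 3" using K0 T7 by (intro mult_mono) auto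
    then have Q: "Q \<ge> 8" by (simp add: Q_def K_def)
    define N where "N = ln Q / ln (13/12)"
    have N: "N \<ge> 0" using Q by (simp add: N_def)
    define c where "c = Complex 2 (T + 1/2)"
    define f where "f z = zeta_pre (c + z)" for z
    define M where "M = K0 * (T + 7) ^ 3"
    have fM: "norm (f z) \<le> M" if "norm z \<le> 13/5" for z
    proof -
      have "Re (c + z) \<ge> -3/4" using abs_Re_le_cmod[of z] that by (simp add: c_def)
      then have "norm (f z) \<le> K0 * (1 + norm (c + z)) ^ 3" unfolding f_def by (rule K0(2))
      also have "norm (c + z) \<le> T + 6"
        using norm_triangle_ineq[of c z] cmod_le[of c] that T by (simp add: c_def)
      then have "K0 * (1 + norm (c + z)) ^ 3 \<le> K0 * (T + 7) ^ 3"
        using K0 by (intro mult_left_mono power_mono) auto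
      finally show ?thesis by (simp add: M_def)
    qed
    have f0: "norm (f 0) \<ge> 1/4"
    proof -
      have "riemann_zeta c = zeta_pre c / (c - 1)" by (rule riemann_zeta_eq) (simp add: c_def)
      moreover have c1: "c - 1 \<noteq> 0" by (simp add: c_def complex_eq_iff)
      ultimately have "norm (f 0) = norm (c - 1) * norm (riemann_zeta c)"
        by (simp add: f_def norm_divide)
      moreover have "norm (riemann_zeta c) \<ge> 1/4" by (rule norm_zeta_2_ge) (simp add: c_def)
      moreover have "norm (c - 1) \<ge> 1" using abs_Re_le_cmod[of "c - 1"] by (simp add: c_def)
      ultimately show ?thesis using mult_mono[of 1 "norm (c - 1)" "1/4" "norm (riemann_zeta c)"] by simp
    qed
    then have f0': "norm (f 0) > 0" "f 0 \<noteq> 0" by auto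
    have hol: "f holomorphic_on ball 0 3"
      unfolding f_def
    proof (rule holomorphic_on_compose_gen[of "\<lambda>z. c + z", unfolded o_def, OF _ zeta_pre_holomorphic image_subsetI])
      fix z :: complex assume "z \<in> ball 0 3"
      then have "Re (c + z) > -1" using abs_Re_le_cmod[of z] by (simp add: c_def)
      then show "c + z \<in> {s. -1 < Re s}" by simp
    qed (intro holomorphic_intros)
    obtain as where as: "set as \<subseteq> cball 0 (12/5)" "(13/5 / (12/5)) ^ length as \<le> M / norm (f 0)"
      "\<And>z. norm z \<le> 11/5 \<Longrightarrow> norm (f 0) * exp (- (2 * (11/5) / (12/5 - 11/5)) * ln (2 * M / norm (f 0))) *
        (\<Prod>a\<leftarrow>as. norm (z - a) / (2 * (13/5))) \<le> norm (f z)"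
      using minimum_modulus[of "11/5" "12/5" "13/5" 3 f M] hol fM f0'(2) by auto
    have M0: "M > 0" unfolding M_def using K0(1) T by simp
    have MQ: "2 * M / norm (f 0) \<le> Q"
    proof -
      have "2 * M / norm (f 0) \<le> 2 * M / (1/4)" using f0 M0 by (intro divide_left_mono) auto
      also have "\<dots> \<le> Q" unfolding Q_def M_def K_def using T by (simp add: algebra_simps)
      finally show ?thesis .
    qed
    have M1: "2 * M / norm (f 0) > 0" using M0 f0' by simp
    have n: "real (length as) \<le> N"
    proof -
      have "(13/12) ^ length as \<le> M / norm (f 0)" using as(2) by simp
      also have "\<dots> \<le> 2 * M / norm (f 0)" using M0 f0' by (intro divide_right_mono) auto
      also note MQ
      finally have "ln ((13/12) ^ length as) \<le> ln Q" by (subst ln_le_cancel_iff) (use Q in auto)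
      then have "real (length as) * ln (13/12) \<le> ln Q" by (simp add: ln_realpow)
      then show ?thesis by (simp add: N_def pos_le_divide_eq)
    qed
    obtain t where t: "T \<le> t" "t \<le> T + 1"
      "\<And>b. b \<in> set (map (\<lambda>a. T + 1/2 + Im a) as) \<Longrightarrow> 1 / (2 * (real (length (map (\<lambda>a. T + 1/2 + Im a) as)) + 1)) \<le> \<bar>t - b\<bar>"
      using exists_height_avoiding by blast
    show ?thesis
    proof (intro exI conjI allI impI)
      fix s assume s: "Im s = t" "-1/8 \<le> Re s" "Re s \<le> 3/2"
      define z where "z = s - c"
      have "(norm z)\<^sup>2 \<le> (11/5)\<^sup>2"
      proof -
        have "\<bar>Re z\<bar> \<le> 17/8" "\<bar>Im z\<bar> \<le> 1/2" using s t by (auto simp: z_def c_def abs_if)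
        then have "(Re z)\<^sup>2 \<le> (17/8)\<^sup>2" "(Im z)\<^sup>2 \<le> (1/2)\<^sup>2" by (metis abs_ge_zero power2_abs power_mono)+
        then show ?thesis unfolding cmod_power2 by (simp add: power2_eq_square)
      qed
      then have z: "norm z \<le> 11/5" by (rule power2_le_imp_le) auto
      have "(1 / (11 * (N + 1))) ^ length as \<le> (\<Prod>a\<leftarrow>as. norm (z - a) / (2 * (13/5)))"
      proof (rule prod_list_ge_power)
        fix a assume a: "a \<in> set as"
        have "1 / (2 * (real (length as) + 1)) \<le> \<bar>t - (T + 1/2 + Im a)\<bar>" using t(3) a by auto
        also have "\<dots> = \<bar>Im (z - a)\<bar>" using s by (simp add: z_def c_def)
        also have "\<dots> \<le> norm (z - a)" by (rule abs_Im_le_cmod)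
        finally have "1 / (2 * (real (length as) + 1)) / (2 * (13/5)) \<le> norm (z - a) / (2 * (13/5))"
          by (intro divide_right_mono) auto
        moreover have "1 / (11 * (N + 1)) \<le> 1 / (2 * (real (length as) + 1)) / (2 * (13/5))"
        proof -
          \<comment> \<open>The product of the constants is 52/5, rounded up to 11.\<close>
          have "2 * (real (length as) + 1) * (2 * (13/5)) \<le> 11 * (N + 1)" using n by simp
          then have "1 / (11 * (N + 1)) \<le> 1 / (2 * (real (length as) + 1) * (2 * (13/5)))"
            by (intro divide_left_mono mult_pos_pos) (use N in auto)
          then show ?thesis by simp
        qed
        ultimately show "1 / (11 * (N + 1)) \<le> norm (z - a) / (2 * (13/5))" by linarith
      qed (use N in auto)
      moreover have "exp (- N * ln (11 * (N + 1))) \<le> (1 / (11 * (N + 1))) ^ length as"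
      proof -
        have "(1 / (11 * (N + 1))) ^ length as = exp (- (real (length as) * ln (11 * (N + 1))))"
          using N by (simp add: exp_minus exp_of_nat_mult power_one_over inverse_eq_divide)
        moreover have "real (length as) * ln (11 * (N + 1)) \<le> N * ln (11 * (N + 1))"
          using n N by (intro mult_right_mono) auto
        ultimately show ?thesis by simp
      qed
      ultimately have P: "exp (- N * ln (11 * (N + 1))) \<le> (\<Prod>a\<leftarrow>as. norm (z - a) / (2 * (13/5)))" by linarith
      have "Q powr (-22) \<le> exp (- 22 * ln (2 * M / norm (f 0)))"
      proof -
        have "ln (2 * M / norm (f 0)) \<le> ln Q" using MQ M1 by simp
        then show ?thesis using Q by (simp add: powr_def)
      qed
      then have "1/4 * Q powr (-22) * exp (- N * ln (11 * (N + 1))) \<le>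
          norm (f 0) * exp (- 22 * ln (2 * M / norm (f 0))) * (\<Prod>a\<leftarrow>as. norm (z - a) / (2 * (13/5)))"
        using f0 P by (intro mult_mono) auto
      also have "\<dots> \<le> norm (f z)" using as(3)[OF z] by simp
      also have "f z = zeta_pre s" by (simp add: f_def z_def)
      finally show "zeta_pre_lower K T \<le> norm (zeta_pre s)" unfolding zeta_pre_lower_def Let_def N_def Q_def .
    qed (use t in auto)
  qed
  moreover have "K > 0" using K0 by (simp add: K_def)
  ultimately show ?thesis using that by blast
qed

text \<open>Here \<open>N\<close> is O(ln T), so the reciprocal of the lower bound is exp (O (ln T *
  ln ln T)), which the exponential in \<open>T\<close> outweighs.\<close>

lemma height_bound_tendsto:
  assumes "K > 0"
  shows "((\<lambda>T. (T + 10) ^ 7 * exp (- (pi / 2) * T) / zeta_pre_lower K T) \<longlongrightarrow> 0) at_top"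
  unfolding zeta_pre_lower_def Let_def using assms by real_asymp

subsection \<open>The kernel and its residues\<close>

text \<open>To the right of 1 zeta has an inverse. To the left of 0 the reflection formula has
  nonvanishing factors at \<open>1 - s\<close>, so a zero must come from the sine, which makes it a
  negative even integer.\<close>

lemma nontrivial_zeta_zeros_Re:
  assumes "s \<in> nontrivial_zeta_zeros"
  shows "0 \<le> Re s" "Re s \<le> 1"
proof -
  have z: "riemann_zeta s = 0" "s \<noteq> 1" "\<And>k::nat. k \<ge> 1 \<Longrightarrow> s \<noteq> - (2 * of_nat k)"
    using assms by (auto simp: nontrivial_zeta_zeros_def)
  show "Re s \<le> 1" using riemann_zeta_nonzero[of s] z(1) by force
  show "0 \<le> Re s"
  proof (rule ccontr)
    assume "\<not> 0 \<le> Re s"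
    then have neg: "Re s < 0" by simp
    have "riemann_zeta (1 - s) \<noteq> 0" using neg by (intro riemann_zeta_nonzero) simp
    moreover have "Gamma (1 - s) \<noteq> 0"
      using neg nonpos_Ints_Re_le_0[of "1 - s"] by (auto simp: Gamma_eq_zero_iff)
    ultimately have "sin (of_real pi * s / 2) = 0"
      using riemann_zeta_reflect[OF neg] z(1) by auto
    then have "s / 2 \<in> \<int>" using sin_of_real_pi_times_nonzero[of "s / 2"] by auto
    then obtain n :: int where n: "s / 2 = of_int n" by (auto elim: Ints_cases)
    then have s: "s = 2 * of_int n" by (simp add: field_simps)
    then have "n < 0" using neg by simp
    then have "of_int n = - (of_nat (nat (- n)) :: complex)" "nat (- n) \<ge> 1" by auto
    then show False using z(3)[of "nat (- n)"] s by simp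
  qed
qed

lemma riemann_zeta_0: "riemann_zeta 0 = - 1 / 2"
  using riemann_zeta_eq[of 0] by simp

lemma riemann_zeta_half_eq: "riemann_zeta (1 / 2) = - 2 * zeta_pre (1 / 2)"
  using riemann_zeta_eq[of "1 / 2"] by simp

lemma zeta_pre_reflected_zero:
  assumes "s \<in> nontrivial_zeta_zeros"
  shows "zeta_pre (1 - s) = 0"
proof -
  have s: "riemann_zeta s = 0" "s \<noteq> 1" using assms by (auto simp: nontrivial_zeta_zeros_def)
  have s0: "s \<noteq> 0" using s riemann_zeta_0 by auto
  note re = nontrivial_zeta_zeros_Re[OF assms]
  have "s \<notin> \<int>\<^sub>\<le>\<^sub>0"
  proof
    assume "s \<in> \<int>\<^sub>\<le>\<^sub>0"
    then obtain n where "s = of_int n" "n \<le> 0" by (auto elim!: nonpos_Ints_cases)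
    with re(1) s0 show False by simp
  qed
  then have "riemann_zeta (1 - s) = 0" using riemann_zeta_functional[of s] s by simp
  then show ?thesis using riemann_zeta_eq[of "1 - s"] re s0 by simp
qed

text \<open>Identifies the zeros of the denominator of the kernel. The converse direction shows that
  \<open>1 - s\<close> is a non-trivial zero and applies the symmetry a second time.\<close>

lemma zeta_pre_reflected_zero_iff:
  assumes s: "-1 < Re s" "Re s < 3/2"
  shows "zeta_pre (1 - s) = 0 \<longleftrightarrow> s \<in> nontrivial_zeta_zeros"
proof
  assume z: "zeta_pre (1 - s) = 0"
  have s0: "s \<noteq> 0" "s \<noteq> 1" using z by auto
  have "riemann_zeta (1 - s) = 0" using riemann_zeta_eq[of "1 - s"] s z by simp
  moreover have "1 - s \<noteq> - (2 * of_nat k)" if "k \<ge> 1" for k :: nat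
  proof
    assume "1 - s = - (2 * of_nat k)"
    then have "Re (1 - s) = - (2 * real k)" by simp
    with s that show False by simp
  qed
  ultimately have "1 - s \<in> nontrivial_zeta_zeros" using s0 by (simp add: nontrivial_zeta_zeros_def)
  from zeta_pre_reflected_zero[OF this] have "zeta_pre s = 0" by simp
  then have "riemann_zeta s = 0" using riemann_zeta_eq[of s] s by simp
  moreover have "s \<noteq> - (2 * of_nat k)" if "k \<ge> 1" for k :: nat
  proof
    assume "s = - (2 * of_nat k)"
    then have "Re s = - (2 * real k)" by simp
    with s that show False by simp
  qed
  ultimately show "s \<in> nontrivial_zeta_zeros" using s0 by (simp add: nontrivial_zeta_zeros_def)
qed (rule zeta_pre_reflected_zero)

lemma finite_nontrivial_zeta_zeros_below: "finite (nontrivial_zeta_zeros_below T)"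
proof -
  let ?K = "cbox (Complex 0 (-T)) (Complex 1 T)"
  have "finite {s \<in> ?K. zeta_pre s = 0}"
  proof (rule holomorphic_compact_finite_zeros[OF zeta_pre_holomorphic])
    show "open {s. -1 < Re s}" by (rule open_halfspace_Re_gt)
    show "connected {s. -1 < Re s}" by (intro convex_connected convex_halfspace_Re_gt)
    show "?K \<subseteq> {s. -1 < Re s}" by (auto simp: in_cbox_complex_iff)
    show "\<not> zeta_pre constant_on {s. -1 < Re s}"
    proof
      assume "zeta_pre constant_on {s. -1 < Re s}"
      then obtain y where "\<And>s. -1 < Re s \<Longrightarrow> zeta_pre s = y" by (auto simp: constant_on_def)
      from this[of 0] this[of 1] show False by simp
    qed
  qed auto
  moreover have "nontrivial_zeta_zeros_below T \<subseteq> {s \<in> ?K. zeta_pre s = 0}"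
  proof
    fix s assume s: "s \<in> nontrivial_zeta_zeros_below T"
    then have n: "s \<in> nontrivial_zeta_zeros" "\<bar>Im s\<bar> < T" by (auto simp: nontrivial_zeta_zeros_below_def)
    note re = nontrivial_zeta_zeros_Re[OF n(1)]
    have "s \<noteq> 1" "riemann_zeta s = 0" using n by (auto simp: nontrivial_zeta_zeros_def)
    then have "zeta_pre s = 0" using riemann_zeta_eq[of s] re by simp
    then show "s \<in> {s \<in> ?K. zeta_pre s = 0}" using re n by (auto simp: in_cbox_complex_iff)
  qed
  ultimately show ?thesis by (rule finite_subset[rotated])
qed

text \<open>
  This is \<open>zeta (2 - 2 * s) / (4 * pi * sin (pi * s / 2) * zeta (1 - s)) * x powr (- s)\<close>, rewritten
  so that the removable singularity at \<open>s = 0\<close> disappears.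
\<close>
definition zeta_kernel :: "real \<Rightarrow> complex \<Rightarrow> complex" where
  "zeta_kernel x s = zeta_pre (2 - 2 * s) * Gamma (1 + s / 2) * Gamma (1 - s / 2) * of_real x powr (- s)
     / ((2 * s - 1) * (2 * of_real (pi\<^sup>2)) * zeta_pre (1 - s))"

text \<open>The product \<open>Gamma (1 + s / 2) * Gamma (1 - s / 2)\<close> is (pi * s / 2) / sin
  (pi * s / 2), and its factor \<open>s\<close> is the one from the pole of zeta (1 - s) at
  0.\<close>

lemma zeta_kernel_eq:
  assumes s: "-1 < Re s" "Re s < 3/2" "s \<noteq> 0" "s \<noteq> 1/2"
  shows "zeta_kernel x s = riemann_zeta (2 - 2 * s) / (riemann_zeta (1 - s) * (4 * of_real pi * sin (of_real pi * s / 2))) * of_real x powr (- s)"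
proof -
  define S where "S = sin (of_real pi * s / 2)"
  have nn: "s / 2 \<notin> \<int>\<^sub>\<le>\<^sub>0"
  proof
    assume "s / 2 \<in> \<int>\<^sub>\<le>\<^sub>0"
    then obtain n where n: "s / 2 = of_int n" "n \<le> 0" by (auto elim!: nonpos_Ints_cases)
    then have s2: "s = 2 * of_int n" by (simp add: field_simps)
    then have "Re s = 2 * real_of_int n" by simp
    with s(1) n(2) have "n = 0" by linarith
    with s2 s(3) show False by simp
  qed
  have a: "Gamma (1 + s / 2) = s / 2 * Gamma (s / 2)" using Gamma_plus1[OF nn] by (simp add: add.commute)
  have b: "Gamma (s / 2) * Gamma (1 - s / 2) = of_real pi / S"
    using Gamma_reflection_complex[of "s / 2"] by (simp add: S_def)
  have G: "Gamma (1 + s / 2) * Gamma (1 - s / 2) = s / 2 * (of_real pi / S)"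
    unfolding a mult.assoc b ..
  have e: "riemann_zeta (2 - 2 * s) = zeta_pre (2 - 2 * s) / (1 - 2 * s)" "riemann_zeta (1 - s) = zeta_pre (1 - s) / (- s)"
    using riemann_zeta_eq[of "2 - 2 * s"] riemann_zeta_eq[of "1 - s"] s by simp_all
  \<comment> \<open>If \<open>w\<close>, \<open>Z\<close> or \<open>S\<close> vanishes, both sides
    are 0 by the convention for division, so zeros of zeta are covered.\<close>
  have alg: "A * (s / 2 * (p / S)) * X / (w * (2 * (p * p)) * Z) = A / (- w) / (Z / (- s) * (4 * p * S)) * X"
    if "p \<noteq> 0" for A p X w Z :: complex
    using that s(3) by (cases "w = 0 \<or> Z = 0 \<or> S = 0") (auto simp: divide_simps)
  have "zeta_kernel x s = zeta_pre (2 - 2 * s) * (Gamma (1 + s / 2) * Gamma (1 - s / 2)) * of_real x powr (- s)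
     / ((2 * s - 1) * (2 * (of_real pi * of_real pi)) * zeta_pre (1 - s))"
    by (simp add: zeta_kernel_def power2_eq_square mult.assoc)
  also have "\<dots> = zeta_pre (2 - 2 * s) / (- (2 * s - 1)) / (zeta_pre (1 - s) / (- s) * (4 * of_real pi * S)) * of_real x powr (- s)"
    unfolding G by (rule alg) simp
  finally show ?thesis unfolding e S_def by simp
qed

lemma zeta_kernel_eq':
  assumes s: "-1 < Re s" "Re s < 3/2" "2 * s \<notin> \<int>" and x: "x > 0"
  shows "zeta_kernel x s = riemann_zeta (2 * s - 1) * Gamma (2 * s - 1) / (riemann_zeta s * Gamma s * of_real (2 * pi * x) powr s)"
proof -
  have ns: "s \<notin> \<int>" using s(3) by (auto elim!: Ints_cases)
  have n2: "2 * s - 1 \<notin> \<int>\<^sub>\<le>\<^sub>0"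
  proof
    assume "2 * s - 1 \<in> \<int>\<^sub>\<le>\<^sub>0"
    then have "2 * s - 1 \<in> \<int>" by (rule nonpos_Ints_Int)
    then have "2 * s - 1 + 1 \<in> \<int>" by (rule Ints_add) simp
    with s(3) show False by simp
  qed
  have s0: "s \<noteq> 0" using s(3) by auto
  have s1: "s \<noteq> 1/2"
  proof
    assume "s = 1/2"
    then have "2 * s = of_int 1" by (simp only:) simp
    with s(3) show False by (metis Ints_of_int)
  qed
  have p: "complex_of_real (2 * pi * x) powr s = of_real (2 * pi) powr s * of_real x powr s"
    unfolding of_real_mult[of "2 * pi"] using x by (intro powr_times_real) auto
  show ?thesis
    unfolding zeta_kernel_eq[OF s(1,2) s0 s1] zeta_quotient_eq[OF ns n2] p powr_minus_divide by simp
qed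

lemma zeta_kernel_holomorphic:
  assumes "x > 0"
  shows "zeta_kernel x holomorphic_on ({s. -1 < Re s \<and> Re s < 3/2} - insert (1/2) nontrivial_zeta_zeros)"
proof -
  let ?S = "{s. -1 < Re s \<and> Re s < 3/2}"
  have 1: "(\<lambda>s. zeta_pre (2 - 2 * s)) holomorphic_on ?S"
  proof (rule holomorphic_on_compose_gen[of "\<lambda>s. 2 - 2 * s", unfolded o_def, OF _ zeta_pre_holomorphic image_subsetI])
    fix z assume "z \<in> ?S" then show "2 - 2 * z \<in> {s. -1 < Re s}" by simp
  qed (intro holomorphic_intros)
  have 2: "(\<lambda>s. zeta_pre (1 - s)) holomorphic_on ?S"
  proof (rule holomorphic_on_compose_gen[of "\<lambda>s. 1 - s", unfolded o_def, OF _ zeta_pre_holomorphic image_subsetI])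
    fix z assume "z \<in> ?S" then show "1 - z \<in> {s. -1 < Re s}" by simp
  qed (intro holomorphic_intros)
  have n: "1 + s / 2 \<notin> \<int>\<^sub>\<le>\<^sub>0" "1 - s / 2 \<notin> \<int>\<^sub>\<le>\<^sub>0" if "s \<in> ?S" for s
    using that nonpos_Ints_Re_le_0[of "1 + s / 2"] nonpos_Ints_Re_le_0[of "1 - s / 2"] by auto
  show ?thesis
    unfolding zeta_kernel_def
    by (intro holomorphic_intros holomorphic_on_subset[OF 1] holomorphic_on_subset[OF 2])
       (use assms n zeta_pre_reflected_zero_iff in \<open>auto simp: field_simps\<close>)
qed

text \<open>The simple pole comes from zeta (2 - 2 * s), visible as the factor
  \<open>2 * s - 1\<close>. The square root of 2 enters through
  \<open>Gamma (1 + 1/4) * Gamma (1 - 1/4)\<close>, which is (pi / 4) / sin (pi / 4).\<close>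

lemma residue_zeta_kernel_half:
  assumes x: "x > 0"
  shows "residue (zeta_kernel x) (1/2) = - 1 / (of_real (4 * pi * sqrt 2 * sqrt x) * riemann_zeta (1/2))"
proof -
  define h where "h s = zeta_pre (2 - 2 * s) * Gamma (1 + s / 2) * Gamma (1 - s / 2) * of_real x powr (- s) / (4 * of_real (pi\<^sup>2) * zeta_pre (1 - s))" for s
  have "((\<lambda>s. h s) \<longlongrightarrow> h (1/2)) (at (1/2))"
  proof -
    have c1: "isCont (\<lambda>s. zeta_pre (2 - 2 * s)) (1/2)" "isCont (\<lambda>s. zeta_pre (1 - s)) (1/2)"
    proof -
      have "isCont zeta_pre z" if "Re z > -1" for z
        using zeta_pre_holomorphic open_halfspace_Re_gt that
        by (metis continuous_on_eq_continuous_at holomorphic_on_imp_continuous_on mem_Collect_eq)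
      then show "isCont (\<lambda>s. zeta_pre (2 - 2 * s)) (1/2)" "isCont (\<lambda>s. zeta_pre (1 - s)) (1/2)"
        by (auto intro!: continuous_at_compose[of "1/2" _ zeta_pre, unfolded o_def] continuous_intros)
    qed
    have n: "1 + (1/2) / 2 \<notin> (\<int>\<^sub>\<le>\<^sub>0 :: complex set)" "1 - (1/2) / 2 \<notin> (\<int>\<^sub>\<le>\<^sub>0 :: complex set)"
      using nonpos_Ints_Re_le_0[of "1 + (1/2) / 2"] nonpos_Ints_Re_le_0[of "1 - (1/2) / 2"] by auto
    have "isCont h (1/2)"
      unfolding h_def using zeta_pre_half x n by (intro continuous_intros c1) (auto simp: pi_neq_zero)
    then show ?thesis by (simp add: isCont_def)
  qed
  moreover have "zeta_kernel x s * (s - 1/2) = h s" if "s \<noteq> 1/2" for s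
  proof -
    have "a / ((2 * s - 1) * (2 * p) * z) * (s - 1/2) = a / (4 * p * z)" for a p z :: complex
    proof -
      have e: "2 * s - 1 = 2 * (s - 1/2)" by (simp add: algebra_simps)
      have "a / ((2 * w) * (2 * p) * z) * w = a / (4 * p * z)" if "w \<noteq> 0" for w
        using that by (cases "p = 0 \<or> z = 0") auto
      from this[of "s - 1/2"] show ?thesis unfolding e using \<open>s \<noteq> 1/2\<close> by simp
    qed
    then show ?thesis unfolding zeta_kernel_def h_def .
  qed
  ultimately have lim: "((\<lambda>s. zeta_kernel x s * (s - 1/2)) \<longlongrightarrow> h (1/2)) (at (1/2))"
    by (subst tendsto_cong[where g = h]) (auto simp: eventually_at_filter)
  have nt: "1/2 \<notin> nontrivial_zeta_zeros" using zeta_pre_half riemann_zeta_half_eq by (auto simp: nontrivial_zeta_zeros_def)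
  \<comment> \<open>Bounding the height leaves only finitely many zeros to remove, so the set stays
    open.\<close>
  define V where "V = {s. -1 < Re s \<and> Re s < 3/2} \<inter> {s. \<bar>Im s\<bar> < 1} - nontrivial_zeta_zeros_below 1"
  have V: "open V"
  proof -
    have "{s. -1 < Re s \<and> Re s < 3/2} \<inter> {s. \<bar>Im s\<bar> < 1} = box (Complex (-1) (-1)) (Complex (3/2) 1)"
      by (auto simp: in_box_complex_iff)
    then show ?thesis unfolding V_def
      by (metis finite_imp_closed finite_nontrivial_zeta_zeros_below open_Diff open_box)
  qed
  have "residue (zeta_kernel x) (1/2) = h (1/2)"
  proof (rule residue_simple'[OF V _ _ lim])
    show "1/2 \<in> V" using nt by (auto simp: V_def nontrivial_zeta_zeros_below_def)
    show "zeta_kernel x holomorphic_on V - {1/2}"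
      by (rule holomorphic_on_subset[OF zeta_kernel_holomorphic[OF x]]) (auto simp: V_def nontrivial_zeta_zeros_below_def)
  qed
  also have "h (1/2) = - 1 / (of_real (4 * pi * sqrt 2 * sqrt x) * riemann_zeta (1/2))"
  proof -
    have a: "Gamma (1 + 1/4) = 1/4 * Gamma (1/4 :: complex)"
      using Gamma_plus1[of "1/4 :: complex"] nonpos_Ints_Re_le_0[of "1/4"] by (auto simp: add.commute)
    have b: "Gamma (1/4) * Gamma (1 - 1/4) = complex_of_real pi / sin (of_real pi * (1/4))"
      by (rule Gamma_reflection_complex)
    have c: "sin (of_real pi * (1/4)) = complex_of_real (sqrt 2 / 2)"
      using sin_45 by (metis mult.right_neutral of_real_divide of_real_mult of_real_numeral sin_of_real times_divide_eq_right)
    have G: "Gamma (1 + 1/4) * Gamma (1 - 1/4) = 1/4 * (complex_of_real pi / of_real (sqrt 2 / 2))"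
      unfolding a mult.assoc b c ..
    have px: "complex_of_real x powr (- (1/2)) = 1 / of_real (sqrt x)"
    proof -
      have "complex_of_real x powr (- (1/2)) = 1 / (complex_of_real x powr (1/2))" by (rule powr_minus_divide)
      also have "complex_of_real x powr (1/2) = of_real (x powr (1/2))" using powr_of_real[of x "1/2"] x by simp
      also have "x powr (1/2) = sqrt x" using powr_half_sqrt[of x] x by simp
      finally show ?thesis .
    qed
    have "h (1/2) = zeta_pre 1 * (Gamma (1 + 1/4) * Gamma (1 - 1/4)) * (of_real x powr (- (1/2))) / (4 * of_real (pi\<^sup>2) * zeta_pre (1/2))"
      by (simp add: h_def mult.assoc)
    also have "\<dots> = 1/4 * (complex_of_real pi / of_real (sqrt 2 / 2)) * (1 / of_real (sqrt x)) / (4 * of_real (pi\<^sup>2) * zeta_pre (1/2))"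
      unfolding G px by simp
    also have "\<dots> = - 1 / (of_real (4 * pi * sqrt 2 * sqrt x) * riemann_zeta (1/2))"
    proof -
      have alg: "1/4 * (p / (q / 2)) * (1 / y) / (4 * (p * p) * z) = - 1 / ((4 * p * q * y) * (- 2 * z))"
        if "p \<noteq> 0" "q \<noteq> 0" "y \<noteq> 0" "z \<noteq> 0" for p q y z :: complex
        using that by (simp add: field_simps)
      show ?thesis unfolding riemann_zeta_half_eq
        using alg[of "of_real pi" "of_real (sqrt 2)" "of_real (sqrt x)" "zeta_pre (1/2)"] zeta_pre_half x
        by (simp add: power2_eq_square)
    qed
    finally show ?thesis .
  qed
  finally show ?thesis .
qed

text \<open>Only 0, 1/2 and 1 would be possible in the critical strip, and there zeta is known to be
  nonzero or the point is excluded. Around a zero the first form of the kernel is therefore free of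
  poles of Gamma.\<close>

lemma nontrivial_zero_not_half_integer:
  assumes "\<rho> \<in> nontrivial_zeta_zeros" shows "2 * \<rho> \<notin> \<int>"
proof
  assume "2 * \<rho> \<in> \<int>"
  then obtain n :: int where n: "2 * \<rho> = of_int n" by (auto elim: Ints_cases)
  then have "2 * Re \<rho> = of_int n" by (metis Re_complex_of_real complex_Re_of_int mult_2 plus_complex.simps(1))
  then have "n = 0 \<or> n = 1 \<or> n = 2" using nontrivial_zeta_zeros_Re[OF assms] by linarith
  moreover have "\<rho> = of_int n / 2" using n by (simp add: field_simps)
  ultimately have "\<rho> = 0 \<or> \<rho> = 1/2 \<or> \<rho> = 1" by auto
  moreover have "riemann_zeta (1/2) \<noteq> 0" "riemann_zeta 0 \<noteq> 0"
    unfolding riemann_zeta_half_eq riemann_zeta_0 using zeta_pre_half by auto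
  moreover have "riemann_zeta \<rho> = 0" "\<rho> \<noteq> 1" using assms by (auto simp: nontrivial_zeta_zeros_def)
  ultimately show False by metis
qed

text \<open>Near the zero the kernel is \<open>N s / riemann_zeta s\<close> with \<open>N\<close>
  holomorphic. Simplicity gives zeta the form \<open>g w * (w - \<rho>)\<close>, and the nonzero
  value of \<open>g\<close> at \<open>\<rho>\<close> is the derivative of zeta.\<close>

lemma residue_zeta_kernel_zero:
  assumes x: "x > 0" and \<rho>: "\<rho> \<in> nontrivial_zeta_zeros" and simple: "zorder riemann_zeta \<rho> = 1"
  shows "residue (zeta_kernel x) \<rho> =
     riemann_zeta (2 * \<rho> - 1) * Gamma (2 * \<rho> - 1) / (deriv riemann_zeta \<rho> * Gamma \<rho> * of_real (2 * pi * x) powr \<rho>)"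
proof -
  have z: "riemann_zeta \<rho> = 0" "\<rho> \<noteq> 1" using \<rho> by (auto simp: nontrivial_zeta_zeros_def)
  note re = nontrivial_zeta_zeros_Re[OF \<rho>]
  define D where "D = {s. 2 * s \<notin> (\<int> :: complex set)} \<inter> {s. -1 < Re s} \<inter> {s. Re s < 3/2}"
  have "open D"
  proof -
    have "closed ((\<lambda>s. 2 * s) -` (\<int> :: complex set))"
      by (intro continuous_closed_vimage closed_Ints continuous_intros)
    then have "open (- ((\<lambda>s. 2 * s) -` (\<int> :: complex set)))" by (rule open_Compl)
    moreover have "- ((\<lambda>s. 2 * s) -` (\<int> :: complex set)) = {s. 2 * s \<notin> \<int>}" by auto
    ultimately show ?thesis unfolding D_def
      by (intro open_Int open_halfspace_Re_gt open_halfspace_Re_lt) simp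
  qed
  moreover have "\<rho> \<in> D" using re nontrivial_zero_not_half_integer[OF \<rho>] by (auto simp: D_def)
  ultimately obtain r where r: "r > 0" "ball \<rho> r \<subseteq> D" by (meson openE)
  define N where "N s = riemann_zeta (2 * s - 1) * Gamma (2 * s - 1) / (Gamma s * of_real (2 * pi * x) powr s)" for s
  have D1: "s \<notin> \<int>" "2 * s - 1 \<notin> \<int>" if "s \<in> D" for s
  proof -
    show "s \<notin> \<int>" using that by (auto simp: D_def elim!: Ints_cases)
    show "2 * s - 1 \<notin> \<int>" using that Ints_add[of "2 * s - 1" 1] by (auto simp: D_def)
  qed
  have hN: "N holomorphic_on ball \<rho> r"
  proof -
    have "(\<lambda>s. riemann_zeta (2 * s - 1)) holomorphic_on ball \<rho> r"
    proof (rule holomorphic_on_compose_gen[of "\<lambda>s. 2 * s - 1", unfolded o_def, OF _ riemann_zeta_holomorphic image_subsetI])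
      fix s assume "s \<in> ball \<rho> r"
      then show "2 * s - 1 \<in> - {1}" using D1(2)[of s] r by auto
    qed (intro holomorphic_intros)
    moreover have "Gamma s \<noteq> 0" "s \<notin> \<int>\<^sub>\<le>\<^sub>0" "2 * s - 1 \<notin> \<int>\<^sub>\<le>\<^sub>0" if "s \<in> ball \<rho> r" for s
    proof -
      have "s \<in> D" using that r by auto
      then show "Gamma s \<noteq> 0" "s \<notin> \<int>\<^sub>\<le>\<^sub>0" "2 * s - 1 \<notin> \<int>\<^sub>\<le>\<^sub>0"
        using D1[of s] nonpos_Ints_Int[of s] nonpos_Ints_Int[of "2 * s - 1"] by (auto simp: Gamma_eq_zero_iff)
    qed
    ultimately show ?thesis unfolding N_def using x
      by (intro holomorphic_intros) auto
  qed
  define g0 where "g0 = zor_poly riemann_zeta \<rho>"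
  have "\<exists>e>0. g0 holomorphic_on cball \<rho> e \<and>
       (\<forall>w\<in>cball \<rho> e. riemann_zeta w = g0 w * (w - \<rho>) \<and> g0 w \<noteq> 0)"
  proof -
    have "open (- {1 :: complex})" by auto
    moreover have "\<exists>w\<in>- {1}. riemann_zeta w \<noteq> 0" using riemann_zeta_0 by (intro bexI[of _ 0]) auto
    moreover have "\<rho> \<in> - {1}" using z by simp
    ultimately have "\<exists>e>0. cball \<rho> e \<subseteq> - {1} \<and> g0 holomorphic_on cball \<rho> e \<and>
       (\<forall>w\<in>cball \<rho> e. riemann_zeta w = g0 w * (w - \<rho>) ^ nat (zorder riemann_zeta \<rho>) \<and> g0 w \<noteq> 0)"
      unfolding g0_def using zorder_exist_zero[OF riemann_zeta_holomorphic _ connected_minus_1] by blast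
    then show ?thesis unfolding simple by auto
  qed
    then obtain g e where g: "e > 0" "g holomorphic_on cball \<rho> e"
      "\<And>w. w \<in> cball \<rho> e \<Longrightarrow> riemann_zeta w = g w * (w - \<rho>)" "\<And>w. w \<in> cball \<rho> e \<Longrightarrow> g w \<noteq> 0"
    by blast
    have "(g has_field_derivative deriv g \<rho>) (at \<rho>)"
      by (rule holomorphic_derivI[of g "ball \<rho> e"]) (use g in \<open>auto intro: holomorphic_on_subset\<close>)
    then have "((\<lambda>w. g w * (w - \<rho>)) has_field_derivative g \<rho>) (at \<rho>)"
      by (auto intro!: derivative_eq_intros)
    then have "(riemann_zeta has_field_derivative g \<rho>) (at \<rho>)"
      by (rule has_field_derivative_transform_within_open[of _ _ _ "ball \<rho> e"]) (use g in auto)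
    then have dg: "deriv riemann_zeta \<rho> = g \<rho>" by (rule DERIV_imp_deriv)
  define B where "B = ball \<rho> (min r e)"
  have B: "open B" "\<rho> \<in> B" "B \<subseteq> ball \<rho> r" "B \<subseteq> cball \<rho> e" using r g by (auto simp: B_def)
  have "residue (zeta_kernel x) \<rho> = residue (\<lambda>s. N s / g s / (s - \<rho>)) \<rho>"
  proof (rule residue_cong)
    have "\<forall>\<^sub>F s in at \<rho>. s \<in> B" using B by (intro eventually_at_in_open') auto
    then show "\<forall>\<^sub>F s in at \<rho>. zeta_kernel x s = N s / g s / (s - \<rho>)"
    proof eventually_elim
      case (elim s)
      then have s: "s \<in> D" "s \<in> cball \<rho> e" using r B by auto
      then have "zeta_kernel x s = N s / riemann_zeta s"
        using x by (subst zeta_kernel_eq') (auto simp: D_def N_def)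
      then show ?case using g(3)[OF s(2)] by simp
    qed
  qed auto
  also have "\<dots> = N \<rho> / g \<rho>"
  proof (rule residue_simple[OF B(1,2)])
    show "(\<lambda>s. N s / g s) holomorphic_on B"
      by (intro holomorphic_intros holomorphic_on_subset[OF hN] holomorphic_on_subset[OF g(2)])
         (use B g in auto)
  qed
  also have "\<dots> = N \<rho> / deriv riemann_zeta \<rho>" unfolding dg ..
  finally show ?thesis by (simp add: N_def mult.commute mult.left_commute)
qed

subsection \<open>Vertical lines\<close>

text \<open>The majorant that justifies termwise integration also yields the summability claims of
  the theorem.\<close>

lemma summable_norm_integrals:
  fixes f :: "nat \<Rightarrow> 'a \<Rightarrow> 'b :: {banach, second_countable_topology}"
  assumes f: "\<And>n. has_bochner_integral M (f n) (I n)"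
    and J: "\<And>n. (LINT x|M. norm (f n x)) \<le> J n" "summable J"
  shows "summable (\<lambda>n. norm (I n))"
proof (rule summable_comparison_test'[OF J(2)])
  fix n
  have "norm (I n) \<le> (LINT x|M. norm (f n x))"
    using f[of n] integral_norm_bound[of M "f n"] by (simp add: has_bochner_integral_iff)
  with J(1)[of n] show "norm (norm (I n)) \<le> J n" by simp
qed

lemma nat_powr_exp_ln: "n > 0 \<Longrightarrow> of_nat n powr s = exp (s * complex_of_real (ln (real n)))"
  by (simp add: powr_def Ln_of_nat)

lemma of_real_powr_exp_ln: "x > 0 \<Longrightarrow> of_real x powr s = exp (s * complex_of_real (ln x))"
  by (simp add: powr_def Ln_of_real)

lemma has_sum_greaterThan_0_imp_sums:
  "(f has_sum S) {0<..} \<Longrightarrow> (\<lambda>n. f (Suc n)) sums S"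
  by (rule has_sum_imp_sums) (simp add: has_sum_reindex_bij_betw[OF bij_betw_Suc_greaterThan_0])

lemma zeta_kernel_left:
  assumes x: "x > 0"
  shows "summable (\<lambda>n. real_of_int (liouville (Suc n)) / (real (Suc n) * (x\<^sup>2 + (real (Suc n))\<^sup>2)))"
    and "has_bochner_integral lborel (\<lambda>t. zeta_kernel x (Complex (-1/2) t))
      (of_real (- (x\<^sup>2 / pi) * (\<Sum>n. real_of_int (liouville (Suc n)) / (real (Suc n) * (x\<^sup>2 + (real (Suc n))\<^sup>2)))))"
proof -
  define N where "N n = real (Suc n)" for n
  have N: "N n > 0" for n by (simp add: N_def)
  define a where "a n = ln (x / N n)" for n
  define \<phi> where "\<phi> t = of_real pi / (2 * sin (of_real pi * Complex (3/2) t / 2))" for t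
  \<comment> \<open>The sign and the square come from the shift by 2; \<open>2 * pi\<^sup>2\<close>
    is the ratio between the factor \<open>pi / 2\<close> in \<open>\<phi>\<close> and the factor 1
    / (4 * pi) in the kernel.\<close>
  define q where "q n = - (real_of_int (liouville (Suc n)) / N n) * (x / N n)\<^sup>2 / (2 * pi\<^sup>2)" for n
  define f where "f n t = complex_of_real (q n) * (exp (- Complex (3/2) t * of_real (a n)) * \<phi> t)" for n t
  define L where "L n = real_of_int (liouville (Suc n)) / (real (Suc n) * (x\<^sup>2 + (real (Suc n))\<^sup>2))" for n
  have ea: "exp (2 * a n) = (x / N n)\<^sup>2" for n
    using x N[of n] by (simp add: a_def exp_double)
  have \<phi>int: "integrable lborel \<phi>" unfolding \<phi>_def by (rule logistic_mellin_inversion(2)) auto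
  have f_int: "has_bochner_integral lborel (f n) (of_real (- (x\<^sup>2 / pi) * L n))" for n
  proof -
    have "has_bochner_integral lborel (f n) (complex_of_real (q n) * of_real (2 * pi / (1 + exp (2 * a n))))"
      unfolding f_def \<phi>_def by (intro has_bochner_integral_mult_right logistic_mellin_inversion(1)) auto
    also have "complex_of_real (q n) * of_real (2 * pi / (1 + exp (2 * a n))) = of_real (q n * (2 * pi / (1 + (x / N n)\<^sup>2)))"
      by (simp add: ea)
    also have "q n * (2 * pi / (1 + (x / N n)\<^sup>2)) = - (x\<^sup>2 / pi) * L n"
    proof -
      have e: "1 + (x / N n)\<^sup>2 = (x\<^sup>2 + (N n)\<^sup>2) / (N n)\<^sup>2" using N[of n] by (simp add: field_simps)
      have alg: "- (l / m) * (x / m)\<^sup>2 / (2 * p\<^sup>2) * (2 * p / (y / m\<^sup>2)) = - (x\<^sup>2 / p) * (l / (m * y))"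
        if "m \<noteq> 0" "p \<noteq> 0" for l m p y :: real
        using that by (cases "y = 0") (simp_all add: power2_eq_square mult_ac)
      show ?thesis unfolding q_def L_def e N_def[symmetric] using N[of n] by (intro alg) auto
    qed
    finally show ?thesis .
  qed
  define C where "C = (LINT t|lborel. norm (\<phi> t))"
  define J where "J n = x powr (1/2) / (2 * pi\<^sup>2) * C * real (Suc n) powr (-3/2)" for n
  have q_abs: "\<bar>q n\<bar> * exp (- (3/2) * a n) = x powr (1/2) / (2 * pi\<^sup>2) * real (Suc n) powr (-3/2)" for n
  proof -
    have l1: "\<bar>real_of_int (liouville (Suc n))\<bar> = 1" by (simp add: liouville_def power_abs)
    have "\<bar>q n\<bar> = 1 / N n * exp (2 * a n) / (2 * pi\<^sup>2)"
      unfolding q_def ea abs_mult abs_divide abs_minus_cancel l1 using N[of n] by simp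
    then have "\<bar>q n\<bar> * exp (- (3/2) * a n) = 1 / (2 * pi\<^sup>2) * (1 / N n * exp (1/2 * a n))"
      by (simp add: field_simps flip: exp_add)
    also have "1 / N n = exp (- ln (N n))" using N[of n] by (simp add: exp_minus divide_inverse)
    also have "exp (- ln (N n)) * exp (1/2 * a n) = exp (1/2 * ln x) * exp (-3/2 * ln (N n))"
      using x N[of n] by (simp add: a_def ln_div algebra_simps flip: exp_add)
    also have "\<dots> = x powr (1/2) * real (Suc n) powr (-3/2)"
      using x N[of n] by (simp add: powr_def N_def)
    finally show ?thesis by simp
  qed
  have norm_f: "norm (f n t) = x powr (1/2) / (2 * pi\<^sup>2) * norm (\<phi> t) * real (Suc n) powr (-3/2)" for n t
  proof -
    have "norm (f n t) = (\<bar>q n\<bar> * exp (- (3/2) * a n)) * norm (\<phi> t)"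
      by (simp add: f_def norm_mult)
    then show ?thesis unfolding q_abs by simp
  qed
  have J1: "(LINT t|lborel. norm (f n t)) \<le> J n" for n
    unfolding norm_f J_def C_def by simp
  have J2: "summable J" unfolding J_def by (intro summable_mult summable_Suc_powr) auto
  have "summable (\<lambda>n. norm (complex_of_real (- (x\<^sup>2 / pi) * L n)))"
    by (rule summable_norm_integrals[OF f_int J1 J2])
  then have "summable (\<lambda>n. - (x\<^sup>2 / pi) * L n)" by (simp only: norm_of_real) (rule summable_rabs_cancel)
  then show sm: "summable L" using x unfolding summable_cmult_iff by simp
  have sums: "(\<lambda>n. f n t) sums zeta_kernel x (Complex (-1/2) t)" for t
  proof -
    define s where "s = Complex (-1/2) t"
    have s: "Re s = -1/2" by (simp add: s_def)
    have z: "Complex (3/2) t = s + 2" by (simp add: s_def complex_eq_iff)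
    define W where "W = 1 / (4 * of_real pi * sin (of_real pi * s / 2)) * of_real x powr (- s)"
    have "(\<lambda>n. of_int (liouville (Suc n)) * of_nat (Suc n) powr (- (1 - s))) sums (riemann_zeta (2 * (1 - s)) / riemann_zeta (1 - s))"
      by (rule has_sum_greaterThan_0_imp_sums[OF liouville_series]) (use s in simp)
    then have "(\<lambda>n. of_int (liouville (Suc n)) * of_nat (Suc n) powr (- (1 - s)) * W) sums (riemann_zeta (2 * (1 - s)) / riemann_zeta (1 - s) * W)"
      by (rule sums_mult2)
    moreover have "riemann_zeta (2 * (1 - s)) / riemann_zeta (1 - s) * W = zeta_kernel x s"
    proof -
      have "s \<noteq> 0" using s by auto
      moreover have "s \<noteq> 1/2"
      proof
        assume "s = 1/2"
        then have "Re s = Re (1/2)" by (rule arg_cong)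
        with s show False by simp
      qed
      ultimately have "zeta_kernel x s = riemann_zeta (2 - 2 * s) / (riemann_zeta (1 - s) * (4 * of_real pi * sin (of_real pi * s / 2))) * of_real x powr (- s)"
        using s by (intro zeta_kernel_eq) auto
      then show ?thesis by (simp add: W_def right_diff_distrib)
    qed
    moreover have "of_int (liouville (Suc n)) * of_nat (Suc n) powr (- (1 - s)) * W = f n t" for n
    proof -
      have sn: "sin (of_real pi * Complex (3/2) t / 2) = - sin (of_real pi * s / 2)"
      proof -
        have "of_real pi * Complex (3/2) t / 2 = of_real pi * s / 2 + of_real pi" unfolding z by (simp add: field_simps)
        then show ?thesis by (simp only: sin_add sin_of_real_pi cos_of_real_pi) simp
      qed
      have "of_real (1 / N n * (x / N n)\<^sup>2) * exp (- Complex (3/2) t * of_real (a n)) = of_nat (Suc n) powr (- (1 - s)) * of_real x powr (- s)"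
      proof -
        have e: "1 / N n * (x / N n)\<^sup>2 = exp (- ln (N n) + 2 * a n)"
          unfolding exp_add ea exp_minus using N[of n] by (simp add: divide_inverse)
        have "of_real (1 / N n * (x / N n)\<^sup>2) * exp (- Complex (3/2) t * of_real (a n)) =
           exp (of_real (- ln (N n) + 2 * a n) + - Complex (3/2) t * of_real (a n))"
          unfolding e exp_add[of "complex_of_real (- ln (N n) + 2 * a n)"] exp_of_real ..
        also have "of_real (- ln (N n) + 2 * a n) + - Complex (3/2) t * of_real (a n) = - (1 - s) * of_real (ln (N n)) + - s * of_real (ln x)"
          unfolding z a_def using x N[of n] by (simp add: ln_div algebra_simps)
        also have "exp \<dots> = of_nat (Suc n) powr (- (1 - s)) * of_real x powr (- s)"
          unfolding nat_powr_exp_ln[OF zero_less_Suc] of_real_powr_exp_ln[OF x] exp_add N_def ..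
        finally show ?thesis .
      qed
      moreover have "f n t = of_int (liouville (Suc n)) * (of_real (1 / N n * (x / N n)\<^sup>2) * exp (- Complex (3/2) t * of_real (a n))) / (4 * of_real pi * sin (of_real pi * s / 2))"
        unfolding f_def q_def \<phi>_def sn by (simp add: power2_eq_square mult_ac)
      ultimately show ?thesis by (simp add: W_def)
    qed
    ultimately show ?thesis by (simp only: s_def)
  qed
  have sn: "summable (\<lambda>n. norm (f n t))" for t
    unfolding norm_f by (intro summable_mult summable_Suc_powr) auto
  have "has_bochner_integral lborel (\<lambda>t. zeta_kernel x (Complex (-1/2) t)) (\<Sum>n. of_real (- (x\<^sup>2 / pi) * L n))"
    by (rule has_bochner_integral_suminf[OF f_int J1 J2 sn sums])
  also have "(\<Sum>n. complex_of_real (- (x\<^sup>2 / pi) * L n)) = of_real (- (x\<^sup>2 / pi) * suminf L)"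
    by (rule sums_unique[symmetric]) (rule sums_of_real[OF sums_mult[OF summable_sums[OF sm]]])
  finally show "has_bochner_integral lborel (\<lambda>t. zeta_kernel x (Complex (-1/2) t)) (of_real (- (x\<^sup>2 / pi) * suminf L))" .
qed

lemma zeta_kernel_right:
  assumes x: "x > 0"
  shows "summable (\<lambda>n. real_of_int (c_coeff (Suc n)) / sqrt (2 * real (Suc n)) * exp (- pi * real (Suc n) * x / 2))"
    and "has_bochner_integral lborel (\<lambda>t. zeta_kernel x (Complex (9/8) t))
      (of_real (1 / sqrt x * (\<Sum>n. real_of_int (c_coeff (Suc n)) / sqrt (2 * real (Suc n)) * exp (- pi * real (Suc n) * x / 2))))"
proof -
  define N where "N n = real (Suc n)" for n
  have N: "N n > 0" for n by (simp add: N_def)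
  \<comment> \<open>Collecting the powers with exponent \<open>s\<close> from the Dirichlet series,
    the duplication formula and \<open>2 * pi * x\<close> gives (pi * n * x / 2) powr (-s) / 4. The
    remaining half in \<open>s = (s - 1/2) + 1/2\<close> is the factor
    \<open>exp (- (1/2) * a n)\<close> of \<open>q\<close>.\<close>
  define a where "a n = ln (pi * N n * x / 2)" for n
  have ea: "exp (a n) = pi * N n * x / 2" for n using x N[of n] by (simp add: a_def)
  have ea': "exp (r * a n) = (pi * x / 2) powr r * real (Suc n) powr r" for r n
  proof -
    have "exp (r * a n) = (pi * N n * x / 2) powr r" using x N[of n] unfolding a_def powr_def by simp
    also have "pi * N n * x / 2 = (pi * x / 2) * N n" by simp
    also have "((pi * x / 2) * N n) powr r = (pi * x / 2) powr r * N n powr r" using x N[of n] by (intro powr_mult)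
    finally show ?thesis by (simp add: N_def)
  qed
  define c where "c n = real_of_int (c_coeff (Suc n))" for n
  define q where "q n = c n / (4 * sqrt pi) * exp (- (1/2) * a n)" for n
  define f where "f n t = complex_of_real (q n) * (exp (- Complex (5/8) t * of_real (a n)) * Gamma (Complex (5/8) t))" for n t
  define L where "L n = real_of_int (c_coeff (Suc n)) / sqrt (2 * real (Suc n)) * exp (- pi * real (Suc n) * x / 2)" for n
  have f_int: "has_bochner_integral lborel (f n) (of_real (1 / sqrt x * L n))" for n
  proof -
    have "has_bochner_integral lborel (f n) (complex_of_real (q n) * of_real (2 * pi * exp (- exp (a n))))"
      unfolding f_def by (intro has_bochner_integral_mult_right Gamma_mellin_inversion(1)) auto
    also have "complex_of_real (q n) * of_real (2 * pi * exp (- exp (a n))) = of_real (q n * (2 * pi * exp (- exp (a n))))"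
      by simp
    also have "q n * (2 * pi * exp (- exp (a n))) = 1 / sqrt x * L n"
    proof -
      have "exp (- (1/2) * a n) = 1 / sqrt (exp (a n))"
      proof -
        have "exp (a n / 2) * exp (a n / 2) = exp (a n)" by (simp flip: exp_add)
        then have "sqrt (exp (a n)) = exp (a n / 2)"
          by (intro real_sqrt_unique) (simp_all only: power2_eq_square exp_ge_zero)
        moreover have "exp (- (1/2) * a n) = inverse (exp (a n / 2))" unfolding exp_minus[symmetric] by simp
        ultimately show ?thesis by (simp only: inverse_eq_divide)
      qed
      also have "\<dots> = sqrt 2 / (sqrt pi * sqrt (N n) * sqrt x)"
        unfolding ea by (simp add: real_sqrt_mult real_sqrt_divide)
      finally have q: "q n = c n / (4 * sqrt pi) * (sqrt 2 / (sqrt pi * sqrt (N n) * sqrt x))" by (simp add: q_def)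
      have s2: "sqrt (2 * real (Suc n)) = sqrt 2 * sqrt (N n)" unfolding N_def by (rule real_sqrt_mult)
      have ex: "exp (- exp (a n)) = exp (- pi * real (Suc n) * x / 2)" unfolding ea N_def by simp
      have alg: "cc / (4 * p) * (s / (p * m * y)) * (2 * (p * p) * E) = 1 / y * (cc / (s * m) * E)"
        if "p \<noteq> 0" "m \<noteq> 0" "y \<noteq> 0" "s \<noteq> 0" "s * s = 2" for cc p s m y E :: real
      proof -
        have "cc / (4 * p) * (s / (p * m * y)) * (2 * (p * p) * E) = cc * s * E / (2 * m * y)"
          using that(1-4) by (simp add: field_simps)
        also have "\<dots> = cc * s * E / (s * s * m * y)" by (simp only: that(5))
        also have "\<dots> = 1 / y * (cc / (s * m) * E)" using that(1-4) by (simp add: field_simps)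
        finally show ?thesis .
      qed
      have m: "q n * (2 * (sqrt pi * sqrt pi) * exp (- exp (a n))) = 1 / sqrt x * (c n / (sqrt 2 * sqrt (N n)) * exp (- exp (a n)))"
        unfolding q using x N[of n] by (intro alg) auto
      have sp: "sqrt pi * sqrt pi = pi" by simp
      show ?thesis using m[unfolded sp ex] unfolding L_def s2 c_def ex .
    qed
    finally show ?thesis .
  qed
  have q_abs: "\<bar>q n\<bar> * exp (- (5/8) * a n) = (pi * x / 2) powr (-9/8) / (4 * sqrt pi) * (\<bar>c n\<bar> * real (Suc n) powr (-9/8))" for n
  proof -
    have "\<bar>q n\<bar> * exp (- (5/8) * a n) = \<bar>c n\<bar> / (4 * sqrt pi) * exp ((-9/8) * a n)"
      by (simp add: q_def abs_mult abs_divide flip: exp_add)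
    then show ?thesis unfolding ea' by simp
  qed
  have norm_f: "norm (f n t) = (pi * x / 2) powr (-9/8) / (4 * sqrt pi) * norm (Gamma (Complex (5/8) t)) * (\<bar>c n\<bar> * real (Suc n) powr (-9/8))" for n t
  proof -
    have "norm (f n t) = (\<bar>q n\<bar> * exp (- (5/8) * a n)) * norm (Gamma (Complex (5/8) t))"
      by (simp add: f_def norm_mult)
    then show ?thesis unfolding q_abs by simp
  qed
  have csum: "summable (\<lambda>n. \<bar>c n\<bar> * real (Suc n) powr (-9/8))"
  proof -
    have "(\<lambda>n. norm (of_int (c_coeff n) * of_nat n powr (- (9/8)) :: complex)) summable_on {0<..}"
      by (rule c_coeff_series(2)) simp
    then have "(\<lambda>n. norm (of_int (c_coeff (Suc n)) * of_nat (Suc n) powr (- (9/8)) :: complex)) summable_on UNIV"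
      by (subst summable_on_reindex_bij_betw[OF bij_betw_Suc_greaterThan_0])
    then have "summable (\<lambda>n. norm (of_int (c_coeff (Suc n)) * of_nat (Suc n) powr (- (9/8)) :: complex))"
      by (rule summable_on_imp_summable)
    moreover have "norm (of_int (c_coeff (Suc n)) * of_nat (Suc n) powr (- (9/8)) :: complex) = \<bar>c n\<bar> * real (Suc n) powr (-9/8)" for n
      unfolding norm_mult by (subst norm_nat_powr) (auto simp: c_def)
    ultimately show ?thesis by simp
  qed
  define C where "C = (LINT t|lborel. norm (Gamma (Complex (5/8) t)))"
  define J where "J n = (pi * x / 2) powr (-9/8) / (4 * sqrt pi) * C * (\<bar>c n\<bar> * real (Suc n) powr (-9/8))" for n
  have J1: "(LINT t|lborel. norm (f n t)) \<le> J n" for n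
    unfolding norm_f J_def C_def by (simp add: mult.assoc)
  have J2: "summable J" unfolding J_def by (intro summable_mult csum)
  have "summable (\<lambda>n. norm (complex_of_real (1 / sqrt x * L n)))"
    by (rule summable_norm_integrals[OF f_int J1 J2])
  then have "summable (\<lambda>n. 1 / sqrt x * L n)" by (simp only: norm_of_real) (rule summable_rabs_cancel)
  then show sm: "summable L" using x unfolding summable_cmult_iff by simp
  have sn: "summable (\<lambda>n. norm (f n t))" for t unfolding norm_f by (intro summable_mult csum)
  have sums: "(\<lambda>n. f n t) sums zeta_kernel x (Complex (9/8) t)" for t
  proof -
    define s where "s = Complex (9/8) t"
    have s: "Re s = 9/8" by (simp add: s_def)
    have z: "Complex (5/8) t = s - 1/2" by (simp add: s_def complex_eq_iff)
    define W where "W = Gamma (2 * s - 1) / (Gamma s * of_real (2 * pi * x) powr s)"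
    have "(\<lambda>n. of_int (c_coeff (Suc n)) * of_nat (Suc n) powr (- s)) sums (riemann_zeta (2 * s - 1) / riemann_zeta s)"
      by (rule has_sum_greaterThan_0_imp_sums[OF c_coeff_series(1)]) (use s in simp)
    then have "(\<lambda>n. of_int (c_coeff (Suc n)) * of_nat (Suc n) powr (- s) * W) sums (riemann_zeta (2 * s - 1) / riemann_zeta s * W)"
      by (rule sums_mult2)
    moreover have "riemann_zeta (2 * s - 1) / riemann_zeta s * W = zeta_kernel x s"
    proof -
      have "2 * s \<notin> \<int>"
      proof
        assume "2 * s \<in> \<int>"
        then obtain k :: int where "2 * s = of_int k" by (auto elim: Ints_cases)
        then have "Re (2 * s) = of_int k" by simp
        then have "real_of_int (4 * k) = real_of_int 9" using s by simp
        then have "4 * k = 9" by (simp only: of_int_eq_iff)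
        then show False by presburger
      qed
      then have "zeta_kernel x s = riemann_zeta (2 * s - 1) * Gamma (2 * s - 1) / (riemann_zeta s * Gamma s * of_real (2 * pi * x) powr s)"
        using s x by (intro zeta_kernel_eq') auto
      then show ?thesis by (simp add: W_def)
    qed
    moreover have "of_int (c_coeff (Suc n)) * of_nat (Suc n) powr (- s) * W = f n t" for n
    proof -
      have n: "s - 1/2 \<notin> \<int>\<^sub>\<le>\<^sub>0" "s \<notin> \<int>\<^sub>\<le>\<^sub>0"
        using nonpos_Ints_Re_le_0[of "s - 1/2"] nonpos_Ints_Re_le_0[of s] s by auto
      have "Gamma (s - 1/2) * Gamma (s - 1/2 + 1/2) = exp ((1 - 2 * (s - 1/2)) * of_real (ln 2)) * of_real (sqrt pi) * Gamma (2 * (s - 1/2))"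
        by (rule Gamma_legendre_duplication) (use n in auto)
      then have "Gamma (s - 1/2) * Gamma s = exp (- ((2 * s - 2) * of_real (ln 2))) * of_real (sqrt pi) * Gamma (2 * s - 1)"
        by (simp add: algebra_simps)
      then have dup: "Gamma (2 * s - 1) / Gamma s = exp ((2 * s - 2) * of_real (ln 2)) / of_real (sqrt pi) * Gamma (s - 1/2)"
      proof -
        have "D / G = exp w / p * A" if "A * G = exp (- w) * p * D" "G \<noteq> 0" "p \<noteq> 0" for A D G p w :: complex
          using that by (simp add: exp_minus field_simps)
        moreover have "Gamma s \<noteq> 0" using n(2) by (simp add: Gamma_eq_zero_iff)
        moreover have "complex_of_real (sqrt pi) \<noteq> 0" by simp
        ultimately show ?thesis using \<open>Gamma (s - 1/2) * Gamma s = _\<close> by blast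
      qed
      have "of_nat (Suc n) powr (- s) * W = of_nat (Suc n) powr (- s) * (Gamma (2 * s - 1) / Gamma s) * of_real (2 * pi * x) powr (- s)"
        unfolding W_def powr_minus_divide by simp
      also have "\<dots> = (exp (- s * of_real (ln (N n))) * exp ((2 * s - 2) * of_real (ln 2)) * exp (- s * of_real (ln (2 * pi * x)))) * (Gamma (s - 1/2) / of_real (sqrt pi))"
        unfolding dup nat_powr_exp_ln[OF zero_less_Suc] using x
        by (subst of_real_powr_exp_ln) (simp_all add: N_def)
      also have "exp (- s * of_real (ln (N n))) * exp ((2 * s - 2) * of_real (ln 2)) * exp (- s * of_real (ln (2 * pi * x))) =
          exp (of_real (- (2 * ln 2)) + (of_real (- (1/2) * a n) + - Complex (5/8) t * of_real (a n)))"
        unfolding z a_def exp_add[symmetric] using x N[of n] by (simp add: ln_div ln_mult algebra_simps)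
      also have "\<dots> = of_real (exp (- (2 * ln 2))) * (of_real (exp (- (1/2) * a n)) * exp (- Complex (5/8) t * of_real (a n)))"
        by (simp only: exp_add exp_of_real)
      also have "exp (- (2 * ln 2)) = (1/4 :: real)" by (simp add: exp_minus exp_double)
      finally have "of_nat (Suc n) powr (- s) * W = of_real (1/4) * (of_real (exp (- (1/2) * a n)) * exp (- Complex (5/8) t * of_real (a n))) * (Gamma (s - 1/2) / of_real (sqrt pi))" .
      then show ?thesis unfolding mult.assoc f_def q_def z[symmetric] c_def by simp
    qed
    ultimately show ?thesis by (simp only: s_def)
  qed
  have "has_bochner_integral lborel (\<lambda>t. zeta_kernel x (Complex (9/8) t)) (\<Sum>n. of_real (1 / sqrt x * L n))"
    by (rule has_bochner_integral_suminf[OF f_int J1 J2 sn sums])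
  also have "(\<Sum>n. complex_of_real (1 / sqrt x * L n)) = of_real (1 / sqrt x * suminf L)"
    by (rule sums_unique[symmetric]) (rule sums_of_real[OF sums_mult[OF summable_sums[OF sm]]])
  finally show "has_bochner_integral lborel (\<lambda>t. zeta_kernel x (Complex (9/8) t)) (of_real (1 / sqrt x * suminf L))" .
qed

subsection \<open>Horizontal lines and the residue theorem\<close>

lemma zeta_term_cnj: "zeta_term n (cnj s) = cnj (zeta_term n s)"
proof -
  have "of_nat (Suc m) powr cnj z = cnj (of_nat (Suc m) powr z)" for m z
    unfolding nat_powr_exp_ln[OF zero_less_Suc] by (simp add: exp_cnj)
  note e = this[of _ "- s"] this[of _ "1 - s"]
  show ?thesis
    unfolding zeta_term_def using e by (simp del: of_nat_Suc)
qed

text \<open>Lower bounds for \<open>zeta_pre\<close> are chosen at positive heights only;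
  conjugation carries them to the lower horizontal side.\<close>

lemma zeta_pre_cnj:
  assumes "Re s > -1" shows "zeta_pre (cnj s) = cnj (zeta_pre s)"
proof -
  have "(\<lambda>n. zeta_term n s) sums (\<Sum>n. zeta_term n s)"
    by (rule summable_sums[OF summable_norm_cancel[OF zeta_term_summable[OF assms]]])
  then have "(\<lambda>n. cnj (zeta_term n s)) sums cnj (\<Sum>n. zeta_term n s)" by (subst sums_cnj)
  then have "(\<Sum>n. zeta_term n (cnj s)) = cnj (\<Sum>n. zeta_term n s)"
    unfolding zeta_term_cnj by (rule sums_unique[symmetric])
  then show ?thesis by (simp add: zeta_pre_def)
qed

lemma norm_sin_ge: "(exp \<bar>Im z\<bar> - 1) / 2 \<le> norm (sin z)"
proof -
  have "sin z = (exp (\<i> * z) - exp (- (\<i> * z))) / (2 * \<i>)" by (rule sin_exp_eq)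
  then have 1: "norm (sin z) = norm (exp (\<i> * z) - exp (- (\<i> * z))) / 2" by (simp add: norm_divide norm_mult)
  have 2: "norm (exp (\<i> * z)) = exp (- Im z)" "norm (exp (- (\<i> * z))) = exp (Im z)" by simp_all
  have "exp \<bar>Im z\<bar> - 1 \<le> norm (exp (\<i> * z) - exp (- (\<i> * z)))"
  proof (cases "Im z \<ge> 0")
    case True
    have "norm (exp (- (\<i> * z))) - norm (exp (\<i> * z)) \<le> norm (exp (\<i> * z) - exp (- (\<i> * z)))"
      using norm_triangle_ineq2[of "exp (- (\<i> * z))" "exp (\<i> * z)"] by (simp add: norm_minus_commute)
    then show ?thesis unfolding 2 using True by simp (smt (verit) exp_le_one_iff)
  next
    case False
    have "norm (exp (\<i> * z)) - norm (exp (- (\<i> * z))) \<le> norm (exp (\<i> * z) - exp (- (\<i> * z)))"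
      by (rule norm_triangle_ineq2)
    then show ?thesis unfolding 2 using False by simp (smt (verit) exp_le_one_iff)
  qed
  then show ?thesis unfolding 1 by simp
qed

text \<open>For \<open>Re s\<close> between -1/2 and 9/8, the real part of \<open>1 - s\<close> runs
  through the interval from -1/8 to 3/2, which is where the lower bound was prepared, and that of
  \<open>2 - 2 * s\<close> is at least -1/4, where the cubic bound holds. The sine provides the
  exponential decay.\<close>

lemma zeta_kernel_horizontal_bound:
  assumes x: "x > 0"
  obtains K H where "K > 0" "\<And>T0. T0 \<ge> 5 \<Longrightarrow> \<exists>T. T0 \<le> T \<and> T \<le> T0 + 1 \<and>
      (\<forall>s. \<bar>Im s\<bar> = T \<longrightarrow> -1/2 \<le> Re s \<longrightarrow> Re s \<le> 9/8 \<longrightarrow>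
         zeta_pre (1 - s) \<noteq> 0 \<and> norm (zeta_kernel x s) \<le> K * H T0)"
    "(H \<longlongrightarrow> 0) at_top"
proof -
  obtain K1 where K1: "K1 > 0" "\<And>T. T \<ge> 5 \<Longrightarrow> \<exists>t. T \<le> t \<and> t \<le> T + 1 \<and>
      (\<forall>s. Im s = t \<longrightarrow> -1/8 \<le> Re s \<longrightarrow> Re s \<le> 3/2 \<longrightarrow>
         zeta_pre_lower K1 T \<le> norm (zeta_pre s))"
    using zeta_pre_lower_bound_heights by metis
  obtain K2 where K2: "K2 > 0" "\<And>s. Re s \<ge> -3/4 \<Longrightarrow> norm (zeta_pre s) \<le> K2 * (1 + norm s) ^ 3"
    using zeta_pre_bound by metis
  define L where "L = zeta_pre_lower K1"
  define H where "H T = (T + 10) ^ 7 * exp (- (pi / 2) * T) / L T" for T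
  have H0: "(H \<longlongrightarrow> 0) at_top"
    unfolding H_def L_def by (rule height_bound_tendsto[OF K1(1)])
  \<comment> \<open>The sum of the two extreme values of \<open>x powr (- Re s)\<close>, which
    covers both \<open>x >= 1\<close> and \<open>x < 1\<close>.\<close>
  define X0 where "X0 = x powr (1/2) + x powr (-9/8)"
  have X0: "X0 > 0" unfolding X0_def using x by (intro add_pos_pos) auto
  \<comment> \<open>The 128 is \<open>4 ^ 3 * 2\<close>, from the bounds \<open>4 * u\<close> under
    the cube and \<open>2 * u\<close> for \<open>norm s\<close>.\<close>
  define K where "K = 128 * K2 * X0"
  have K: "K > 0" using K2 X0 by (simp add: K_def)
  show ?thesis
  proof (rule that[OF K _ H0])
    fix T0 :: real assume T0: "T0 \<ge> 5"
    have L0: "L T0 > 0" unfolding L_def zeta_pre_lower_def Let_def using K1(1) T0 by (intro mult_pos_pos) auto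
    obtain T where T: "T0 \<le> T" "T \<le> T0 + 1" and lower: "\<And>s. Im s = T \<Longrightarrow> -1/8 \<le> Re s \<Longrightarrow> Re s \<le> 3/2 \<Longrightarrow> L T0 \<le> norm (zeta_pre s)"
      using K1(2)[OF T0] unfolding L_def by blast
    show "\<exists>T. T0 \<le> T \<and> T \<le> T0 + 1 \<and>
      (\<forall>s. \<bar>Im s\<bar> = T \<longrightarrow> -1/2 \<le> Re s \<longrightarrow> Re s \<le> 9/8 \<longrightarrow>
         zeta_pre (1 - s) \<noteq> 0 \<and> norm (zeta_kernel x s) \<le> K * H T0)"
    proof (intro exI[of _ T] conjI allI impI T)
      fix s assume s: "\<bar>Im s\<bar> = T" "-1/2 \<le> Re s" "Re s \<le> 9/8"
      \<comment> \<open>The imaginary part of \<open>1 - s\<close> is \<open>- Im s\<close>, so it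
        is the upper side that has to be conjugated to reach height \<open>T\<close>.\<close>
      have low: "L T0 \<le> norm (zeta_pre (1 - s))"
      proof (cases "Im s \<ge> 0")
        case True
        have "zeta_pre (1 - s) = cnj (zeta_pre (cnj (1 - s)))"
          using zeta_pre_cnj[of "cnj (1 - s)"] s by simp
        moreover have "L T0 \<le> norm (zeta_pre (cnj (1 - s)))"
          using s True by (intro lower) auto
        ultimately show ?thesis by simp
      next
        case False
        then show ?thesis using s by (intro lower) auto
      qed
      then show nz: "zeta_pre (1 - s) \<noteq> 0" using L0 by auto
      have "Im s \<noteq> 0" using s(1) T T0 by auto
      then have s0: "s \<noteq> 0" "s \<noteq> 1/2" by (auto simp only: complex_eq_iff) auto
      have eq: "zeta_kernel x s = riemann_zeta (2 - 2 * s) / (riemann_zeta (1 - s) * (4 * of_real pi * sin (of_real pi * s / 2))) * of_real x powr (- s)"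
        using s s0 by (intro zeta_kernel_eq) auto
      have e1: "riemann_zeta (2 - 2 * s) = zeta_pre (2 - 2 * s) / (2 - 2 * s - 1)"
        using s by (intro riemann_zeta_eq) auto
      have e2: "riemann_zeta (1 - s) = zeta_pre (1 - s) / (1 - s - 1)"
        using s by (intro riemann_zeta_eq) auto
      define u where "u = T0 + 10"
      have u: "u \<ge> 15" using T0 by (simp add: u_def)
      have ns: "norm s \<le> 2 * u" using cmod_le[of s] s T T0 by (simp add: u_def)
      have "norm (2 - 2 * s) \<le> \<bar>Re (2 - 2 * s)\<bar> + \<bar>Im (2 - 2 * s)\<bar>" by (rule cmod_le)
      also have "\<dots> \<le> 4 * u - 1" using s T T0 by (simp add: u_def abs_mult)
      finally have "1 + norm (2 - 2 * s) \<le> 4 * u" by simp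
      then have "K2 * (1 + norm (2 - 2 * s)) ^ 3 \<le> K2 * (4 * u) ^ 3"
        using K2(1) by (intro mult_left_mono power_mono) auto
      then have b1: "norm (zeta_pre (2 - 2 * s)) \<le> K2 * (4 * u) ^ 3"
        using K2(2)[of "2 - 2 * s"] s by simp
      have b2: "norm (2 - 2 * s - 1) \<ge> 1"
        using abs_Im_le_cmod[of "2 - 2 * s - 1"] s T T0 by (simp add: abs_mult)
      have b3: "norm (4 * of_real pi * sin (of_real pi * s / 2)) \<ge> exp (pi / 2 * T0)"
      proof -
        have "\<bar>Im (of_real pi * s / 2)\<bar> = pi / 2 * T" using s by (simp add: abs_mult)
        then have "(exp (pi / 2 * T) - 1) / 2 \<le> norm (sin (of_real pi * s / 2))"
          using norm_sin_ge[of "of_real pi * s / 2"] by simp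
        moreover have "exp (pi / 2 * T) \<ge> exp (pi / 2 * T0)" using T by simp
        moreover have "exp (pi / 2 * T0) \<ge> 2"
        proof -
          have "1 + pi / 2 * T0 \<le> exp (pi / 2 * T0)" by (rule exp_ge_add_one_self)
          moreover have "pi / 2 * T0 \<ge> 3 / 2 * 5" using pi_gt3 T0 by (intro mult_mono) auto
          ultimately show ?thesis by linarith
        qed
        moreover have "E0 / 4 \<le> n" if "(E1 - 1) / 2 \<le> n" "E1 \<ge> E0" "E0 \<ge> 2" for E0 E1 n :: real
        proof -
          have "E0 / 4 \<le> (E0 - 1) / 2" using that(3) by (simp add: field_simps)
          also have "\<dots> \<le> (E1 - 1) / 2" using that(2) by (simp add: divide_right_mono)
          finally show ?thesis using that(1) by (rule order.trans)
        qed
        ultimately have "exp (pi / 2 * T0) / 4 \<le> norm (sin (of_real pi * s / 2))" by blast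
        moreover have "norm (4 * of_real pi * sin (of_real pi * s / 2)) = 4 * pi * norm (sin (of_real pi * s / 2))"
          by (simp add: norm_mult)
        moreover have "4 * norm (sin (of_real pi * s / 2)) \<le> 4 * pi * norm (sin (of_real pi * s / 2))"
          using pi_gt3 by (intro mult_right_mono) auto
        ultimately show ?thesis by linarith
      qed
      have b4: "norm (of_real x powr (- s)) \<le> X0"
      proof -
        have "norm (of_real x powr (- s)) = x powr (- Re s)" using x by (simp add: norm_powr_real_powr)
        also have "\<dots> \<le> X0"
        proof (cases "x \<ge> 1")
          case True
          then have "x powr (- Re s) \<le> x powr (1/2)" using s by (intro powr_mono) auto
          moreover have "0 < x powr (-9/8)" using x by simp
          ultimately show ?thesis unfolding X0_def by linarith
        next
          case False
          then have "x powr (- Re s) \<le> x powr (-9/8)" using s x by (intro powr_mono') auto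
          moreover have "0 < x powr (1/2)" using x by simp
          ultimately show ?thesis unfolding X0_def by linarith
        qed
        finally show ?thesis .
      qed
      have "norm (zeta_kernel x s) = norm (zeta_pre (2 - 2 * s)) / norm (2 - 2 * s - 1) *
          (norm s / norm (zeta_pre (1 - s))) / norm (4 * of_real pi * sin (of_real pi * s / 2)) * norm (of_real x powr (- s))"
        unfolding eq e1 e2 norm_mult norm_divide by simp
      also have "\<dots> \<le> (K2 * (4 * u) ^ 3) / 1 * ((2 * u) / L T0) / exp (pi / 2 * T0) * X0"
        using b1 b2 b3 b4 low ns L0 K2(1) X0 u
        by (intro mult_mono frac_le divide_nonneg_nonneg mult_nonneg_nonneg) auto
      also have "\<dots> = K * (u ^ 4 * exp (- (pi / 2) * T0) / L T0)"
        by (simp add: K_def exp_minus power_mult_distrib eval_nat_numeral field_simps)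
      \<comment> \<open>Four powers of \<open>u\<close> occur; the seventh power is the generous one
        fixed in \<open>H\<close>.\<close>
      also have "\<dots> \<le> K * (u ^ 7 * exp (- (pi / 2) * T0) / L T0)"
        using u K L0 by (intro mult_left_mono divide_right_mono mult_right_mono power_increasing) auto
      finally show "norm (zeta_kernel x s) \<le> K * H T0" by (simp add: H_def u_def)
    qed
  qed
qed

lemma contour_integral_rectpath:
  assumes "f contour_integrable_on (linepath a (Complex (Re b) (Im a)))"
    and "f contour_integrable_on (linepath (Complex (Re b) (Im a)) b)"
    and "f contour_integrable_on (linepath b (Complex (Re a) (Im b)))"
    and "f contour_integrable_on (linepath (Complex (Re a) (Im b)) a)"
  shows "contour_integral (rectpath a b) f =
     contour_integral (linepath a (Complex (Re b) (Im a))) f + contour_integral (linepath (Complex (Re b) (Im a)) b) f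
     + contour_integral (linepath b (Complex (Re a) (Im b))) f + contour_integral (linepath (Complex (Re a) (Im b)) a) f"
  using assms by (simp add: rectpath_def Let_def contour_integrable_joinI add.assoc)

lemma tendsto_symmetric_integral:
  fixes f :: "real \<Rightarrow> complex"
  assumes f: "has_bochner_integral lborel f I" and T: "filterlim T at_top sequentially"
  shows "(\<lambda>j. integral {- T j..T j} f) \<longlonglongrightarrow> I"
proof -
  have int: "integrable lborel f" using f by (simp add: has_bochner_integral_iff)
  have "(\<lambda>j. LINT t|lborel. indicator {- T j..T j} t *\<^sub>R f t) \<longlonglongrightarrow> (LINT t|lborel. f t)"
  proof (rule integral_dominated_convergence[where w = "\<lambda>t. norm (f t)"])
    show "AE t in lborel. (\<lambda>j. indicator {- T j..T j} t *\<^sub>R f t) \<longlonglongrightarrow> f t"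
    proof (intro AE_I2 tendsto_eventually)
      fix t :: real
      have "\<forall>\<^sub>F j in sequentially. T j \<ge> \<bar>t\<bar>" using T by (auto simp: filterlim_at_top)
      then show "\<forall>\<^sub>F j in sequentially. indicator {- T j..T j} t *\<^sub>R f t = f t"
        by eventually_elim (auto simp: indicator_def)
    qed
  qed (use int in \<open>auto simp: indicator_def\<close>)
  moreover have "(LINT t|lborel. indicator {- T j..T j} t *\<^sub>R f t) = integral {- T j..T j} f" for j
  proof -
    have "set_integrable lborel {- T j..T j} f"
      unfolding set_integrable_def using int by (intro integrable_mult_indicator) auto
    from set_borel_integral_eq_integral(2)[OF this] show ?thesis by (simp add: set_lebesgue_integral_def)
  qed
  ultimately show ?thesis using f by (simp add: has_bochner_integral_iff)
qed

text \<open>The vertical sides are i times integrals over t, which turns 2 * pi * i into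
  \<open>2 * pi\<close>. Each horizontal side has length 13/8, rounded up to 2, and hence
  contributes at most \<open>2 * B\<close>.\<close>

lemma zeta_kernel_residue_theorem:
  assumes x: "x > 0" and T: "T > 0" and nz: "\<And>s. \<bar>Im s\<bar> = T \<Longrightarrow> s \<notin> nontrivial_zeta_zeros"
    and B: "\<And>s. \<bar>Im s\<bar> = T \<Longrightarrow> -1/2 \<le> Re s \<Longrightarrow> Re s \<le> 9/8 \<Longrightarrow> norm (zeta_kernel x s) \<le> B"
  shows "norm (integral {-T..T} (\<lambda>t. zeta_kernel x (Complex (9/8) t)) - integral {-T..T} (\<lambda>t. zeta_kernel x (Complex (-1/2) t))
      - of_real (2 * pi) * (residue (zeta_kernel x) (1/2) + (\<Sum>\<rho>\<in>nontrivial_zeta_zeros_below T. residue (zeta_kernel x) \<rho>))) \<le> 4 * B"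
proof -
  let ?f = "zeta_kernel x"
  \<comment> \<open>The residue theorem needs an open set around the closed rectangle; the zeros
    with heights between \<open>T\<close> and \<open>T + 1\<close> that it brings in have winding
    number 0.\<close>
  define S where "S = box (Complex (-1) (- (T + 1))) (Complex (3/2) (T + 1))"
  define Z where "Z = nontrivial_zeta_zeros_below (T + 1)"
  define a where "a = Complex (-1/2) (-T)"
  define b where "b = Complex (9/8) T"
  have S: "open S" "connected S" unfolding S_def by (auto intro: convex_connected)
  have finZ: "finite Z" unfolding Z_def by (rule finite_nontrivial_zeta_zeros_below)
  have nt: "1/2 \<notin> nontrivial_zeta_zeros"
    using zeta_pre_half riemann_zeta_half_eq by (auto simp: nontrivial_zeta_zeros_def)
  have hol: "?f holomorphic_on S - insert (1/2) Z"
    by (rule holomorphic_on_subset[OF zeta_kernel_holomorphic[OF x]])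
       (auto simp: S_def Z_def in_box_complex_iff nontrivial_zeta_zeros_below_def)
  have on_path: "z \<in> S - insert (1/2) Z \<and> (Re z = -1/2 \<or> Re z = 9/8 \<or> \<bar>Im z\<bar> = T)" if "z \<in> path_image (rectpath a b)" for z
  proof -
    have "(Re z \<in> {-1/2, 9/8} \<and> Im z \<in> {-T..T}) \<or> (Im z \<in> {-T, T} \<and> Re z \<in> {-1/2..9/8})"
      using that T by (subst (asm) path_image_rectpath) (auto simp: a_def b_def)
    then have z: "-1/2 \<le> Re z" "Re z \<le> 9/8" "\<bar>Im z\<bar> \<le> T" "Re z = -1/2 \<or> Re z = 9/8 \<or> \<bar>Im z\<bar> = T"
      using T by auto
    have "z \<notin> nontrivial_zeta_zeros"
    proof
      assume n: "z \<in> nontrivial_zeta_zeros"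
      from z(4) nontrivial_zeta_zeros_Re[OF n] nz[of z] n show False by auto
    qed
    moreover have "z \<noteq> 1/2"
    proof
      assume "z = 1/2"
      then have "Re z = Re (1/2)" "Im z = Im (1/2)" by (simp_all only:)
      with z(4) T show False by auto
    qed
    ultimately show ?thesis using z T by (auto simp: S_def Z_def in_box_complex_iff nontrivial_zeta_zeros_below_def)
  qed
  have sub: "path_image (rectpath a b) \<subseteq> S - insert (1/2) Z" using on_path by blast
  have "contour_integral (rectpath a b) ?f =
      of_real (2 * pi) * \<i> * (\<Sum>p\<in>insert (1/2) Z. winding_number (rectpath a b) p * residue ?f p)"
  proof (rule Residue_theorem[OF S _ hol _ _ sub])
    show "\<forall>z. z \<notin> S \<longrightarrow> winding_number (rectpath a b) z = 0"
    proof (intro allI impI winding_number_rectpath_outside)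
      fix z assume "z \<notin> S"
      then show "z \<notin> cbox a b" using T by (auto simp: S_def a_def b_def in_box_complex_iff in_cbox_complex_iff)
    qed (use T in \<open>auto simp: a_def b_def\<close>)
  qed (use finZ in auto)
  also have "(\<Sum>p\<in>insert (1/2) Z. winding_number (rectpath a b) p * residue ?f p) =
     residue ?f (1/2) + (\<Sum>\<rho>\<in>nontrivial_zeta_zeros_below T. residue ?f \<rho>)"
  proof -
    have w1: "winding_number (rectpath a b) p = 1" if "p \<in> box a b" for p
      using that by (rule winding_number_rectpath)
    have half: "1/2 \<in> box a b" using T by (auto simp: a_def b_def in_box_complex_iff)
    have "1/2 \<notin> Z" using nt by (auto simp: Z_def nontrivial_zeta_zeros_below_def)
    then have "(\<Sum>p\<in>insert (1/2) Z. winding_number (rectpath a b) p * residue ?f p) =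
       residue ?f (1/2) + (\<Sum>p\<in>Z. winding_number (rectpath a b) p * residue ?f p)"
      using finZ w1[OF half] by simp
    also have "(\<Sum>p\<in>Z. winding_number (rectpath a b) p * residue ?f p) = (\<Sum>\<rho>\<in>nontrivial_zeta_zeros_below T. residue ?f \<rho>)"
    proof (rule sum.mono_neutral_cong_right[OF finZ])
      show "nontrivial_zeta_zeros_below T \<subseteq> Z" by (auto simp: Z_def nontrivial_zeta_zeros_below_def)
      show "\<forall>p\<in>Z - nontrivial_zeta_zeros_below T. winding_number (rectpath a b) p * residue ?f p = 0"
      proof
        fix p assume p: "p \<in> Z - nontrivial_zeta_zeros_below T"
        then have "\<bar>Im p\<bar> > T" using nz[of p] by (force simp: Z_def nontrivial_zeta_zeros_below_def)
        then have "p \<notin> cbox a b" by (auto simp: a_def b_def in_cbox_complex_iff)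
        then show "winding_number (rectpath a b) p * residue ?f p = 0"
          using T by (subst winding_number_rectpath_outside) (auto simp: a_def b_def)
      qed
      fix p assume "p \<in> nontrivial_zeta_zeros_below T"
      then have "p \<in> box a b" using nontrivial_zeta_zeros_Re[of p]
        by (auto simp: nontrivial_zeta_zeros_below_def a_def b_def in_box_complex_iff)
      then show "winding_number (rectpath a b) p * residue ?f p = residue ?f p" using w1 by simp
    qed
    finally show ?thesis .
  qed
  finally have res: "contour_integral (rectpath a b) ?f = of_real (2 * pi) * \<i> *
      (residue ?f (1/2) + (\<Sum>\<rho>\<in>nontrivial_zeta_zeros_below T. residue ?f \<rho>))" .
  have cont: "continuous_on (path_image (rectpath a b)) ?f"
    by (rule holomorphic_on_imp_continuous_on, rule holomorphic_on_subset[OF hol sub])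
  have pts: "Complex (Re b) (Im a) = Complex (9/8) (-T)" "Complex (Re a) (Im b) = Complex (-1/2) T"
    by (simp_all add: a_def b_def)
  have segs: "path_image (rectpath a b) =
     closed_segment a (Complex (9/8) (-T)) \<union> closed_segment (Complex (9/8) (-T)) b \<union>
     closed_segment b (Complex (-1/2) T) \<union> closed_segment (Complex (-1/2) T) a"
    unfolding rectpath_def Let_def pts by (simp add: path_image_join Un_assoc)
  have ci: "?f contour_integrable_on linepath a (Complex (9/8) (-T))" "?f contour_integrable_on linepath (Complex (9/8) (-T)) b"
     "?f contour_integrable_on linepath b (Complex (-1/2) T)" "?f contour_integrable_on linepath (Complex (-1/2) T) a"
    using cont unfolding segs by (auto intro!: contour_integrable_continuous_linepath intro: continuous_on_subset)
  have split: "contour_integral (rectpath a b) ?f =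
     contour_integral (linepath a (Complex (9/8) (-T))) ?f + contour_integral (linepath (Complex (9/8) (-T)) b) ?f
     + contour_integral (linepath b (Complex (-1/2) T)) ?f + contour_integral (linepath (Complex (-1/2) T) a) ?f"
    using contour_integral_rectpath[of ?f a b] ci unfolding pts by simp
  have r: "contour_integral (linepath (Complex (9/8) (-T)) b) ?f = \<i> * integral {-T..T} (\<lambda>t. ?f (Complex (9/8) t))"
    by (rule contour_integral_linepath_same_Re) (use T in \<open>auto simp: b_def\<close>)
  have "contour_integral (linepath a (Complex (-1/2) T)) ?f = \<i> * integral {-T..T} (\<lambda>t. ?f (Complex (-1/2) t))"
    by (rule contour_integral_linepath_same_Re) (use T in \<open>auto simp: a_def\<close>)
  moreover have "contour_integral (linepath (Complex (-1/2) T) a) ?f = - contour_integral (linepath a (Complex (-1/2) T)) ?f"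
    by (rule contour_integral_reverse_linepath)
       (rule continuous_on_subset[OF cont], auto simp: segs closed_segment_commute)
  ultimately have l: "contour_integral (linepath (Complex (-1/2) T) a) ?f = - \<i> * integral {-T..T} (\<lambda>t. ?f (Complex (-1/2) t))" by simp
  have B0: "B \<ge> 0" using order.trans[OF norm_ge_zero B[of "Complex 0 T"]] T by simp
  have seg: "\<bar>Im z\<bar> = T \<and> -1/2 \<le> Re z \<and> Re z \<le> 9/8"
    if "z \<in> closed_segment a (Complex (9/8) (-T)) \<or> z \<in> closed_segment b (Complex (-1/2) T)" for z
    using that T by (auto simp: a_def b_def closed_segment_same_Im closed_segment_eq_real_ivl)
  have h1: "norm (contour_integral (linepath a (Complex (9/8) (-T))) ?f) \<le> B * norm (Complex (9/8) (-T) - a)"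
    by (rule contour_integral_bound_linepath[OF ci(1) B0]) (use B seg in blast)
  have h2: "norm (contour_integral (linepath b (Complex (-1/2) T)) ?f) \<le> B * norm (Complex (-1/2) T - b)"
    by (rule contour_integral_bound_linepath[OF ci(3) B0]) (use B seg in blast)
  have n1: "norm (Complex (9/8) (-T) - a) \<le> 2" "norm (Complex (-1/2) T - b) \<le> 2"
    using cmod_le[of "Complex (9/8) (-T) - a"] cmod_le[of "Complex (-1/2) T - b"] by (auto simp: a_def b_def)
  define D where "D = integral {-T..T} (\<lambda>t. ?f (Complex (9/8) t)) - integral {-T..T} (\<lambda>t. ?f (Complex (-1/2) t))
      - of_real (2 * pi) * (residue ?f (1/2) + (\<Sum>\<rho>\<in>nontrivial_zeta_zeros_below T. residue ?f \<rho>))"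
  have "\<i> * D = - (contour_integral (linepath a (Complex (9/8) (-T))) ?f + contour_integral (linepath b (Complex (-1/2) T)) ?f)"
    using split unfolding res r l D_def by (simp add: algebra_simps)
  then have "norm D = norm (contour_integral (linepath a (Complex (9/8) (-T))) ?f + contour_integral (linepath b (Complex (-1/2) T)) ?f)"
    by (metis norm_ii norm_minus_cancel norm_mult mult_1)
  also have "\<dots> \<le> B * 2 + B * 2"
    using h1 h2 mult_left_mono[OF n1(1) B0] mult_left_mono[OF n1(2) B0] by (intro norm_triangle_le) linarith
  finally show ?thesis unfolding D_def by simp
qed

theorem theorem2p8:
  fixes x :: real
  assumes "x > 0"
    and simple_zeros: "\<forall>\<rho>\<in>nontrivial_zeta_zeros. zorder riemann_zeta \<rho> = 1"
  shows "summable (\<lambda>n. real_of_int (liouville (Suc n)) / (real (Suc n) * (x\<^sup>2 + (real (Suc n))\<^sup>2))) \<and>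
    summable (\<lambda>n. real_of_int (c_coeff (Suc n)) / sqrt (2 * real (Suc n)) * exp (- pi * real (Suc n) * x / 2)) \<and>
    (\<exists>T :: nat \<Rightarrow> real.
      (\<forall>j. T j > 0) \<and> filterlim T at_top sequentially \<and>
      (\<forall>j. finite (nontrivial_zeta_zeros_below (T j))) \<and>
      convergent (\<lambda>j. \<Sum>\<rho>\<in>nontrivial_zeta_zeros_below (T j).
        riemann_zeta (2 * \<rho> - 1) * Gamma (2 * \<rho> - 1) /
        (deriv riemann_zeta \<rho> * Gamma \<rho> * complex_of_real (2 * pi * x) powr \<rho>)) \<and>
      complex_of_real (\<Sum>n. real_of_int (liouville (Suc n)) / (real (Suc n) * (x\<^sup>2 + (real (Suc n))\<^sup>2))) =
        - complex_of_real (pi * x powr (- 5 / 2) *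
            (\<Sum>n. real_of_int (c_coeff (Suc n)) / sqrt (2 * real (Suc n)) * exp (- pi * real (Suc n) * x / 2)))
        - complex_of_real (pi * x powr (- 5 / 2)) / (complex_of_real (2 * sqrt 2) * riemann_zeta (1 / 2))
        + complex_of_real (2 * pi\<^sup>2 / x\<^sup>2) *
            lim (\<lambda>j. \<Sum>\<rho>\<in>nontrivial_zeta_zeros_below (T j).
              riemann_zeta (2 * \<rho> - 1) * Gamma (2 * \<rho> - 1) /
              (deriv riemann_zeta \<rho> * Gamma \<rho> * complex_of_real (2 * pi * x) powr \<rho>)))"
proof -
  define a where "a n = real_of_int (liouville (Suc n)) / (real (Suc n) * (x\<^sup>2 + (real (Suc n))\<^sup>2))" for n
  define c where "c n = real_of_int (c_coeff (Suc n)) / sqrt (2 * real (Suc n)) * exp (- pi * real (Suc n) * x / 2)" for n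
  define t where "t \<rho> = riemann_zeta (2 * \<rho> - 1) * Gamma (2 * \<rho> - 1) /
        (deriv riemann_zeta \<rho> * Gamma \<rho> * complex_of_real (2 * pi * x) powr \<rho>)" for \<rho>
  have x: "x > 0" by fact
  have res: "residue (zeta_kernel x) \<rho> = t \<rho>" if "\<rho> \<in> nontrivial_zeta_zeros" for \<rho>
    unfolding t_def using x that simple_zeros by (intro residue_zeta_kernel_zero) auto
  obtain K H where K: "K > 0" and H: "\<And>T0. T0 \<ge> 5 \<Longrightarrow> \<exists>T. T0 \<le> T \<and> T \<le> T0 + 1 \<and>
      (\<forall>s. \<bar>Im s\<bar> = T \<longrightarrow> -1/2 \<le> Re s \<longrightarrow> Re s \<le> 9/8 \<longrightarrow>
         zeta_pre (1 - s) \<noteq> 0 \<and> norm (zeta_kernel x s) \<le> K * H T0)" and H0: "(H \<longlongrightarrow> 0) at_top"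
    using zeta_kernel_horizontal_bound[OF x] by blast
  \<comment> \<open>Starting the search at \<open>j + 5\<close> meets the threshold 5 of the
    estimate and forces the heights to infinity.\<close>
  have "\<exists>T. real j + 5 \<le> T \<and> (\<forall>s. \<bar>Im s\<bar> = T \<longrightarrow> -1/2 \<le> Re s \<longrightarrow> Re s \<le> 9/8 \<longrightarrow>
         zeta_pre (1 - s) \<noteq> 0 \<and> norm (zeta_kernel x s) \<le> K * H (real j + 5))" for j :: nat
    using H[of "real j + 5"] by auto
  then obtain T where T: "\<And>j::nat. real j + 5 \<le> T j"
    and bound: "\<And>j s. \<bar>Im s\<bar> = T j \<Longrightarrow> -1/2 \<le> Re s \<Longrightarrow> Re s \<le> 9/8 \<Longrightarrow>
         zeta_pre (1 - s) \<noteq> 0 \<and> norm (zeta_kernel x s) \<le> K * H (real j + 5)"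
    by metis
  have Tpos: "T j > 0" for j using T[of j] by (meson add_nonneg_pos less_le_trans of_nat_0_le_iff zero_less_numeral)
  have Tlim: "filterlim T at_top sequentially"
  proof (rule filterlim_at_top_mono)
    show "filterlim (\<lambda>j::nat. real j + 5) at_top sequentially" by real_asymp
  qed (use T in auto)
  \<comment> \<open>The estimate covers only real parts from -1/2 to 9/8, but all non-trivial zeros
    have real part in the interval from 0 to 1.\<close>
  have off: "s \<notin> nontrivial_zeta_zeros" if "\<bar>Im s\<bar> = T j" for s j
    using bound[OF that] nontrivial_zeta_zeros_Re[of s] zeta_pre_reflected_zero[of s] by force
  define S where "S j = (\<Sum>\<rho>\<in>nontrivial_zeta_zeros_below (T j). t \<rho>)" for j
  define R where "R = - 1 / (of_real (4 * pi * sqrt 2 * sqrt x) * riemann_zeta (1/2))"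
  define I1 where "I1 j = integral {- T j..T j} (\<lambda>t. zeta_kernel x (Complex (9/8) t))" for j
  define I2 where "I2 j = integral {- T j..T j} (\<lambda>t. zeta_kernel x (Complex (-1/2) t))" for j
  have S_eq: "(\<Sum>\<rho>\<in>nontrivial_zeta_zeros_below (T j). residue (zeta_kernel x) \<rho>) = S j" for j
    unfolding S_def by (intro sum.cong res) (auto simp: nontrivial_zeta_zeros_below_def)
  have err: "norm (I1 j - I2 j - of_real (2 * pi) * (R + S j)) \<le> 4 * (K * H (real j + 5))" for j
    unfolding S_eq[symmetric] I1_def I2_def R_def residue_zeta_kernel_half[OF x, symmetric]
    by (rule zeta_kernel_residue_theorem[OF x Tpos]) (use off bound in auto)
  have "filterlim (\<lambda>j::nat. real j + 5) at_top sequentially" by real_asymp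
  then have "(\<lambda>j. H (real j + 5)) \<longlonglongrightarrow> 0" by (rule filterlim_compose[OF H0])
  then have "(\<lambda>j. 4 * (K * H (real j + 5))) \<longlonglongrightarrow> 4 * (K * 0)" by (intro tendsto_intros)
  then have err0: "(\<lambda>j. 4 * (K * H (real j + 5))) \<longlonglongrightarrow> 0" by simp
  have D0: "(\<lambda>j. I1 j - I2 j - of_real (2 * pi) * (R + S j)) \<longlonglongrightarrow> 0"
    by (rule Lim_null_comparison[OF always_eventually err0]) (use err in blast)
  have L1: "I1 \<longlonglongrightarrow> of_real (1 / sqrt x * suminf c)"
    unfolding I1_def c_def by (rule tendsto_symmetric_integral[OF zeta_kernel_right(2)[OF x] Tlim])
  have L2: "I2 \<longlonglongrightarrow> of_real (- (x\<^sup>2 / pi) * suminf a)"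
    unfolding I2_def a_def by (rule tendsto_symmetric_integral[OF zeta_kernel_left(2)[OF x] Tlim])
  define S' where "S' = (of_real (1 / sqrt x * suminf c) - of_real (- (x\<^sup>2 / pi) * suminf a)) / of_real (2 * pi) - R"
  \<comment> \<open>This expression is \<open>S j\<close> itself, recovered from the two vertical
    integrals and the error, so that the convergence of the sum over the zeros is a
    conclusion.\<close>
  have "(\<lambda>j. (I1 j - I2 j - (I1 j - I2 j - of_real (2 * pi) * (R + S j))) / of_real (2 * pi) - R) \<longlonglongrightarrow>
     (of_real (1 / sqrt x * suminf c) - of_real (- (x\<^sup>2 / pi) * suminf a) - 0) / of_real (2 * pi) - R"
    by (intro tendsto_intros L1 L2 D0) auto
  then have S: "S \<longlonglongrightarrow> S'" by (simp add: S'_def)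
  have conv: "convergent S" "lim S = S'" using S by (auto simp: convergent_def limI)
  have final: "complex_of_real (suminf a) =
        - complex_of_real (pi * x powr (- 5 / 2) * suminf c)
        - complex_of_real (pi * x powr (- 5 / 2)) / (complex_of_real (2 * sqrt 2) * riemann_zeta (1 / 2))
        + complex_of_real (2 * pi\<^sup>2 / x\<^sup>2) * lim S"
  proof -
    have z: "riemann_zeta (1/2) \<noteq> 0" using riemann_zeta_half_eq zeta_pre_half by simp
    have "x powr (- 5 / 2) = x powr (- 2) * x powr (- (1 / 2))" by (simp flip: powr_add)
    also have "\<dots> = 1 / (x\<^sup>2 * sqrt x)"
      using x by (simp add: powr_minus_divide powr_half_sqrt)
    finally have p: "x powr (- 5 / 2) = 1 / (x\<^sup>2 * sqrt x)" .
    \<comment> \<open>Solving the limit identity for the Liouville sum: the factor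
      \<open>2 * p\<^sup>2 / y\<^sup>2\<close> undoes the factor \<open>y\<^sup>2 / p\<close> of the
      left line together with the division by \<open>2 * p\<close>.\<close>
    have alg: "A = - (p * (1 / (y\<^sup>2 * q)) * C) - p * (1 / (y\<^sup>2 * q)) / (2 * w * z)
        + 2 * p\<^sup>2 / y\<^sup>2 * ((1 / q * C - (- (y\<^sup>2 / p) * A)) / (2 * p) - - 1 / (4 * p * w * q * z))"
      if "p \<noteq> 0" "y \<noteq> 0" "q \<noteq> 0" "w \<noteq> 0" "z \<noteq> 0" for A C p y q w z :: complex
      using that by (simp add: field_simps power2_eq_square)
    show ?thesis
      unfolding conv(2) S'_def R_def p
      using alg[of "of_real pi" "of_real x" "of_real (sqrt x)" "of_real (sqrt 2)" "riemann_zeta (1/2)" "of_real (suminf a)" "of_real (suminf c)"] x z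
      by simp
  qed
  show ?thesis
    using zeta_kernel_left(1)[OF x] zeta_kernel_right(1)[OF x] Tpos Tlim finite_nontrivial_zeta_zeros_below conv(1) final
    unfolding a_def[symmetric] c_def[symmetric] t_def[symmetric] S_def[abs_def, symmetric]
    by (intro conjI exI[of _ T]) (auto simp: S_def[abs_def, symmetric])
qed

end
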